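(* Let $\mathcal{F}_t$ be a smooth $1$-parameter family of smooth codimension $q$ foliations with oriented normal bundles on a smooth manifold $M$, with smooth families of defining $q$-forms $\alpha=\alpha(t)$ and of $1$-forms $\beta=\beta(t)$ satisfying $d\alpha=\alpha\wedge\beta$. Then for every $t$, the $(2q+1)$-form $(\dot\beta\wedge(d\beta)^q)(t)$ is in $\mathcal{I}(\mathcal{F}_t)$. It is closed, and its cohomology class $T(\mathcal{F}_t)\in H^{2q+1}(\mathcal{I}(\mathcal{F}_t))$ is a well-defined invariant of the family $\mathcal{F}_t$ (independent of the choices of $\alpha$ and $\beta$). If $q\geq 2$, then $T(\mathcal{F}_t)=\frac{1}{q+1}\frac{d}{dt}GV(\mathcal{F}_t)\in H^{2q+1}(\mathcal{I}(\mathcal{F}_t))$. The product of $T(\mathcal{F}_t)$ with the Reeb class is a well-defined cohomology class $TGV(\mathcal{F}_t)\in H^{2q+2}(\mathcal{I}(\mathcal{F}_t))$ represented by $(\dot\beta\wedge\beta\wedge(d\beta)^q)(t)$, up to sign.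
   Context: All manifolds, foliations, forms and families are of class $C^\infty$; a dot denotes the derivative with respect to $t$ and $d$ the exterior derivative on $M$. A codimension $q$ foliation $\mathcal{F}$ with oriented normal bundle is defined by a nowhere vanishing, locally decomposable $q$-form $\alpha=\alpha_1\wedge\ldots\wedge\alpha_q$ (locally, with $\bigcap_i\ker\alpha_i=T\mathcal{F}$), positive with respect to the orientation of the normal bundle; any two such forms differ by a positive function. There is a $1$-form $\beta$ with $d\alpha=\alpha\wedge\beta$. $\mathcal{I}(\mathcal{F})\subset\Omega^*(M)$ is the graded differential ideal of forms which vanish when evaluated on tuples of vectors all tangent to $\mathcal{F}$; all $(q+1)$-fold products of elements of $\mathcal{I}(\mathcal{F})$ vanish. $H^*(\mathcal{I}(\mathcal{F}))$ is its cohomology under $d$, and $H^*(\mathcal{F})$ is the cohomology of the quotient complex $\Omega^*(M)/\mathcal{I}(\mathcal{F})$. The form $d\beta$ lies in $\mathcal{I}(\mathcal{F})$, so $\beta$ defines a class in $H^1(\mathcal{F})$, the Reeb class of $\mathcal{F}$, independent of the choices of $\alpha$ and $\beta$. A closed form that is a $q$-fold product of elements of $\mathcal{I}(\mathcal{F})$ has closed wedge product with $\beta$; the product of its class with the Reeb class means the class of this wedge product in $H^*(\mathcal{I}(\mathcal{F}))$. Thus the product of $T(\mathcal{F}_t)$ with the Reeb class is the class of the wedge product of $\dot\beta\wedge(d\beta)^q$ with $\beta$, and well-defined means independent of the choices of $\alpha$ and $\beta$. The Godbillon-Vey class $GV(\mathcal{F})$ is the class of $\beta\wedge(d\beta)^q$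 (in $H^{2q+1}(\mathcal{I}(\mathcal{F}))$ or, after mapping, in $H^{2q+1}(M,\mathbb{R})$), independent of choices. In the statement for $q\geq 2$, $\frac{d}{dt}GV(\mathcal{F}_t)$ denotes the class in $H^{2q+1}(\mathcal{I}(\mathcal{F}_t))$ represented by the form $\frac{d}{dt}\left(\beta\wedge(d\beta)^q\right)$. *)

theory Defs
  imports "HOL-Analysis.Analysis" "HOL-Library.Function_Algebras"
begin

(* Meant for open S only. *)
primrec Ck_on :: "nat \<Rightarrow> ('v::real_normed_vector \<Rightarrow> 'w::real_normed_vector) \<Rightarrow> 'v set \<Rightarrow> bool" where
  "Ck_on 0 f S \<longleftrightarrow> continuous_on S f"
| "Ck_on (Suc k) f S \<longleftrightarrow> (\<forall>x\<in>S. f differentiable (at x)) \<and>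
     (\<forall>v. Ck_on k (\<lambda>x. frechet_derivative f (at x) v) S)"

definition smooth_on :: "('v::real_normed_vector \<Rightarrow> 'w::real_normed_vector) \<Rightarrow> 'v set \<Rightarrow> bool" where
  "smooth_on f S \<longleftrightarrow> (\<forall>k. Ck_on k f S)"

(* A chart (U, \<phi>) has domain U; the values of \<phi> outside U are irrelevant. *)
type_synonym ('a, 'e) chart = "'a set \<times> ('a \<Rightarrow> 'e)"

definition im :: "('a, 'e) chart \<Rightarrow> 'e set" where
  "im c = snd c ` fst c"

definition transition :: "('a, 'e) chart \<Rightarrow> ('a, 'e) chart \<Rightarrow> 'e \<Rightarrow> 'e" where
  "transition c c' = snd c' \<circ> inv_into (fst c) (snd c)"

definition is_chart :: "'a topology \<Rightarrow> ('a, 'e::euclidean_space) chart \<Rightarrow> bool" where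
  "is_chart M c \<longleftrightarrow> openin M (fst c) \<and> open (im c) \<and>
     homeomorphic_map (subtopology M (fst c)) (top_of_set (im c)) (snd c)"

definition compatible :: "('a, 'e::euclidean_space) chart \<Rightarrow> ('a, 'e) chart \<Rightarrow> bool" where
  "compatible c c' \<longleftrightarrow>
     smooth_on (transition c c') (snd c ` (fst c \<inter> fst c')) \<and>
     smooth_on (transition c' c) (snd c' ` (fst c \<inter> fst c'))"

(* A smooth structure is a maximal smooth atlas; the dimension of M is DIM('e). *)
definition smooth_manifold :: "'a topology \<Rightarrow> ('a, 'e::euclidean_space) chart set \<Rightarrow> bool" where
  "smooth_manifold M A \<longleftrightarrow>
     Hausdorff_space M \<and> second_countable M \<and>
     (\<forall>c\<in>A. is_chart M c) \<and> (\<Union>c\<in>A. fst c) = topspace M \<and>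
     (\<forall>c\<in>A. \<forall>c'\<in>A. compatible c c') \<and>
     (\<forall>c. is_chart M c \<and> (\<forall>c'\<in>A. compatible c c') \<longrightarrow> c \<in> A)"

definition tangent_map :: "('a, 'e::euclidean_space) chart \<Rightarrow> ('a, 'e) chart \<Rightarrow> 'a \<Rightarrow> 'e \<Rightarrow> 'e" where
  "tangent_map c c' p = frechet_derivative (transition c c') (at (snd c p))"

(* The homogeneous elements of degree k are supported on lists of length k (see alt_form),
   so that degrees need not be passed to the operations. *)
type_synonym 'e ext = "'e list \<Rightarrow> real"

definition alt_form :: "nat \<Rightarrow> 'e::real_vector ext \<Rightarrow> bool" where
  "alt_form k f \<longleftrightarrow>
     (\<forall>vs. length vs \<noteq> k \<longrightarrow> f vs = 0) \<and>
     (\<forall>vs. \<forall>i<k. length vs = k \<longrightarrow> linear (\<lambda>v. f (vs[i := v]))) \<and>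
     (\<forall>vs. \<forall>i<k. \<forall>j<k. length vs = k \<and> i \<noteq> j \<and> vs ! i = vs ! j \<longrightarrow> f vs = 0)"

(* Normalised such that a wedge product of q covectors is the determinant of their values. *)
definition wedge :: "'e ext \<Rightarrow> 'e ext \<Rightarrow> 'e ext" where
  "wedge f g vs = (let n = length vs in
     \<Sum>k\<le>n. (\<Sum>\<sigma> | \<sigma> permutes {..<n}. of_int (sign \<sigma>) *
         f (map (\<lambda>i. vs ! \<sigma> i) [0..<k]) * g (map (\<lambda>i. vs ! \<sigma> i) [k..<n]))
       / (fact k * fact (n - k)))"

definition ext_one :: "'e ext" where
  "ext_one vs = (if vs = [] then 1 else 0)"

definition wedge_list :: "'e ext list \<Rightarrow> 'e ext" where
  "wedge_list as = foldr wedge as ext_one"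

definition common_kernel :: "'e ext list \<Rightarrow> 'e set" where
  "common_kernel as = {v. \<forall>a\<in>set as. a [v] = 0}"

definition smooth_ext_on :: "nat \<Rightarrow> 'p::real_normed_vector set \<Rightarrow> ('p \<Rightarrow> 'e::real_vector ext) \<Rightarrow> bool" where
  "smooth_ext_on k N a \<longleftrightarrow> (\<forall>z\<in>N. alt_form k (a z)) \<and> (\<forall>vs. smooth_on (\<lambda>z. a z vs) N)"

(* A differential form is given by its representations in all charts, which have to be related
   by pullback along the transition maps.  They are extended by 0, so that equality of forms is
   equality of functions. *)
type_synonym ('a, 'e) dform = "('a, 'e) chart \<Rightarrow> 'e \<Rightarrow> 'e ext"

definition form :: "('a, 'e::euclidean_space) chart set \<Rightarrow> nat \<Rightarrow> ('a, 'e) dform \<Rightarrow> bool" where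
  "form A k \<omega> \<longleftrightarrow>
     (\<forall>c x vs. c \<notin> A \<or> x \<notin> im c \<longrightarrow> \<omega> c x vs = 0) \<and>
     (\<forall>c\<in>A. smooth_ext_on k (im c) (\<omega> c)) \<and>
     (\<forall>c\<in>A. \<forall>c'\<in>A. \<forall>p \<in> fst c \<inter> fst c'. \<forall>vs.
        \<omega> c (snd c p) vs = \<omega> c' (snd c' p) (map (tangent_map c c' p) vs))"

definition form_scale :: "real \<Rightarrow> ('a, 'e) dform \<Rightarrow> ('a, 'e) dform" where
  "form_scale r \<omega> c x vs = r * \<omega> c x vs"

definition fwedge :: "('a, 'e) dform \<Rightarrow> ('a, 'e) dform \<Rightarrow> ('a, 'e) dform" where
  "fwedge \<omega> \<eta> c x = wedge (\<omega> c x) (\<eta> c x)"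

definition form_one :: "('a, 'e) chart set \<Rightarrow> ('a, 'e) dform" where
  "form_one A c x vs = (if c \<in> A \<and> x \<in> im c then ext_one vs else 0)"

definition form_pow :: "('a, 'e) chart set \<Rightarrow> ('a, 'e) dform \<Rightarrow> nat \<Rightarrow> ('a, 'e) dform" where
  "form_pow A \<omega> n = (fwedge \<omega> ^^ n) (form_one A)"

(* take i vs @ drop (Suc i) vs omits the i-th vector *)
definition ext_d :: "('a, 'e::euclidean_space) dform \<Rightarrow> ('a, 'e) dform" where
  "ext_d \<omega> c x vs = (if x \<in> im c then
     (\<Sum>i<length vs. (-1) ^ i *
        frechet_derivative (\<lambda>y. \<omega> c y (take i vs @ drop (Suc i) vs)) (at x) (vs ! i))
     else 0)"

definition smooth_form_family ::
  "('a, 'e::euclidean_space) chart set \<Rightarrow> nat \<Rightarrow> real set \<Rightarrow> (real \<Rightarrow> ('a, 'e) dform) \<Rightarrow> bool" where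
  "smooth_form_family A k J \<omega> \<longleftrightarrow>
     (\<forall>t\<in>J. form A k (\<omega> t)) \<and>
     (\<forall>c\<in>A. smooth_ext_on k (J \<times> im c) (\<lambda>(t, x). \<omega> t c x))"

definition form_dt :: "(real \<Rightarrow> ('a, 'e) dform) \<Rightarrow> real \<Rightarrow> ('a, 'e) dform" where
  "form_dt \<omega> t c x vs = deriv (\<lambda>s. \<omega> s c x vs) t"

(* tangent F c x is the tangent space of the leaf through x in the chart c.  An orientation of the
   normal bundle is recorded by pos_tuples F c x, the set of those q-tuples of vectors that project
   to positive bases of the normal space.  Values are meaningful only for x in im c. *)
record ('a, 'e) foliation =
  tangent :: "('a, 'e) chart \<Rightarrow> 'e \<Rightarrow> 'e set"
  pos_tuples :: "('a, 'e) chart \<Rightarrow> 'e \<Rightarrow> 'e list set"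

(* The covectors as trivialise the normal space compatibly with its orientation. *)
definition oriented_coframe ::
  "nat \<Rightarrow> ('a, 'e::euclidean_space) foliation \<Rightarrow> ('a, 'e) chart \<Rightarrow> 'e \<Rightarrow> 'e ext list \<Rightarrow> bool" where
  "oriented_coframe q F c x as \<longleftrightarrow>
     length as = q \<and> (\<forall>a\<in>set as. alt_form 1 a) \<and> (\<exists>vs. wedge_list as vs \<noteq> 0) \<and>
     tangent F c x = common_kernel as \<and>
     pos_tuples F c x = {vs. 0 < wedge_list as vs}"

(* Foliated charts: tangent spaces and normal orientations are constant in the chart, so that the
   plaques are open pieces of parallel affine subspaces of codimension q. *)
definition oriented_foliation ::
  "'a topology \<Rightarrow> ('a, 'e::euclidean_space) chart set \<Rightarrow> nat \<Rightarrow> ('a, 'e) foliation \<Rightarrow> bool" where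
  "oriented_foliation M A q F \<longleftrightarrow>
     (\<forall>p\<in>topspace M. \<exists>c\<in>A. p \<in> fst c \<and> (\<exists>as. \<forall>x\<in>im c. oriented_coframe q F c x as)) \<and>
     (\<forall>c\<in>A. \<forall>c'\<in>A. \<forall>p \<in> fst c \<inter> fst c'.
        tangent F c' (snd c' p) = tangent_map c c' p ` tangent F c (snd c p) \<and>
        pos_tuples F c' (snd c' p) = map (tangent_map c c' p) ` pos_tuples F c (snd c p))"

definition smooth_foliation_family ::
  "'a topology \<Rightarrow> ('a, 'e::euclidean_space) chart set \<Rightarrow> nat \<Rightarrow> real set \<Rightarrow>
   (real \<Rightarrow> ('a, 'e) foliation) \<Rightarrow> bool" where
  "smooth_foliation_family M A q J F \<longleftrightarrow>
     (\<forall>t\<in>J. oriented_foliation M A q (F t)) \<and>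
     (\<forall>c\<in>A. \<forall>t0\<in>J. \<forall>x0\<in>im c. \<exists>N as. open N \<and> (t0, x0) \<in> N \<and> N \<subseteq> J \<times> im c \<and>
        (\<forall>a\<in>set as. smooth_ext_on 1 N a) \<and>
        (\<forall>(t, x)\<in>N. oriented_coframe q (F t) c x (map (\<lambda>a. a (t, x)) as)))"

definition defining_form ::
  "('a, 'e::euclidean_space) chart set \<Rightarrow> nat \<Rightarrow> ('a, 'e) foliation \<Rightarrow> ('a, 'e) dform \<Rightarrow> bool" where
  "defining_form A q F \<alpha> \<longleftrightarrow>
     form A q \<alpha> \<and>
     (\<forall>c\<in>A. \<forall>x\<in>im c. \<exists>vs. \<alpha> c x vs \<noteq> 0) \<and>
     (\<forall>c\<in>A. \<forall>x\<in>im c. \<forall>vs\<in>pos_tuples F c x. 0 < \<alpha> c x vs) \<and>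
     (\<forall>c\<in>A. \<forall>x0\<in>im c. \<exists>N as. open N \<and> x0 \<in> N \<and> N \<subseteq> im c \<and> length as = q \<and>
        (\<forall>a\<in>set as. smooth_ext_on 1 N a) \<and>
        (\<forall>x\<in>N. \<alpha> c x = wedge_list (map (\<lambda>a. a x) as) \<and>
                tangent F c x = common_kernel (map (\<lambda>a. a x) as)))"

definition defining_family ::
  "('a, 'e::euclidean_space) chart set \<Rightarrow> nat \<Rightarrow> real set \<Rightarrow> (real \<Rightarrow> ('a, 'e) foliation) \<Rightarrow>
   (real \<Rightarrow> ('a, 'e) dform) \<Rightarrow> (real \<Rightarrow> ('a, 'e) dform) \<Rightarrow> bool" where
  "defining_family A q J F \<alpha> \<beta> \<longleftrightarrow>
     smooth_form_family A q J \<alpha> \<and> smooth_form_family A 1 J \<beta> \<and>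
     (\<forall>t\<in>J. defining_form A q (F t) (\<alpha> t) \<and> ext_d (\<alpha> t) = fwedge (\<alpha> t) (\<beta> t))"

definition ideal ::
  "('a, 'e::euclidean_space) chart set \<Rightarrow> ('a, 'e) foliation \<Rightarrow> nat \<Rightarrow> ('a, 'e) dform set" where
  "ideal A F k = {\<omega>. form A k \<omega> \<and>
     (\<forall>c\<in>A. \<forall>x\<in>im c. \<forall>vs. length vs = k \<and> set vs \<subseteq> tangent F c x \<longrightarrow> \<omega> c x vs = 0)}"

definition cocycles ::
  "('a, 'e::euclidean_space) chart set \<Rightarrow> ('a, 'e) foliation \<Rightarrow> nat \<Rightarrow> ('a, 'e) dform set" where
  "cocycles A F k = {\<omega> \<in> ideal A F k. ext_d \<omega> = 0}"

definition coboundaries ::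
  "('a, 'e::euclidean_space) chart set \<Rightarrow> ('a, 'e) foliation \<Rightarrow> nat \<Rightarrow> ('a, 'e) dform set" where
  "coboundaries A F k = (case k of 0 \<Rightarrow> {0} | Suc j \<Rightarrow> ext_d ` ideal A F j)"

definition cohomologous ::
  "('a, 'e::euclidean_space) chart set \<Rightarrow> ('a, 'e) foliation \<Rightarrow> nat \<Rightarrow> ('a, 'e) dform rel" where
  "cohomologous A F k =
     {(\<omega>, \<eta>). \<omega> \<in> cocycles A F k \<and> \<eta> \<in> cocycles A F k \<and> \<eta> - \<omega> \<in> coboundaries A F k}"

definition coh ::
  "('a, 'e::euclidean_space) chart set \<Rightarrow> ('a, 'e) foliation \<Rightarrow> nat \<Rightarrow> ('a, 'e) dform set set" where
  "coh A F k = cocycles A F k // cohomologous A F k"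

(* This is an element of coh A F k precisely if \<omega> is a cocycle, and empty otherwise. *)
definition coh_class ::
  "('a, 'e::euclidean_space) chart set \<Rightarrow> ('a, 'e) foliation \<Rightarrow> nat \<Rightarrow> ('a, 'e) dform \<Rightarrow> ('a, 'e) dform set" where
  "coh_class A F k \<omega> = cohomologous A F k `` {\<omega>}"

definition coh_scale ::
  "('a, 'e::euclidean_space) chart set \<Rightarrow> ('a, 'e) foliation \<Rightarrow> nat \<Rightarrow> real \<Rightarrow>
   ('a, 'e) dform set \<Rightarrow> ('a, 'e) dform set" where
  "coh_scale A F k r C = (\<Union>\<omega>\<in>C. coh_class A F k (form_scale r \<omega>))"

(* The cohomology of the quotient complex of all forms by the ideal is expressed by
   representatives in the complex of all forms. *)
definition quot_cocycles ::
  "('a, 'e::euclidean_space) chart set \<Rightarrow> ('a, 'e) foliation \<Rightarrow> nat \<Rightarrow> ('a, 'e) dform set" where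
  "quot_cocycles A F k = {\<omega>. form A k \<omega> \<and> ext_d \<omega> \<in> ideal A F (Suc k)}"

definition quot_coboundaries ::
  "('a, 'e::euclidean_space) chart set \<Rightarrow> ('a, 'e) foliation \<Rightarrow> nat \<Rightarrow> ('a, 'e) dform set" where
  "quot_coboundaries A F k = {\<eta> + \<theta> | \<eta> \<theta>. \<eta> \<in> ideal A F k \<and>
     \<theta> \<in> (case k of 0 \<Rightarrow> {0} | Suc j \<Rightarrow> ext_d ` {\<zeta>. form A j \<zeta>})}"

definition quot_class ::
  "('a, 'e::euclidean_space) chart set \<Rightarrow> ('a, 'e) foliation \<Rightarrow> nat \<Rightarrow> ('a, 'e) dform \<Rightarrow> ('a, 'e) dform set" where
  "quot_class A F k \<omega> =
     {(\<omega>, \<rho>). \<omega> \<in> quot_cocycles A F k \<and> \<rho> \<in> quot_cocycles A F k \<and>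
        \<rho> - \<omega> \<in> quot_coboundaries A F k} `` {\<omega>}"

definition reeb_class ::
  "('a, 'e::euclidean_space) chart set \<Rightarrow> ('a, 'e) foliation \<Rightarrow> ('a, 'e) dform \<Rightarrow> ('a, 'e) dform set" where
  "reeb_class A F \<beta> = quot_class A F 1 \<beta>"

definition GV_form ::
  "('a, 'e::euclidean_space) chart set \<Rightarrow> nat \<Rightarrow> ('a, 'e) dform \<Rightarrow> ('a, 'e) dform" where
  "GV_form A q \<beta> = fwedge \<beta> (form_pow A (ext_d \<beta>) q)"

definition GV_deriv_class ::
  "('a, 'e::euclidean_space) chart set \<Rightarrow> nat \<Rightarrow> (real \<Rightarrow> ('a, 'e) foliation) \<Rightarrow>
   (real \<Rightarrow> ('a, 'e) dform) \<Rightarrow> real \<Rightarrow> ('a, 'e) dform set" where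
  "GV_deriv_class A q F \<beta> t =
     coh_class A (F t) (2 * q + 1) (form_dt (\<lambda>s. GV_form A q (\<beta> s)) t)"

definition T_form ::
  "('a, 'e::euclidean_space) chart set \<Rightarrow> nat \<Rightarrow> (real \<Rightarrow> ('a, 'e) dform) \<Rightarrow> real \<Rightarrow> ('a, 'e) dform" where
  "T_form A q \<beta> t = fwedge (form_dt \<beta> t) (form_pow A (ext_d (\<beta> t)) q)"

definition T_class ::
  "('a, 'e::euclidean_space) chart set \<Rightarrow> nat \<Rightarrow> (real \<Rightarrow> ('a, 'e) foliation) \<Rightarrow>
   (real \<Rightarrow> ('a, 'e) dform) \<Rightarrow> real \<Rightarrow> ('a, 'e) dform set" where
  "T_class A q F \<beta> t = coh_class A (F t) (2 * q + 1) (T_form A q \<beta> t)"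

definition TGV_class ::
  "('a, 'e::euclidean_space) chart set \<Rightarrow> nat \<Rightarrow> (real \<Rightarrow> ('a, 'e) foliation) \<Rightarrow>
   (real \<Rightarrow> ('a, 'e) dform) \<Rightarrow> real \<Rightarrow> ('a, 'e) dform set" where
  "TGV_class A q F \<beta> t = coh_class A (F t) (2 * q + 2) (fwedge (T_form A q \<beta> t) (\<beta> t))"

end

theory Submission
  imports Defs "Jordan_Normal_Form.Determinant"
begin

text \<open>Why the theorem holds. Let \<open>I\<close> be the ideal of the foliation, \<open>a = d\<beta>\<close>, and let primes denote derivatives in \<open>t\<close>.
From \<open>0 = dd\<alpha>\<close> one gets \<open>\<alpha> \<and> d\<beta> = 0\<close>, which means \<open>a \<in> I\<close>; and every product of \<open>q + 1\<close> elements of \<open>I\<close> is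
zero. The theorem comes from differentiating identities of the latter kind with respect to \<open>t\<close>.

Closedness: \<open>a^(q+1) = 0\<close> for all \<open>t\<close>, so its derivative \<open>(q+1) d\<beta>' \<and> a^q\<close> vanishes;
up to the factor this is \<open>d\<close> of \<open>T = \<beta>' \<and> a^q\<close> (lemma \<open>ext_d_T_form\<close>).

Independence of the choices: two defining forms differ by a positive function \<open>r\<close>, and comparing the equations for
\<open>\<beta>\<close> shows that two choices of \<open>\<beta>\<close> differ by the exact form \<open>\<plusminus> d (ln r)\<close> and a family \<open>\<gamma>\<close> of one-forms in \<open>I\<close>
(lemma \<open>defining_families_compare\<close>). An exact family \<open>dh\<close> changes \<open>T\<close> by \<open>d (h' \<and> a^q)\<close>. For the change by \<open>\<gamma>\<close>, with
the two curvatures \<open>a0\<close> and \<open>a1 = a0 + d\<gamma>\<close>, the \<open>q + 1\<close> identities \<open>\<gamma> \<and> a1^i \<and> a0^(q-i) = 0\<close> are differentiated with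
respect to \<open>t\<close> and added up: modulo \<open>d\<close> of explicit elements of \<open>I^q\<close> the sum telescopes to \<open>q + 1\<close> times the
difference of the two forms \<open>T\<close> (lemma \<open>T_form_transgression\<close>). It matters that the primitive lies in \<open>I^q\<close>
rather than only in \<open>I\<close>: its product with \<open>d\<beta> \<in> I\<close> is zero, so the difference of the products with \<open>\<beta>\<close> is
exact too (lemma \<open>TGV_form_change\<close>).

Relation with the Godbillon-Vey form: the derivative of \<open>\<beta> \<and> a^q\<close> equals \<open>(q+1) T - q d (\<beta> \<and> \<beta>' \<and> a^(q-1))\<close>
(lemma \<open>GV_form_derivative\<close>), and for \<open>q \<ge> 2\<close> the form under \<open>d\<close> contains a factor \<open>a\<close> and lies in \<open>I\<close>.

The calculus of forms is developed from the explicit formulas for \<open>wedge\<close> and \<open>ext_d\<close>. Forms are functions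
of lists of vectors, so inserting a first argument is the interior product, and identities of forms are proved by
induction on the list of arguments. This needs two formulas only: the interior product is an antiderivation of the wedge
product (\<open>contract_wedge\<close>), and Cartan's formula for a constant vector field (\<open>contract_extd\<close>).\<close>

section \<open>Exterior forms on a vector space\<close>

text \<open>The interior product. Since \<open>v # vs\<close> runs through all nonempty lists, two exterior forms agree if they
agree on the empty list and have the same contractions; this is the induction behind most identities below.\<close>

definition contract :: "'e \<Rightarrow> 'e ext \<Rightarrow> 'e ext" where
  "contract v f = (\<lambda>vs. f (v # vs))"

lemma contract_apply [simp]: "contract v f vs = f (v # vs)"
  by (simp add: contract_def)

text \<open>A named operation, so that interior products inside a scaled form stay visible as such.\<close>

definition ext_scale :: "real \<Rightarrow> 'e ext \<Rightarrow> 'e ext" where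
  "ext_scale r f = (\<lambda>vs. r * f vs)"

lemma ext_scale_apply [simp]: "ext_scale r f vs = r * f vs"
  by (simp add: ext_scale_def)

lemma alt_form_length: "alt_form k f \<Longrightarrow> length vs \<noteq> k \<Longrightarrow> f vs = 0"
  by (simp add: alt_form_def)

text \<open>For degree 0 the truncated subtraction is harmless: the contraction is then 0, which has every degree.\<close>

lemma alt_form_contract:
  assumes "alt_form k f" shows "alt_form (k - 1) (contract v f)"
proof (cases k)
  case 0
  then show ?thesis using assms by (simp add: alt_form_def module_hom_zero)
next
  case (Suc m)
  show ?thesis unfolding alt_form_def
  proof (intro conjI allI impI)
    fix vs :: "'a list" and i assume i: "i < k - 1" "length vs = k - 1"
    have "linear (\<lambda>w. f ((v # vs)[Suc i := w]))"
      using assms i Suc unfolding alt_form_def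
      by (metis Suc_less_eq Suc_pred' length_Cons zero_less_Suc diff_Suc_1)
    then show "linear (\<lambda>w. contract v f (vs[i := w]))" by simp
  next
    fix vs :: "'a list" and i j
    assume ij: "i < k - 1" "j < k - 1" "length vs = k - 1 \<and> i \<noteq> j \<and> vs ! i = vs ! j"
    then have "Suc i < k" "Suc j < k" "length (v # vs) = k \<and> Suc i \<noteq> Suc j \<and> (v#vs) ! Suc i = (v#vs) ! Suc j"
      using Suc by auto
    then have "f (v # vs) = 0" using assms unfolding alt_form_def by blast
    then show "contract v f vs = 0" by simp
  qed (use assms Suc in \<open>auto simp: alt_form_def\<close>)
qed

lemma alt_form_contract_Suc: "alt_form (Suc k) f \<Longrightarrow> alt_form k (contract v f)"
  using alt_form_contract[of "Suc k"] by simp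

lemma alt_form_0_contract: "alt_form 0 f \<Longrightarrow> contract v f = 0"
  by (auto simp: fun_eq_iff alt_form_def)

lemma alt_form_linear_Cons:
  assumes "alt_form k f" shows "linear (\<lambda>v. f (v # vs))"
proof (cases "k = Suc (length vs)")
  case True
  then have "linear (\<lambda>w. f ((undefined # vs)[0 := w]))"
    using assms unfolding alt_form_def by (metis length_Cons zero_less_Suc)
  then show ?thesis by simp
next
  case False
  then show ?thesis using assms by (simp add: alt_form_length module_hom_zero)
qed

lemma alt_form_repeat:
  assumes "alt_form k f" shows "f (v # v # vs) = 0"
proof (cases "k = Suc (Suc (length vs))")
  case True
  have "(v # v # vs) ! 0 = (v # v # vs) ! Suc 0" "0 < k" "Suc 0 < k" "length (v # v # vs) = k" "0 \<noteq> Suc 0"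
    using True by auto
  then show ?thesis using assms unfolding alt_form_def by blast
qed (use assms in \<open>simp add: alt_form_length\<close>)

lemma alt_form_swap:
  assumes "alt_form k f" shows "f (u # v # vs) = - f (v # u # vs)"
proof -
  have l1: "linear (\<lambda>v. f (v # vs))" for vs by (rule alt_form_linear_Cons[OF assms])
  have l2: "linear (\<lambda>v. contract w f (v # vs))" for w
    by (rule alt_form_linear_Cons[OF alt_form_contract[OF assms]])
  have "f ((u + v) # (u + v) # vs) = 0" by (rule alt_form_repeat[OF assms])
  moreover have "f ((u + v) # (u + v) # vs) = f (u # u # vs) + f (u # v # vs) + (f (v # u # vs) + f (v # v # vs))"
    using linear_add[OF l1, of u v "(u + v) # vs"] linear_add[OF l2, of u u v] linear_add[OF l2, of v u v]
    by simp
  ultimately show ?thesis using alt_form_repeat[OF assms] by simp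
qed

text \<open>Each of the arguments that \<open>v\<close> passes contributes one sign.\<close>

lemma alt_form_to_front:
  "alt_form k f \<Longrightarrow> f (us @ v # vs) = (-1) ^ length us * f (v # us @ vs)"
proof (induction us arbitrary: k f)
  case (Cons u us)
  have "f ((u # us) @ v # vs) = contract u f (us @ v # vs)" by simp
  also have "\<dots> = (-1) ^ length us * f (u # v # us @ vs)"
    by (subst Cons.IH[OF alt_form_contract[OF Cons.prems]]) simp
  also have "f (u # v # us @ vs) = - f (v # u # us @ vs)" by (rule alt_form_swap[OF Cons.prems])
  finally show ?case by simp
qed simp

text \<open>A repetition in arbitrary positions reduces to one in the first two: if the first position is not involved, it is a
repetition in a contraction, and otherwise the second copy can be moved next to the first.\<close>

lemma alt_formI_contract:
  assumes "f [] = 0" and alt: "\<And>v. alt_form k (contract v f)"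
    and lin: "\<And>vs. linear (\<lambda>v. f (v # vs))" and rep: "\<And>v vs. f (v # v # vs) = 0"
  shows "alt_form (Suc k) f"
  unfolding alt_form_def
proof (intro conjI allI impI)
  fix vs :: "'a list" assume "length vs \<noteq> Suc k"
  then show "f vs = 0"
  proof (cases vs)
    case (Cons v us)
    then show ?thesis using alt_form_length[OF alt[of v], of us] \<open>length vs \<noteq> Suc k\<close> by simp
  qed (simp add: assms(1))
next
  fix vs :: "'a list" and i assume i: "i < Suc k" "length vs = Suc k"
  then obtain v us where vs: "vs = v # us" by (cases vs) auto
  show "linear (\<lambda>w. f (vs[i := w]))"
  proof (cases i)
    case 0 then show ?thesis using lin vs by simp
  next
    case (Suc j)
    then have "linear (\<lambda>w. contract v f (us[j := w]))" using alt[of v] i vs unfolding alt_form_def by simp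
    then show ?thesis using Suc vs by simp
  qed
next
  fix vs :: "'a list" and i j
  assume ij: "i < Suc k" "j < Suc k" and *: "length vs = Suc k \<and> i \<noteq> j \<and> vs ! i = vs ! j"
  have main: "f vs = 0" if ij: "i < j" and "j < Suc k" and len: "length vs = Suc k" and "vs ! i = vs ! j" for vs i j
  proof -
    obtain v us where vs: "vs = v # us" using len by (cases vs) auto
    show ?thesis
    proof (cases i)
      case 0
      obtain j' where j: "j = Suc j'" using ij by (cases j) auto
      have "us = take j' us @ v # drop (Suc j') us"
        using id_take_nth_drop[of j' us] that vs 0 j by simp
      then have "f vs = contract v f (take j' us @ v # drop (Suc j') us)" using vs by simp
      also have "\<dots> = (-1) ^ length (take j' us) * f (v # v # take j' us @ drop (Suc j') us)"
        by (subst alt_form_to_front[OF alt]) simp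
      finally show ?thesis by (simp add: rep)
    next
      case (Suc i')
      then obtain j' where j: "j = Suc j'" using ij by (cases j) auto
      have "i' < k" "j' < k" "length us = k \<and> i' \<noteq> j' \<and> us ! i' = us ! j'" using that Suc j vs by auto
      then have "contract v f us = 0" using alt[of v] unfolding alt_form_def by blast
      then show ?thesis using vs by simp
    qed
  qed
  show "f vs = 0" using main[of i j vs] main[of j i vs] ij * by (cases "i < j") auto
qed

lemma alt_form_0 [simp]: "alt_form k 0"
  by (simp add: alt_form_def module_hom_zero)

lemma alt_form_add: "alt_form k f \<Longrightarrow> alt_form k g \<Longrightarrow> alt_form k (f + g)"
  unfolding alt_form_def by (auto intro!: linear_compose_add)

lemma alt_form_scale: "alt_form k f \<Longrightarrow> alt_form k (ext_scale r f)"
  unfolding alt_form_def ext_scale_def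
  by (auto intro!: linear_compose_scale_right[where 'b=real, simplified])

lemma alt_form_uminus: "alt_form k f \<Longrightarrow> alt_form k (- f)"
  using alt_form_scale[of k f "-1"] by (simp add: fun_Compl_def ext_scale_def)

lemma alt_form_diff: "alt_form k f \<Longrightarrow> alt_form k g \<Longrightarrow> alt_form k (f - g)"
  using alt_form_add[of k f "- g"] alt_form_uminus[of k g] by simp

lemma alt_form_one: "alt_form 0 ext_one"
  by (auto simp: alt_form_def ext_one_def)

text \<open>Up to sign, the value of an alternating form on a list does not depend on the order of the list.\<close>

lemma alt_form_mset_zero:
  "alt_form k f \<Longrightarrow> f us = 0 \<Longrightarrow> mset us = mset vs \<Longrightarrow> f vs = 0"
proof (induction us arbitrary: k f vs)
  case (Cons u us)
  then have "u \<in> set vs" by (metis list.set_intros(1) mset_eq_setD)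
  then obtain as bs where vs: "vs = as @ u # bs" by (meson split_list)
  have "contract u f (as @ bs) = 0"
    by (rule Cons.IH[OF alt_form_contract[OF Cons.prems(1)]]) (use Cons.prems vs in auto)
  then show ?case using alt_form_to_front[OF Cons.prems(1)] vs by simp
qed simp

lemma alt_form_eq_0_on_span:
  assumes "alt_form k f" "span B = UNIV" "\<And>vs. set vs \<subseteq> B \<Longrightarrow> f vs = 0"
  shows "f vs = 0"
  using assms(1,3)
proof (induction vs arbitrary: k f)
  case Nil then show ?case by simp
next
  case (Cons v vs)
  have "(\<lambda>v. f (v # vs)) v = 0"
  proof (rule linear_eq_0_on_span[OF alt_form_linear_Cons[OF Cons.prems(1)]])
    show "v \<in> span B" using assms(2) by simp
    fix b assume b: "b \<in> B"
    have "contract b f vs = 0"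
      by (rule Cons.IH[OF alt_form_contract[OF Cons.prems(1)]]) (use b Cons.prems in auto)
    then show "f (b # vs) = 0" by simp
  qed
  then show ?case by simp
qed

text \<open>All but one of the splittings in the definition of \<open>wedge\<close> feed one of the factors a list of the wrong length.\<close>

lemma wedge_homogeneous:
  assumes "alt_form k f" "alt_form l g"
  shows "wedge f g vs = (if length vs = k + l then
     (\<Sum>\<sigma> | \<sigma> permutes {..<length vs}. of_int (sign \<sigma>) *
        f (take k (permute_list \<sigma> vs)) * g (drop k (permute_list \<sigma> vs))) / (fact k * fact l) else 0)"
proof -
  let ?n = "length vs"
  let ?t = "\<lambda>j. (\<Sum>\<sigma> | \<sigma> permutes {..<?n}. of_int (sign \<sigma>) *
         f (map (\<lambda>i. vs ! \<sigma> i) [0..<j]) * g (map (\<lambda>i. vs ! \<sigma> i) [j..<?n]))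
       / (fact j * fact (?n - j))"
  have w: "wedge f g vs = (\<Sum>j\<le>?n. ?t j)" by (simp add: wedge_def Let_def)
  have z: "?t j = 0" if "j \<le> ?n" "j \<noteq> k \<or> ?n - j \<noteq> l" for j
  proof -
    have "f (map (\<lambda>i. vs ! \<sigma> i) [0..<j]) * g (map (\<lambda>i. vs ! \<sigma> i) [j..<?n]) = 0" for \<sigma>
      using that alt_form_length[OF assms(1), of "map (\<lambda>i. vs ! \<sigma> i) [0..<j]"]
        alt_form_length[OF assms(2), of "map (\<lambda>i. vs ! \<sigma> i) [j..<?n]"] by auto
    then show ?thesis by (simp only: mult.assoc) simp
  qed
  show ?thesis
  proof (cases "?n = k + l")
    case True
    have "(\<Sum>j\<le>?n. ?t j) = (\<Sum>j\<in>{k}. ?t j)"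
      by (rule sum.mono_neutral_right) (use True z in auto)
    moreover have "map (\<lambda>i. vs ! \<sigma> i) [0..<k] = take k (permute_list \<sigma> vs)"
      "map (\<lambda>i. vs ! \<sigma> i) [k..<?n] = drop k (permute_list \<sigma> vs)" for \<sigma>
      using True by (auto simp: permute_list_def take_map drop_map)
    ultimately show ?thesis using w True by simp
  next
    case False
    have "(\<Sum>j\<le>?n. ?t j) = 0" by (rule sum.neutral) (use False z in force)
    then show ?thesis using w False by simp
  qed
qed

text \<open>Sorts the terms of a wedge product evaluated on \<open>v # vs\<close> by the position \<open>j\<close> at which \<open>v\<close> ends up.\<close>

lemma bij_betw_permutation_insert:
  "bij_betw (\<lambda>(j, \<rho>). permutation_insert j 0 \<rho>) ({..<Suc n} \<times> {\<rho>. \<rho> permutes {..<n}}) {\<sigma>. \<sigma> permutes {..<Suc n}}"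
proof (rule bij_betw_byWitness[where f' = "\<lambda>\<sigma>. (inv_into UNIV \<sigma> 0, permutation_delete \<sigma> (inv_into UNIV \<sigma> 0))"])
  have at: "{..<m} = {0..<m}" for m :: nat by auto
  show "(\<lambda>(j, \<rho>). permutation_insert j 0 \<rho>) ` ({..<Suc n} \<times> {\<rho>. \<rho> permutes {..<n}}) \<subseteq> {\<sigma>. \<sigma> permutes {..<Suc n}}"
    using permutation_insert_permutes[of _ n _ 0] unfolding at by auto
  show "(\<lambda>\<sigma>. (inv_into UNIV \<sigma> 0, permutation_delete \<sigma> (inv_into UNIV \<sigma> 0))) ` {\<sigma>. \<sigma> permutes {..<Suc n}} \<subseteq>
     {..<Suc n} \<times> {\<rho>. \<rho> permutes {..<n}}"
  proof safe
    fix \<sigma> :: "nat \<Rightarrow> nat" assume s: "\<sigma> permutes {..<Suc n}"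
    show 1: "inv_into UNIV \<sigma> 0 < Suc n" using permutes_in_image[OF permutes_inv[OF s], of 0] by simp
    show "permutation_delete \<sigma> (inv_into UNIV \<sigma> 0) permutes {..<n}"
      using permutation_delete_permutes[of \<sigma> n "inv_into UNIV \<sigma> 0"] s 1 unfolding at by simp
  qed
  show "\<forall>a'\<in>{\<sigma>. \<sigma> permutes {..<Suc n}}. (\<lambda>(j, \<rho>). permutation_insert j 0 \<rho>) (inv_into UNIV a' 0, permutation_delete a' (inv_into UNIV a' 0)) = a'"
  proof safe
    fix \<sigma> :: "nat \<Rightarrow> nat" assume s: "\<sigma> permutes {..<Suc n}"
    have 1: "inv_into UNIV \<sigma> 0 < Suc n" using permutes_in_image[OF permutes_inv[OF s], of 0] by simp
    have "\<sigma> (inv_into UNIV \<sigma> 0) = 0" using permutes_inverses(1)[OF s] .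
    then show "permutation_insert (inv_into UNIV \<sigma> 0) 0 (permutation_delete \<sigma> (inv_into UNIV \<sigma> 0)) = \<sigma>"
      using permutation_insert_delete[of \<sigma> n "inv_into UNIV \<sigma> 0"] s 1 unfolding at by simp
  qed
  show "\<forall>a\<in>{..<Suc n} \<times> {\<rho>. \<rho> permutes {..<n}}. (inv_into UNIV (case a of (j, \<rho>) \<Rightarrow> permutation_insert j 0 \<rho>) 0,
      permutation_delete (case a of (j, \<rho>) \<Rightarrow> permutation_insert j 0 \<rho>) (inv_into UNIV (case a of (j, \<rho>) \<Rightarrow> permutation_insert j 0 \<rho>) 0)) = a"
  proof (rule ballI)
    fix a assume "a \<in> {..<Suc n} \<times> {\<rho>. \<rho> permutes {..<n}}"
    then obtain j \<rho> where a: "a = (j, \<rho>)" and j: "j < Suc n" and r: "\<rho> permutes {..<n}" by auto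
    have s: "permutation_insert j 0 \<rho> permutes {..<Suc n}"
      using permutation_insert_permutes[of \<rho> n j 0] j r unfolding at by simp
    have i: "inv_into UNIV (permutation_insert j 0 \<rho>) 0 = j"
      using permutes_inverses(2)[OF s, of j] by simp
    have "permutation_delete (permutation_insert j 0 \<rho>) j = \<rho>"
      by (auto simp: fun_eq_iff permutation_delete_expand permutation_insert_expand)
    then show "(inv_into UNIV (case a of (j, \<rho>) \<Rightarrow> permutation_insert j 0 \<rho>) 0,
      permutation_delete (case a of (j, \<rho>) \<Rightarrow> permutation_insert j 0 \<rho>) (inv_into UNIV (case a of (j, \<rho>) \<Rightarrow> permutation_insert j 0 \<rho>) 0)) = a"
      using i a by simp
  qed
qed

lemma permute_list_insert:
  assumes "j < Suc (length vs)"
  shows "permute_list (permutation_insert j 0 \<rho>) (v # vs) =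
    take j (permute_list \<rho> vs) @ v # drop j (permute_list \<rho> vs)" (is "?L = ?R")
proof (rule nth_equalityI)
  show "length ?L = length ?R" using assms by simp
  fix i assume "i < length ?L"
  then show "?L ! i = ?R ! i" using assms
    by (cases "i = length vs") (auto simp: permute_list_def permutation_insert_expand nth_append nth_Cons' min_def)
qed

text \<open>The interior product is an antiderivation. In the sum over all permutations, let \<open>j\<close> be the position that
receives \<open>v\<close>. If \<open>j < k\<close>, then \<open>v\<close> is an argument of \<open>f\<close>, and the sign from moving it to the front equals the sign of
inserting it; the \<open>k\<close> positions thus contribute the same, which turns \<open>1 / fact k\<close> into \<open>1 / fact (k - 1)\<close>. If \<open>j \<ge> k\<close>,
it is an argument of \<open>g\<close> and the two signs differ by \<open>(-1) ^ k\<close>.\<close>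

lemma contract_wedge:
  assumes f: "alt_form k f" and g: "alt_form l g"
  shows "contract v (wedge f g) = wedge (contract v f) g + ext_scale ((-1) ^ k) (wedge f (contract v g))"
proof
  fix vs :: "'a list"
  have cf: "alt_form (k - 1) (contract v f)" and cg: "alt_form (l - 1) (contract v g)"
    by (rule alt_form_contract[OF f], rule alt_form_contract[OF g])
  show "contract v (wedge f g) vs = (wedge (contract v f) g + ext_scale ((-1) ^ k) (wedge f (contract v g))) vs"
  proof (cases "Suc (length vs) = k + l")
    case False
    have z: "wedge 0 h = 0" "wedge h 0 = 0" for h :: "'a ext" by (auto simp: wedge_def fun_eq_iff)
    have "wedge (contract v f) g vs = 0"
    proof (cases k)
      case 0 then show ?thesis using alt_form_0_contract[of f v] f z by simp
    next
      case (Suc m) then show ?thesis using False by (subst wedge_homogeneous[OF cf g]) auto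
    qed
    moreover have "wedge f (contract v g) vs = 0"
    proof (cases l)
      case 0 then show ?thesis using alt_form_0_contract[of g v] g z by simp
    next
      case (Suc m) then show ?thesis using False by (subst wedge_homogeneous[OF f cg]) auto
    qed
    ultimately show ?thesis using False by (simp add: wedge_homogeneous[OF f g])
  next
    case True
    let ?n = "length vs"
    let ?P = "{\<rho>. \<rho> permutes {..<?n}}"
    let ?t = "\<lambda>\<sigma>. of_int (sign \<sigma>) * f (take k (permute_list \<sigma> (v # vs))) * g (drop k (permute_list \<sigma> (v # vs)))"
    let ?a = "\<lambda>\<rho>. of_int (sign \<rho>) * f (v # take (k - 1) (permute_list \<rho> vs)) * g (drop (k - 1) (permute_list \<rho> vs))"
    let ?b = "\<lambda>\<rho>. of_int (sign \<rho>) * f (take k (permute_list \<rho> vs)) * g (v # drop k (permute_list \<rho> vs))"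
    have t: "?t (permutation_insert j 0 \<rho>) = (if j < k then ?a \<rho> else (-1) ^ k * ?b \<rho>)"
      if j: "j < Suc ?n" and r: "\<rho> permutes {..<?n}" for j \<rho>
    proof -
      let ?us = "permute_list \<rho> vs"
      have sg: "of_int (sign (permutation_insert j 0 \<rho>)) = ((-1) ^ j * of_int (sign \<rho>) :: real)"
        using signof_permutation_insert[of \<rho> ?n j 0, where 'a=real] j r
        by (simp add: lessThan_atLeast0)
      have L: "permute_list (permutation_insert j 0 \<rho>) (v # vs) = take j ?us @ v # drop j ?us"
        using j by (rule permute_list_insert)
      show ?thesis
      proof (cases "j < k")
        case True
        have tk: "take k (take j ?us @ v # drop j ?us) = take j ?us @ v # take (k - 1 - j) (drop j ?us)"
          using True j by (simp add: take_Cons' min_def)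
        have dr: "drop k (take j ?us @ v # drop j ?us) = drop (k - 1) ?us"
          using True j by (simp add: drop_Cons' min_def)
        have "take j ?us @ take (k - 1 - j) (drop j ?us) = take (k - 1) ?us"
          using True by (metis take_add add_diff_inverse_nat less_Suc_eq_le Suc_diff_1 gr0I not_less0 linorder_not_less)
        then have "f (take j ?us @ v # take (k - 1 - j) (drop j ?us)) = (-1) ^ j * f (v # take (k - 1) ?us)"
          using alt_form_to_front[OF f, of "take j ?us" v "take (k - 1 - j) (drop j ?us)"] j by (simp add: min_absorb2)
        then show ?thesis unfolding L tk dr sg using True by simp
      next
        case False
        have tk: "take k (take j ?us @ v # drop j ?us) = take k ?us"
          using False j by (simp add: min_def)
        have dr: "drop k (take j ?us @ v # drop j ?us) = take (j - k) (drop k ?us) @ v # drop j ?us"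
          using False j by (simp add: drop_take)
        have "take (j - k) (drop k ?us) @ drop j ?us = drop k ?us"
          using False by (metis append_take_drop_id drop_drop le_add_diff_inverse2 not_less)
        then have "g (take (j - k) (drop k ?us) @ v # drop j ?us) = (-1) ^ (j - k) * g (v # drop k ?us)"
          using alt_form_to_front[OF g, of "take (j - k) (drop k ?us)" v "drop j ?us"] j False by (simp add: min_absorb2)
        moreover have "(-1) ^ j * (-1) ^ (j - k) = ((-1) ^ k :: real)"
        proof -
          obtain d where "j = k + d" using False le_Suc_ex not_less by blast
          then show ?thesis by (simp add: minus_one_power_iff)
        qed
        ultimately show ?thesis unfolding L tk dr sg using False
          by (simp add: algebra_simps)
      qed
    qed
    have "(\<Sum>\<sigma> | \<sigma> permutes {..<Suc ?n}. ?t \<sigma>) = (\<Sum>(j, \<rho>)\<in>{..<Suc ?n} \<times> ?P. ?t (permutation_insert j 0 \<rho>))"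
      using sum.reindex_bij_betw[OF bij_betw_permutation_insert[of ?n], of ?t]
      by (simp add: case_prod_unfold)
    also have "\<dots> = (\<Sum>j<Suc ?n. \<Sum>\<rho>\<in>?P. ?t (permutation_insert j 0 \<rho>))"
      by (simp add: sum.cartesian_product)
    also have "\<dots> = (\<Sum>j<Suc ?n. if j < k then (\<Sum>\<rho>\<in>?P. ?a \<rho>) else (-1) ^ k * (\<Sum>\<rho>\<in>?P. ?b \<rho>))"
      by (intro sum.cong refl) (auto simp: t sum_distrib_left simp del: One_nat_def intro!: sum.cong)
    also have "\<dots> = real k * (\<Sum>\<rho>\<in>?P. ?a \<rho>) + real l * ((-1) ^ k * (\<Sum>\<rho>\<in>?P. ?b \<rho>))"
    proof -
      have i1: "{..<k + l} \<inter> {j. j < k} = {..<k}" by auto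
      have i2: "{..<k + l} \<inter> - {j. j < k} = {k..<k + l}" by auto
      show ?thesis unfolding True by (subst sum.If_cases) (simp_all only: i1 i2 finite_lessThan sum_constant card_lessThan card_atLeastLessThan add_diff_cancel_left')
    qed
    finally have S: "(\<Sum>\<sigma> | \<sigma> permutes {..<Suc ?n}. ?t \<sigma>) =
        real k * (\<Sum>\<rho>\<in>?P. ?a \<rho>) + real l * ((-1) ^ k * (\<Sum>\<rho>\<in>?P. ?b \<rho>))" .
    have A: "real k * (\<Sum>\<rho>\<in>?P. ?a \<rho>) / (fact k * fact l) = wedge (contract v f) g vs"
    proof (cases k)
      case 0 then show ?thesis using alt_form_0_contract[of f v] f by (simp add: wedge_def)
    next
      case (Suc m)
      then have "?n = (k - 1) + l" using True by simp
      then show ?thesis unfolding wedge_homogeneous[OF cf g] using Suc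
        by (simp add: field_simps del: of_nat_Suc)
    qed
    have B: "real l * (\<Sum>\<rho>\<in>?P. ?b \<rho>) / (fact k * fact l) = wedge f (contract v g) vs"
    proof (cases l)
      case 0 then show ?thesis using alt_form_0_contract[of g v] g by (simp add: wedge_def)
    next
      case (Suc m)
      then have "?n = k + (l - 1)" using True by simp
      then show ?thesis unfolding wedge_homogeneous[OF f cg] using Suc
        by (simp add: field_simps del: of_nat_Suc)
    qed
    have "contract v (wedge f g) vs = (\<Sum>\<sigma> | \<sigma> permutes {..<Suc ?n}. ?t \<sigma>) / (fact k * fact l)"
      using True by (simp add: wedge_homogeneous[OF f g])
    also have "\<dots> = real k * (\<Sum>\<rho>\<in>?P. ?a \<rho>) / (fact k * fact l)
        + (-1) ^ k * (real l * (\<Sum>\<rho>\<in>?P. ?b \<rho>) / (fact k * fact l))"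
      unfolding S by (simp add: add_divide_distrib)
    finally show ?thesis unfolding A B by simp
  qed
qed

lemma wedge_0_left [simp]: "wedge 0 g = 0" and wedge_0_right [simp]: "wedge f 0 = 0"
  by (auto simp: wedge_def fun_eq_iff)

lemma wedge_eq_sum: "wedge f g vs = (\<Sum>k\<le>length vs. \<Sum>\<sigma> | \<sigma> permutes {..<length vs}.
    of_int (sign \<sigma>) * f (map (\<lambda>i. vs ! \<sigma> i) [0..<k]) * g (map (\<lambda>i. vs ! \<sigma> i) [k..<length vs])
      / (fact k * fact (length vs - k)))"
  by (simp add: wedge_def Let_def sum_divide_distrib)

lemma wedge_add_left: "wedge (f + g) h = wedge f h + wedge g h"
  by (rule ext) (simp add: wedge_eq_sum distrib_right distrib_left add_divide_distrib sum.distrib)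

lemma wedge_add_right: "wedge h (f + g) = wedge h f + wedge h g"
  by (rule ext) (simp add: wedge_eq_sum distrib_right distrib_left add_divide_distrib sum.distrib)

lemma wedge_scale_left: "wedge (ext_scale r f) g = ext_scale r (wedge f g)"
  by (rule ext) (simp add: wedge_eq_sum sum_distrib_left mult.assoc mult.left_commute)

lemma wedge_scale_right: "wedge f (ext_scale r g) = ext_scale r (wedge f g)"
  by (rule ext) (simp add: wedge_eq_sum sum_distrib_left mult.assoc mult.left_commute)

lemma wedge_diff_left: "wedge (f - g) h = wedge f h - wedge g h"
  by (rule ext) (simp add: wedge_eq_sum left_diff_distrib right_diff_distrib diff_divide_distrib sum_subtractf)

lemma wedge_diff_right: "wedge h (f - g) = wedge h f - wedge h g"
  by (rule ext) (simp add: wedge_eq_sum left_diff_distrib right_diff_distrib diff_divide_distrib sum_subtractf)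

lemma wedge_Nil [simp]: "wedge f g [] = f [] * g []"
  by (simp add: wedge_def)

lemma contract_add: "alt_form k f \<Longrightarrow> contract (u + v) f = contract u f + contract v f"
  using linear_add[OF alt_form_linear_Cons] by (fastforce simp: fun_eq_iff)

lemma contract_scale: "alt_form k f \<Longrightarrow> contract (r *\<^sub>R v) f = ext_scale r (contract v f)"
  using linear_scale[OF alt_form_linear_Cons] by (fastforce simp: fun_eq_iff)

lemma contract_contract: "alt_form k f \<Longrightarrow> contract v (contract v f) = 0"
  by (auto simp: fun_eq_iff alt_form_repeat)

lemma contract_plus: "contract v (f + g) = contract v f + contract v g"
  and contract_times: "contract v (ext_scale r f) = ext_scale r (contract v f)"
  and contract_minus: "contract v (f - g) = contract v f - contract v g"
  and contract_0 [simp]: "contract v 0 = 0"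
  by (auto simp: fun_eq_iff)

text \<open>By induction on the degree: contracting twice with the same vector leaves the two mixed terms of
\<open>contract_wedge\<close>, and these have opposite signs.\<close>

lemma alt_form_wedge:
  "alt_form k f \<Longrightarrow> alt_form l g \<Longrightarrow> alt_form (k + l) (wedge f g)"
proof (induction "k + l" arbitrary: k l f g)
  case 0
  have "wedge f g vs = 0" if "vs \<noteq> []" for vs
    using that 0 by (subst wedge_homogeneous[OF 0(2,3)]) simp
  then show ?case using 0 by (simp add: alt_form_def)
next
  case (Suc n)
  note f = Suc.prems(1) and g = Suc.prems(2)
  note cw = contract_wedge[OF f g]
  have "alt_form (Suc n) (wedge f g)"
  proof (rule alt_formI_contract)
    show "wedge f g [] = 0" using Suc.hyps(2) alt_form_length[OF f, of "[]"] alt_form_length[OF g, of "[]"]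
      by (cases k) auto
  next
    fix v
    have "alt_form n (wedge (contract v f) g)"
    proof (cases k)
      case 0 then show ?thesis using f by (simp add: alt_form_0_contract)
    next
      case (Suc m) then show ?thesis
        using Suc.hyps(1)[of m l "contract v f" g] Suc.hyps(2) f g by (auto intro: alt_form_contract_Suc)
    qed
    moreover have "alt_form n (wedge f (contract v g))"
    proof (cases l)
      case 0 then show ?thesis using g by (simp add: alt_form_0_contract)
    next
      case (Suc m) then show ?thesis
        using Suc.hyps(1)[of k m f "contract v g"] Suc.hyps(2) f g by (auto intro: alt_form_contract_Suc)
    qed
    ultimately show "alt_form n (contract v (wedge f g))"
      unfolding cw by (intro alt_form_add alt_form_scale)
  next
    fix vs
    have "wedge f g (v # vs) = wedge (contract v f) g vs + (-1) ^ k * wedge f (contract v g) vs" for v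
      using fun_cong[OF cw[of v], of vs] by simp
    then show "linear (\<lambda>v. wedge f g (v # vs))"
      by (auto intro!: linearI simp del: contract_apply simp: contract_add[OF f] contract_add[OF g] contract_scale[OF f] contract_scale[OF g]
          wedge_add_left wedge_add_right wedge_scale_left wedge_scale_right algebra_simps)
  next
    fix v vs
    have "contract v (contract v (wedge f g)) vs = 0"
    proof (cases k)
      case 0
      then show ?thesis unfolding cw using f g
        by (simp add: alt_form_0_contract contract_times contract_plus
          contract_wedge[OF _ alt_form_contract[OF g]] contract_contract)
    next
      case (Suc m)
      then show ?thesis unfolding cw contract_plus contract_times contract_wedge[OF alt_form_contract[OF f] g]
          contract_wedge[OF f alt_form_contract[OF g]]
        by (simp add: contract_contract[OF f] contract_contract[OF g])
    qed
    then show "wedge f g (v # v # vs) = 0" by simp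
  qed
  then show ?case using Suc.hyps(2) by simp
qed

text \<open>Contracting either side with a vector gives three terms of lower degree, one for each factor, with equal signs.\<close>

lemma wedge_assoc:
  assumes "alt_form k f" "alt_form l g" "alt_form m h"
  shows "wedge (wedge f g) h = wedge f (wedge g h)"
proof
  fix vs
  show "wedge (wedge f g) h vs = wedge f (wedge g h) vs"
    using assms
  proof (induction vs arbitrary: k l m f g h)
    case (Cons v vs)
    note f = Cons.prems(1) and g = Cons.prems(2) and h = Cons.prems(3)
    have IH: "wedge (wedge (contract v f) g) h vs = wedge (contract v f) (wedge g h) vs"
      "wedge (wedge f (contract v g)) h vs = wedge f (wedge (contract v g) h) vs"
      "wedge (wedge f g) (contract v h) vs = wedge f (wedge g (contract v h)) vs"
      using Cons.IH alt_form_contract f g h by blast+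
    have "wedge (wedge f g) h (v # vs) = contract v (wedge (wedge f g) h) vs" by simp
    also have "\<dots> = contract v (wedge f (wedge g h)) vs"
      unfolding contract_wedge[OF f g] contract_wedge[OF g h] contract_wedge[OF alt_form_wedge[OF f g] h]
        contract_wedge[OF f alt_form_wedge[OF g h]]
      by (simp add: IH wedge_add_left wedge_add_right wedge_scale_left wedge_scale_right algebra_simps power_add)
    finally show ?case by simp
  qed simp
qed

lemma wedge_commute:
  assumes "alt_form k f" "alt_form l g"
  shows "wedge f g = ext_scale ((-1) ^ (k * l)) (wedge g f)"
proof
  fix vs
  show "wedge f g vs = ext_scale ((-1) ^ (k * l)) (wedge g f) vs"
    using assms
  proof (induction vs arbitrary: k l f g)
    case Nil
    show ?case
    proof (cases "k = 0 \<and> l = 0")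
      case True then show ?thesis by simp
    next
      case False
      then have "f [] * g [] = 0" using Nil alt_form_length[OF Nil(1), of "[]"] alt_form_length[OF Nil(2), of "[]"] by auto
      then show ?thesis by (simp add: mult.commute)
    qed
  next
    case (Cons v vs)
    note f = Cons.prems(1) and g = Cons.prems(2)
    have a: "wedge (contract v f) g vs = (-1) ^ (k * l) * (-1) ^ l * wedge g (contract v f) vs"
    proof (cases k)
      case 0 then show ?thesis using f by (simp add: alt_form_0_contract)
    next
      case (Suc m)
      show ?thesis using Cons.IH[OF alt_form_contract[OF f, of v] g] Suc
        by (simp add: power_add power_mult_distrib[symmetric] del: contract_apply)
    qed
    have b: "(-1) ^ k * wedge f (contract v g) vs = (-1) ^ (k * l) * wedge (contract v g) f vs"
    proof (cases l)
      case 0 then show ?thesis using g by (simp add: alt_form_0_contract)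
    next
      case (Suc m)
      show ?thesis using Cons.IH[OF f alt_form_contract[OF g, of v]] Suc
        by (simp add: power_add power_mult_distrib[symmetric] del: contract_apply)
    qed
    have "wedge f g (v # vs) = contract v (wedge f g) vs" by simp
    also have "\<dots> = (-1) ^ (k * l) * contract v (wedge g f) vs"
      unfolding contract_wedge[OF f g] contract_wedge[OF g f] using a b by (simp add: algebra_simps)
    finally show ?case by simp
  qed
qed

lemma wedge_one_left: "alt_form k f \<Longrightarrow> wedge ext_one f = f"
proof
  fix vs
  assume "alt_form k f"
  then show "wedge ext_one f vs = f vs"
  proof (induction vs arbitrary: k f)
    case (Cons v vs)
    have "wedge ext_one f (v # vs) = contract v (wedge ext_one f) vs" by simp
    also have "\<dots> = wedge ext_one (contract v f) vs"
      unfolding contract_wedge[OF alt_form_one Cons.prems] by (simp add: alt_form_0_contract[OF alt_form_one])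
    also have "\<dots> = contract v f vs"
      by (rule Cons.IH[OF alt_form_contract[OF Cons.prems]])
    finally show ?case by simp
  qed (simp add: ext_one_def)
qed

lemma wedge_one_right: "alt_form k f \<Longrightarrow> wedge f ext_one = f"
  using wedge_commute[of k f 0 ext_one] by (simp add: alt_form_one wedge_one_left ext_scale_def)

lemma alt_form_0_eq: "alt_form 0 f \<Longrightarrow> f = ext_scale (f []) ext_one"
  by (auto simp: fun_eq_iff alt_form_def ext_one_def)

lemma wedge_degree_0: "alt_form 0 f \<Longrightarrow> alt_form k g \<Longrightarrow> wedge f g = ext_scale (f []) g"
  by (metis (no_types, lifting) alt_form_0_eq wedge_scale_left wedge_one_left)

text \<open>The wedge product is natural for arbitrary maps of vectors, because it only permutes its arguments.\<close>

lemma wedge_map: "wedge f g (map L vs) = wedge (f \<circ> map L) (g \<circ> map L) vs"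
proof -
  have "map (\<lambda>i. map L vs ! \<sigma> i) [a..<b] = map L (map (\<lambda>i. vs ! \<sigma> i) [a..<b])"
    if "\<sigma> permutes {..<length vs}" "b \<le> length vs" for \<sigma> a b
    using that permutes_in_image[OF that(1)] by auto
  then show ?thesis unfolding wedge_eq_sum length_map by (intro sum.cong refl) (simp del: map_map map_eq_conv)
qed

lemma alt_form_wedge_list: "(\<And>a. a \<in> set as \<Longrightarrow> alt_form 1 a) \<Longrightarrow> alt_form (length as) (wedge_list as)"
proof (induction as)
  case (Cons a as)
  then show ?case using alt_form_wedge[of 1 a "length as" "wedge_list as"] by (simp add: wedge_list_def)
qed (simp add: wedge_list_def alt_form_one)

section \<open>Powers of the ideal of forms vanishing on a subspace\<close>

text \<open>For exterior forms this describes the \<open>p\<close>-th power of the ideal of the forms that vanish on tuples from \<open>V\<close>: each of the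
\<open>p\<close> factors has to be fed at least one vector outside \<open>V\<close>.\<close>

definition vanishing :: "'e set \<Rightarrow> nat \<Rightarrow> 'e ext \<Rightarrow> bool" where
  "vanishing V p f \<longleftrightarrow> (\<forall>vs. length (filter (\<lambda>v. v \<notin> V) vs) < p \<longrightarrow> f vs = 0)"

text \<open>In each term one of the two factors receives too few vectors outside \<open>V\<close>.\<close>

lemma vanishing_wedge:
  assumes "vanishing V p f" "vanishing V p' g"
  shows "vanishing V (p + p') (wedge f g)"
  unfolding vanishing_def
proof (intro allI impI)
  fix vs assume vs: "length (filter (\<lambda>v. v \<notin> V) vs) < p + p'"
  have "f (map (\<lambda>i. vs ! \<sigma> i) [0..<k]) * g (map (\<lambda>i. vs ! \<sigma> i) [k..<length vs]) = 0"
    if s: "\<sigma> permutes {..<length vs}" and k: "k \<le> length vs" for \<sigma> k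
  proof -
    let ?a = "map (\<lambda>i. vs ! \<sigma> i) [0..<k]" and ?b = "map (\<lambda>i. vs ! \<sigma> i) [k..<length vs]"
    have "?a @ ?b = permute_list \<sigma> vs"
      using upt_add_eq_append[of 0 k "length vs - k"] k by (simp add: permute_list_def)
    then have "mset (?a @ ?b) = mset vs" using mset_permute_list[OF s] by simp
    then have "length (filter (\<lambda>v. v \<notin> V) (?a @ ?b)) = length (filter (\<lambda>v. v \<notin> V) vs)"
      by (metis mset_filter size_mset)
    then have "length (filter (\<lambda>v. v \<notin> V) ?a) < p \<or> length (filter (\<lambda>v. v \<notin> V) ?b) < p'" using vs by auto
    then show ?thesis using assms unfolding vanishing_def by (metis mult_eq_0_iff)
  qed
  then show "wedge f g vs = 0" unfolding wedge_eq_sum mult.assoc by (intro sum.neutral ballI) simp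
qed

lemma vanishing_0: "vanishing V 0 f" by (simp add: vanishing_def)

lemma vanishing_mono: "vanishing V p f \<Longrightarrow> p' \<le> p \<Longrightarrow> vanishing V p' f" by (auto simp: vanishing_def)

lemma vanishing_1_iff: "vanishing V 1 f \<longleftrightarrow> (\<forall>vs. set vs \<subseteq> V \<longrightarrow> f vs = 0)"
  by (auto simp: vanishing_def filter_empty_conv)

lemma vanishing_wedge_list:
  "(\<And>a. a \<in> set as \<Longrightarrow> alt_form 1 a \<and> (\<forall>v\<in>V. a [v] = 0)) \<Longrightarrow> vanishing V (length as) (wedge_list as)"
proof (induction as)
  case (Cons a as)
  have "vanishing V 1 a" unfolding vanishing_1_iff
  proof (intro allI impI)
    fix vs :: "'a list" assume "set vs \<subseteq> V"
    then show "a vs = 0" using Cons.prems[of a] alt_form_length[of 1 a vs]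
      by (cases "length vs = 1") (auto simp: length_Suc_conv)
  qed
  then show ?case using vanishing_wedge[of V 1 a "length as" "wedge_list as"] Cons by (simp add: wedge_list_def)
qed (simp add: vanishing_0)

definition codim_le :: "nat \<Rightarrow> 'e::real_vector set \<Rightarrow> bool" where
  "codim_le q V \<longleftrightarrow> (\<exists>W. finite W \<and> card W \<le> q \<and> span (V \<union> W) = UNIV)"

text \<open>Intersecting with the kernel of one more covector \<open>a\<close> loses at most one dimension, spanned by any vector of the
previous kernel on which \<open>a\<close> does not vanish.\<close>

lemma codim_le_common_kernel:
  fixes as :: "'e::real_vector ext list"
  shows "(\<And>a. a \<in> set as \<Longrightarrow> alt_form 1 a) \<Longrightarrow> codim_le (length as) (common_kernel as)"
proof (induction as)
  case Nil
  then show ?case by (auto simp: codim_le_def common_kernel_def intro!: exI[of _ "{}"])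
next
  case (Cons a as)
  obtain W where W: "finite W" "card W \<le> length as" "span (common_kernel as \<union> W) = UNIV"
    using Cons unfolding codim_le_def by auto
  have lin: "linear (\<lambda>v. b [v])" if "b \<in> set (a # as)" for b
    using alt_form_linear_Cons[OF Cons.prems[OF that], of "[]"] .
  show ?case
  proof (cases "\<exists>w\<in>common_kernel as. a [w] \<noteq> 0")
    case False
    then have "common_kernel (a # as) = common_kernel as" by (auto simp: common_kernel_def)
    then show ?thesis using W unfolding codim_le_def by (intro exI[of _ W]) auto
  next
    case True
    then obtain w where w: "w \<in> common_kernel as" "a [w] \<noteq> 0" by blast
    let ?S = "span (common_kernel (a # as) \<union> insert w W)"
    have "v \<in> ?S" if v: "v \<in> common_kernel as" for v
    proof -
      let ?c = "a [v] / a [w]"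
      have "b [v - ?c *\<^sub>R w] = 0" if "b \<in> set (a # as)" for b
        using linear_diff[OF lin[OF that], of v "?c *\<^sub>R w"] linear_scale[OF lin[OF that], of ?c w]
          that v w by (auto simp: common_kernel_def)
      then have "v - ?c *\<^sub>R w \<in> ?S" by (intro span_base) (auto simp: common_kernel_def)
      moreover have "?c *\<^sub>R w \<in> ?S" by (intro span_scale span_base) simp
      ultimately have "(v - ?c *\<^sub>R w) + ?c *\<^sub>R w \<in> ?S" by (rule span_add)
      then show ?thesis by simp
    qed
    then have "common_kernel as \<union> W \<subseteq> ?S" using span_base[of _ "common_kernel (a # as) \<union> insert w W"] by auto
    then have "?S = UNIV" using W(3) span_minimal[of "common_kernel as \<union> W" ?S] by auto
    moreover have "finite (insert w W)" "card (insert w W) \<le> length (a # as)"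
      using W by (auto simp: card_insert_if)
    ultimately show ?thesis unfolding codim_le_def by blast
  qed
qed

lemma alt_form_distinct:
  assumes "alt_form k f" "f vs \<noteq> 0" shows "distinct vs"
proof (rule ccontr)
  assume "\<not> distinct vs"
  then obtain i j where "i < length vs" "j < length vs" "i \<noteq> j" "vs ! i = vs ! j"
    by (auto simp: distinct_conv_nth)
  moreover have "length vs = k" using assms alt_form_length by blast
  ultimately show False using assms unfolding alt_form_def by blast
qed

text \<open>Products of more factors than the codimension are zero: by multilinearity only arguments in \<open>V\<close> and in a complement
with at most \<open>q\<close> elements matter, and an alternating form sees each element of the latter at most once.\<close>

lemma vanishing_top:
  assumes f: "alt_form k f" and van: "vanishing V (Suc q) f" and "codim_le q V"
  shows "f = 0"
proof -
  obtain W where W: "finite W" "card W \<le> q" "span (V \<union> W) = UNIV" using assms(3) by (auto simp: codim_le_def)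
  have "f vs = 0" if vs: "set vs \<subseteq> V \<union> W" for vs
  proof (rule ccontr)
    assume nz: "f vs \<noteq> 0"
    then have "distinct (filter (\<lambda>v. v \<notin> V) vs)" using alt_form_distinct[OF f] by auto
    then have "length (filter (\<lambda>v. v \<notin> V) vs) = card (set (filter (\<lambda>v. v \<notin> V) vs))" by (simp add: distinct_card del: set_filter)
    also have "\<dots> \<le> card W" using vs W(1) by (intro card_mono) auto
    finally show False using van nz W(2) unfolding vanishing_def by auto
  qed
  then show ?thesis using alt_form_eq_0_on_span[OF f W(3)] by (auto simp: fun_eq_iff)
qed

text \<open>The determinant line: by the argument of \<open>vanishing_top\<close>, a \<open>q\<close>-form in the \<open>q\<close>-th power is determined by its value on
the complement \<open>W\<close>, listed in any order.\<close>

lemma vanishing_proportional: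
  assumes f: "alt_form q f" "vanishing V q f" and g: "alt_form q g" "vanishing V q g" and "codim_le q V"
  shows "f us * g vs = g us * f vs"
proof -
  obtain W where W: "finite W" "card W \<le> q" "span (V \<union> W) = UNIV" using assms(5) by (auto simp: codim_le_def)
  obtain ws where ws: "distinct ws" "set ws = W" using W(1) finite_distinct_list by blast
  have zero: "h us = 0" if h: "alt_form q h" "vanishing V q h" "h ws = 0" for h us
  proof (rule alt_form_eq_0_on_span[OF h(1) W(3)])
    fix vs assume vs: "set vs \<subseteq> V \<union> W"
    show "h vs = 0"
    proof (rule ccontr)
      assume nz: "h vs \<noteq> 0"
      have len: "length vs = q" using nz alt_form_length[OF h(1)] by blast
      have d: "distinct vs" using alt_form_distinct[OF h(1) nz] .
      have "length (filter (\<lambda>v. v \<notin> V) vs) \<ge> length vs" using h(2) nz len unfolding vanishing_def by force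
      then have "filter (\<lambda>v. v \<notin> V) vs = vs" by (metis filter_True length_filter_less not_less)
      then have "set vs \<subseteq> W" using vs by (auto simp: filter_id_conv)
      then have "set vs = W" using card_subset_eq[OF W(1)] distinct_card[OF d] len W(2)
        by (metis W(1) card_mono le_antisym)
      then have "mset ws = mset vs" using ws d by (metis set_eq_iff_mset_eq_distinct)
      then show False using alt_form_mset_zero[OF h(1,3)] nz by blast
    qed
  qed
  let ?h = "ext_scale (f ws) g - ext_scale (g ws) f"
  have h: "?h vs = 0" for vs
  proof (rule zero)
    show "alt_form q ?h" using f g by (intro alt_form_diff alt_form_scale)
  qed (use f g in \<open>auto simp: vanishing_def\<close>)
  show ?thesis
  proof (cases "f ws = 0")
    case True
    then show ?thesis using zero[OF f True] by simp
  next
    case False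
    have "g vs = g ws / f ws * f vs" for vs using h[of vs] False by (simp add: field_simps)
    from this[of us] this[of vs] show ?thesis by simp
  qed
qed

text \<open>Vectors in \<open>V\<close> contract \<open>\<alpha>\<close> to zero, so they can be contracted out of the second factor of \<open>\<alpha> \<and> \<omega> = 0\<close>. Once all
arguments of \<open>\<omega>\<close> are used up, a multiple of \<open>\<alpha>\<close> remains.\<close>

lemma wedge_eq_0_imp_vanishing:
  assumes \<alpha>: "alt_form q \<alpha>" "vanishing V q \<alpha>" "\<alpha> us \<noteq> 0"
  shows "alt_form k \<omega> \<Longrightarrow> wedge \<alpha> \<omega> = 0 \<Longrightarrow> set vs \<subseteq> V \<Longrightarrow> \<omega> vs = 0"
proof (induction vs arbitrary: k \<omega>)
  case Nil
  show ?case
  proof (cases k)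
    case 0
    then have "wedge \<alpha> \<omega> us = \<omega> [] * \<alpha> us"
      using wedge_commute[OF \<alpha>(1), of 0 \<omega>] wedge_degree_0[of \<omega> q \<alpha>] Nil \<alpha> by simp
    then show ?thesis using Nil \<alpha> by simp
  qed (use alt_form_length[OF Nil(1)] in auto)
next
  case (Cons v vs)
  have "\<alpha> (v # us') = 0" for us'
  proof (cases "length (v # us') = q")
    case True
    then have "length (filter (\<lambda>v. v \<notin> V) (v # us')) < q" using Cons.prems(3) length_filter_le[of "\<lambda>v. v \<notin> V" us']
      by (simp add: less_Suc_eq_le del: length_filter_le)
    then show ?thesis using \<alpha>(2) unfolding vanishing_def by blast
  qed (use alt_form_length[OF \<alpha>(1)] in blast)
  then have "contract v \<alpha> = 0" by (auto simp: fun_eq_iff)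
  then have "ext_scale ((-1) ^ q) (wedge \<alpha> (contract v \<omega>)) = 0"
    using contract_wedge[OF \<alpha>(1) Cons.prems(1), of v] unfolding Cons.prems(2) by simp
  then have w0: "wedge \<alpha> (contract v \<omega>) = 0" by (auto simp: fun_eq_iff)
  then have "contract v \<omega> vs = 0" using Cons.IH[OF alt_form_contract[OF Cons.prems(1), of v] w0] Cons.prems(3) by (simp del: contract_apply)
  then show ?case by simp
qed

section \<open>Smooth functions\<close>

lemma frechet_derivativeI: "(f has_derivative f') (at x) \<Longrightarrow> frechet_derivative f (at x) v = f' v"
  using frechet_derivative_at by metis

lemma frechet_derivative_has: "f differentiable (at x) \<Longrightarrow> (f has_derivative frechet_derivative f (at x)) (at x)"
  by (simp add: frechet_derivative_works)

lemma Ck_on_SucD: "Ck_on (Suc k) f S \<Longrightarrow> Ck_on k f S"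
proof (induction k arbitrary: f)
  case 0
  then show ?case by (auto intro!: continuous_at_imp_continuous_on differentiable_imp_continuous_within)
qed auto

text \<open>The coinductive reading of smoothness, which spares counting orders of differentiability.\<close>

lemma smooth_on_iff:
  "smooth_on f S \<longleftrightarrow> (\<forall>x\<in>S. f differentiable (at x)) \<and> (\<forall>v. smooth_on (\<lambda>x. frechet_derivative f (at x) v) S)"
proof
  assume f: "smooth_on f S"
  have "Ck_on (Suc k) f S" for k using f unfolding smooth_on_def by blast
  then show "(\<forall>x\<in>S. f differentiable (at x)) \<and> (\<forall>v. smooth_on (\<lambda>x. frechet_derivative f (at x) v) S)"
    by (auto simp: smooth_on_def)
next
  assume f: "(\<forall>x\<in>S. f differentiable (at x)) \<and> (\<forall>v. smooth_on (\<lambda>x. frechet_derivative f (at x) v) S)"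
  have "Ck_on (Suc k) f S" for k using f by (auto simp: smooth_on_def)
  then show "smooth_on f S" unfolding smooth_on_def using Ck_on_SucD by blast
qed

lemma smooth_on_differentiable: "smooth_on f S \<Longrightarrow> x \<in> S \<Longrightarrow> f differentiable (at x)"
  and smooth_on_derivative: "smooth_on f S \<Longrightarrow> smooth_on (\<lambda>x. frechet_derivative f (at x) v) S"
  using smooth_on_iff by blast+

lemma smooth_on_has_derivative:
  "smooth_on f S \<Longrightarrow> x \<in> S \<Longrightarrow> (f has_derivative frechet_derivative f (at x)) (at x)"
  using smooth_on_differentiable frechet_derivative_has by blast

lemma smooth_on_continuous_on: "smooth_on f S \<Longrightarrow> continuous_on S f"
  unfolding smooth_on_def by (metis Ck_on.simps(1))

lemma Ck_on_cong:
  assumes "open S" "\<And>x. x \<in> S \<Longrightarrow> f x = g x" "Ck_on k f S"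
  shows "Ck_on k g S"
  using assms(2,3)
proof (induction k arbitrary: f g)
  case 0 then show ?case using continuous_on_cong by fastforce
next
  case (Suc k)
  have d: "f differentiable (at x)" if "x \<in> S" for x using Suc that by simp
  have e: "frechet_derivative f (at x) = frechet_derivative g (at x)" if "x \<in> S" for x
    using frechet_derivative_transform_within_open[OF d[OF that] assms(1) that] Suc by blast
  have "g differentiable (at x)" if "x \<in> S" for x
    using d[OF that] has_derivative_transform_within_open[OF _ assms(1) that, of f _ _ g] Suc.prems(1)
    unfolding differentiable_def by metis
  moreover have "Ck_on k (\<lambda>x. frechet_derivative g (at x) v) S" for v
    using Suc.IH[of "\<lambda>x. frechet_derivative f (at x) v" "\<lambda>x. frechet_derivative g (at x) v"] e Suc.prems by simp
  ultimately show ?case by simp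
qed

lemma smooth_on_cong:
  "open S \<Longrightarrow> (\<And>x. x \<in> S \<Longrightarrow> f x = g x) \<Longrightarrow> smooth_on f S \<Longrightarrow> smooth_on g S"
  unfolding smooth_on_def using Ck_on_cong by blast

lemma Ck_on_subset: "Ck_on k f T \<Longrightarrow> S \<subseteq> T \<Longrightarrow> Ck_on k f S"
  by (induction k arbitrary: f) (auto intro: continuous_on_subset)

lemma smooth_on_subset: "smooth_on f T \<Longrightarrow> S \<subseteq> T \<Longrightarrow> smooth_on f S"
  unfolding smooth_on_def using Ck_on_subset by blast

lemma smooth_on_local:
  fixes f :: "'v::real_normed_vector \<Rightarrow> 'w::real_normed_vector"
  assumes "\<And>x. x \<in> S \<Longrightarrow> \<exists>N. open N \<and> x \<in> N \<and> smooth_on f N"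
  shows "smooth_on f S"
proof -
  have "Ck_on k f S" if "\<And>x. x \<in> S \<Longrightarrow> \<exists>N. open N \<and> x \<in> N \<and> Ck_on k f N" for k and f :: "'v \<Rightarrow> 'w"
    using that
  proof (induction k arbitrary: f)
    case 0
    then show ?case by (auto intro!: continuous_at_imp_continuous_on) (metis continuous_on_eq_continuous_at)
  next
    case (Suc k)
    have "f differentiable at x" if "x \<in> S" for x using Suc.prems[OF that] by auto
    moreover have "Ck_on k (\<lambda>x. frechet_derivative f (at x) v) S" for v
    proof (rule Suc.IH)
      fix x assume "x \<in> S"
      from Suc.prems[OF this] show "\<exists>N. open N \<and> x \<in> N \<and> Ck_on k (\<lambda>x. frechet_derivative f (at x) v) N"
        by auto
    qed
    ultimately show ?case by simp
  qed
  note Ck_local = this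
  show ?thesis unfolding smooth_on_def
  proof
    fix k
    show "Ck_on k f S"
    proof (rule Ck_local)
      fix x assume "x \<in> S"
      from assms[OF this] show "\<exists>N. open N \<and> x \<in> N \<and> Ck_on k f N" unfolding smooth_on_def by blast
    qed
  qed
qed

lemma smooth_on_const [simp]:
  fixes c :: "'w::real_normed_vector" shows "smooth_on (\<lambda>x. c) S"
proof -
  have "Ck_on k (\<lambda>x. c) S" for k and c :: 'w
    by (induction k arbitrary: c) (auto simp: frechet_derivative_const)
  then show ?thesis by (simp add: smooth_on_def)
qed

lemma Ck_on_add: "open S \<Longrightarrow> Ck_on k f S \<Longrightarrow> Ck_on k g S \<Longrightarrow> Ck_on k (\<lambda>x. f x + g x) S"
proof (induction k arbitrary: f g)
  case (Suc k)
  have h: "((\<lambda>x. f x + g x) has_derivative (\<lambda>v. frechet_derivative f (at x) v + frechet_derivative g (at x) v)) (at x)"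
    if "x \<in> S" for x
    using Suc.prems that by (intro has_derivative_add frechet_derivative_has) auto
  have "Ck_on k (\<lambda>x. frechet_derivative (\<lambda>x. f x + g x) (at x) v) S" for v
    by (rule Ck_on_cong[OF Suc.prems(1) _ Suc.IH]) (use Suc.prems frechet_derivativeI[OF h] in auto)
  then show ?case using h unfolding Ck_on.simps differentiable_def by blast
qed (auto intro: continuous_on_add)

lemma Ck_on_mult:
  fixes f g :: "'v::real_normed_vector \<Rightarrow> real"
  shows "open S \<Longrightarrow> Ck_on k f S \<Longrightarrow> Ck_on k g S \<Longrightarrow> Ck_on k (\<lambda>x. f x * g x) S"
proof (induction k arbitrary: f g)
  case (Suc k)
  have h: "((\<lambda>x. f x * g x) has_derivative (\<lambda>v. f x * frechet_derivative g (at x) v + frechet_derivative f (at x) v * g x)) (at x)"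
    if "x \<in> S" for x
    using Suc.prems that by (intro has_derivative_mult frechet_derivative_has) auto
  have fg: "Ck_on k f S" "Ck_on k g S" using Suc.prems Ck_on_SucD by blast+
  have "Ck_on k (\<lambda>x. f x * frechet_derivative g (at x) v + frechet_derivative f (at x) v * g x) S" for v
    using Suc.prems fg by (intro Ck_on_add Suc.IH) auto
  from Ck_on_cong[OF Suc.prems(1) _ this]
  have "Ck_on k (\<lambda>x. frechet_derivative (\<lambda>x. f x * g x) (at x) v) S" for v
    using frechet_derivativeI[OF h] by simp
  then show ?case using h unfolding Ck_on.simps differentiable_def by blast
qed (auto intro: continuous_on_mult)

lemma smooth_on_add: "open S \<Longrightarrow> smooth_on f S \<Longrightarrow> smooth_on g S \<Longrightarrow> smooth_on (\<lambda>x. f x + g x) S"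
  unfolding smooth_on_def using Ck_on_add by blast

lemma smooth_on_mult:
  fixes f g :: "'v::real_normed_vector \<Rightarrow> real"
  shows "open S \<Longrightarrow> smooth_on f S \<Longrightarrow> smooth_on g S \<Longrightarrow> smooth_on (\<lambda>x. f x * g x) S"
  unfolding smooth_on_def using Ck_on_mult by blast

lemma smooth_on_sum: "open S \<Longrightarrow> (\<And>i. i \<in> I \<Longrightarrow> smooth_on (f i) S) \<Longrightarrow> smooth_on (\<lambda>x. \<Sum>i\<in>I. f i x) S"
  by (induction I rule: infinite_finite_induct) (auto intro: smooth_on_add)

lemma smooth_on_inverse:
  fixes f :: "'v::real_normed_vector \<Rightarrow> real"
  assumes "open S" "smooth_on f S" "\<And>x. x \<in> S \<Longrightarrow> f x \<noteq> 0"
  shows "smooth_on (\<lambda>x. inverse (f x)) S"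
proof -
  have h: "((\<lambda>x. inverse (f x)) has_derivative (\<lambda>v. - (inverse (f x) * frechet_derivative f (at x) v * inverse (f x)))) (at x)"
    if "x \<in> S" for x
    using smooth_on_has_derivative[OF assms(2) that] assms(3)[OF that] by (intro Deriv.has_derivative_inverse) auto
  have "Ck_on k (\<lambda>x. inverse (f x)) S" for k
  proof (induction k)
    case 0
    then show ?case using assms by (simp add: continuous_on_inverse smooth_on_continuous_on)
  next
    case (Suc k)
    have df: "Ck_on k (\<lambda>x. (-1) * frechet_derivative f (at x) v) S" for v
      using smooth_on_mult[OF assms(1) smooth_on_const smooth_on_derivative[OF assms(2)], of "-1" v] by (simp add: smooth_on_def)
    have prod: "Ck_on k (\<lambda>x. inverse (f x) * ((-1) * frechet_derivative f (at x) v) * inverse (f x)) S" for v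
      by (rule Ck_on_mult[OF assms(1) Ck_on_mult[OF assms(1) Suc df] Suc])
    have "Ck_on k (\<lambda>x. frechet_derivative (\<lambda>x. inverse (f x)) (at x) v) S" for v
      by (rule Ck_on_cong[OF assms(1) _ prod[of v]]) (simp add: frechet_derivativeI[OF h])
    then show ?case using h unfolding Ck_on.simps differentiable_def by blast
  qed
  then show ?thesis by (simp add: smooth_on_def)
qed

text \<open>The derivative is a product of smooth functions, whence \<open>smooth_on_ln\<close>.\<close>

lemma has_derivative_ln_comp:
  fixes f :: "'v::real_normed_vector \<Rightarrow> real"
  assumes "smooth_on f S" "x \<in> S" "f x > 0"
  shows "((\<lambda>x. ln (f x)) has_derivative (\<lambda>v. frechet_derivative f (at x) v * inverse (f x))) (at x)"
  by (rule has_derivative_ln) (use assms smooth_on_has_derivative in \<open>auto simp: field_class.field_divide_inverse\<close>)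

lemma smooth_on_ln:
  fixes f :: "'v::real_normed_vector \<Rightarrow> real"
  assumes "open S" "smooth_on f S" "\<And>x. x \<in> S \<Longrightarrow> f x > 0"
  shows "smooth_on (\<lambda>x. ln (f x)) S"
  unfolding smooth_on_iff[of "\<lambda>x. ln (f x)"]
proof (intro conjI ballI allI)
  fix x assume "x \<in> S"
  then show "(\<lambda>x. ln (f x)) differentiable at x"
    using has_derivative_ln_comp[OF assms(2)] assms(3) by (auto simp: differentiable_def)
next
  fix v
  have "smooth_on (\<lambda>x. inverse (f x)) S" by (rule smooth_on_inverse) (use assms in force)+
  note prod = smooth_on_mult[OF assms(1) smooth_on_derivative[OF assms(2)] this, of v]
  show "smooth_on (\<lambda>x. frechet_derivative (\<lambda>x. ln (f x)) (at x) v) S"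
    by (rule smooth_on_cong[OF assms(1) _ prod])
      (simp add: frechet_derivativeI[OF has_derivative_ln_comp[OF assms(2)]] assms(3))
qed

lemma has_derivative_slice:
  assumes "f differentiable (at (t, x))"
  shows "((\<lambda>y. f (t, y)) has_derivative (\<lambda>v. frechet_derivative f (at (t, x)) (0, v))) (at x)"
proof -
  have "((\<lambda>y. (t, y)) has_derivative (\<lambda>v. (0, v))) (at x)"
    by (auto intro!: derivative_eq_intros)
  then have "((f \<circ> (\<lambda>y. (t, y))) has_derivative (frechet_derivative f (at (t, x)) \<circ> (\<lambda>v. (0, v)))) (at x)"
    using frechet_derivative_has[OF assms] by (rule diff_chain_at)
  then show ?thesis by (simp add: o_def)
qed

lemma has_derivative_time:
  fixes f :: "real \<times> 'v::real_normed_vector \<Rightarrow> real"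
  assumes "f differentiable (at (t, x))"
  shows "((\<lambda>s. f (s, x)) has_real_derivative frechet_derivative f (at (t, x)) (1, 0)) (at t)"
proof -
  have "((\<lambda>s. (s, x)) has_derivative (\<lambda>v. (v, 0))) (at t)"
    by (auto intro!: derivative_eq_intros)
  then have "((f \<circ> (\<lambda>s. (s, x))) has_derivative (frechet_derivative f (at (t, x)) \<circ> (\<lambda>v. (v, 0)))) (at t)"
    using frechet_derivative_has[OF assms] by (rule diff_chain_at)
  moreover have "frechet_derivative f (at (t, x)) \<circ> (\<lambda>v. (v, 0)) = (*) (frechet_derivative f (at (t, x)) (1, 0))"
  proof
    fix v show "(frechet_derivative f (at (t, x)) \<circ> (\<lambda>v. (v, 0))) v = frechet_derivative f (at (t, x)) (1, 0) * v"
      using linear_scale[OF linear_frechet_derivative[OF assms], of v "(1, 0)"] by simp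
  qed
  ultimately show ?thesis unfolding has_field_derivative_def by (simp add: o_def)
qed

lemma smooth_on_slice:
  fixes f :: "'s::real_normed_vector \<times> 'v::real_normed_vector \<Rightarrow> 'w::real_normed_vector"
  assumes "open T" "open U" "smooth_on f (T \<times> U)" "t \<in> T"
  shows "smooth_on (\<lambda>x. f (t, x)) U"
proof -
  have "Ck_on k (\<lambda>x. f (t, x)) U" if "Ck_on k f (T \<times> U)" for k and f :: "'s \<times> 'v \<Rightarrow> 'w"
    using that
  proof (induction k arbitrary: f)
    case 0
    then show ?case using assms(4) by (auto intro!: continuous_on_compose2[of "T \<times> U" f] continuous_intros)
  next
    case (Suc k)
    have h: "((\<lambda>y. f (t, y)) has_derivative (\<lambda>v. frechet_derivative f (at (t, x)) (0, v))) (at x)" if "x \<in> U" for x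
      using that assms Suc.prems by (intro has_derivative_slice) auto
    have "Ck_on k (\<lambda>x. frechet_derivative (\<lambda>x. f (t, x)) (at x) v) U" for v
      by (rule Ck_on_cong[OF assms(2) _ Suc.IH[of "\<lambda>z. frechet_derivative f (at z) (0, v)"]])
        (use frechet_derivativeI[OF h] Suc.prems in auto)
    then show ?case using h unfolding Ck_on.simps differentiable_def by blast
  qed
  then show ?thesis using assms(3) by (simp add: smooth_on_def)
qed

lemma has_derivative_line:
  fixes f :: "'v::real_normed_vector \<Rightarrow> real"
  assumes "f differentiable (at (a + s *\<^sub>R u))"
  shows "((\<lambda>s. f (a + s *\<^sub>R u)) has_real_derivative frechet_derivative f (at (a + s *\<^sub>R u)) u) (at s)"
proof -
  have "((\<lambda>s. a + s *\<^sub>R u) has_derivative (\<lambda>r. r *\<^sub>R u)) (at s)"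
    by (auto intro!: derivative_eq_intros)
  then have "((f \<circ> (\<lambda>s. a + s *\<^sub>R u)) has_derivative (frechet_derivative f (at (a + s *\<^sub>R u)) \<circ> (\<lambda>r. r *\<^sub>R u))) (at s)"
    using frechet_derivative_has[OF assms] by (rule diff_chain_at)
  moreover have "frechet_derivative f (at (a + s *\<^sub>R u)) \<circ> (\<lambda>r. r *\<^sub>R u) = (*) (frechet_derivative f (at (a + s *\<^sub>R u)) u)"
    by (rule ext) (simp add: linear_scale[OF linear_frechet_derivative[OF assms]])
  ultimately show ?thesis unfolding has_field_derivative_def by (simp add: o_def)
qed

text \<open>The mean value theorem in direction \<open>u\<close>, applied to the difference in direction \<open>v\<close>, and then once more in direction
\<open>v\<close>.\<close>

lemma second_difference_mean_value:
  fixes f :: "'v::real_normed_vector \<Rightarrow> real"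
  assumes "h > 0" and S: "\<And>s t. 0 \<le> s \<Longrightarrow> s \<le> h \<Longrightarrow> 0 \<le> t \<Longrightarrow> t \<le> h \<Longrightarrow> x + s *\<^sub>R u + t *\<^sub>R v \<in> S"
    and d1: "\<And>y. y \<in> S \<Longrightarrow> f differentiable (at y)"
    and d2: "\<And>y. y \<in> S \<Longrightarrow> (\<lambda>y. frechet_derivative f (at y) u) differentiable (at y)"
  shows "\<exists>s t. 0 \<le> s \<and> s \<le> h \<and> 0 \<le> t \<and> t \<le> h \<and>
    f (x + h *\<^sub>R u + h *\<^sub>R v) - f (x + h *\<^sub>R u) - f (x + h *\<^sub>R v) + f x =
    h * (h * frechet_derivative (\<lambda>y. frechet_derivative f (at y) u) (at (x + s *\<^sub>R u + t *\<^sub>R v)) v)"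
proof -
  let ?D = "\<lambda>y. frechet_derivative f (at y) u"
  have "\<exists>s>0. s < h \<and> (f ((x + h *\<^sub>R v) + h *\<^sub>R u) - f (x + h *\<^sub>R u)) - (f ((x + h *\<^sub>R v) + 0 *\<^sub>R u) - f (x + 0 *\<^sub>R u))
      = (h - 0) * (?D ((x + h *\<^sub>R v) + s *\<^sub>R u) - ?D (x + s *\<^sub>R u))"
  proof (rule MVT2[OF \<open>h > 0\<close>])
    fix s assume s: "0 \<le> s" "s \<le> h"
    show "((\<lambda>s. f ((x + h *\<^sub>R v) + s *\<^sub>R u) - f (x + s *\<^sub>R u)) has_real_derivative
        ?D ((x + h *\<^sub>R v) + s *\<^sub>R u) - ?D (x + s *\<^sub>R u)) (at s)"
      using S[of s h] S[of s 0] s assms(1) by (intro DERIV_diff has_derivative_line d1) (auto simp: algebra_simps)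
  qed
  then obtain s where s: "0 < s" "s < h"
    "f (x + h *\<^sub>R u + h *\<^sub>R v) - f (x + h *\<^sub>R u) - f (x + h *\<^sub>R v) + f x =
      h * (?D ((x + s *\<^sub>R u) + h *\<^sub>R v) - ?D ((x + s *\<^sub>R u) + 0 *\<^sub>R v))"
    by (auto simp: algebra_simps)
  have "\<exists>t>0. t < h \<and> ?D ((x + s *\<^sub>R u) + h *\<^sub>R v) - ?D ((x + s *\<^sub>R u) + 0 *\<^sub>R v)
     = (h - 0) * frechet_derivative ?D (at ((x + s *\<^sub>R u) + t *\<^sub>R v)) v"
  proof (rule MVT2[OF \<open>h > 0\<close>])
    fix t assume t: "0 \<le> t" "t \<le> h"
    show "((\<lambda>t. ?D ((x + s *\<^sub>R u) + t *\<^sub>R v)) has_real_derivative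
        frechet_derivative ?D (at ((x + s *\<^sub>R u) + t *\<^sub>R v)) v) (at t)"
      using S[of s t] s t by (intro has_derivative_line d2) auto
  qed
  then show ?thesis using s by (metis diff_zero less_imp_le)
qed

text \<open>The second difference is symmetric in the two directions, and by \<open>second_difference_mean_value\<close> it equals
\<open>h\<^sup>2\<close> times either mixed derivative at points arbitrarily close to \<open>x\<close>, where these derivatives are continuous.\<close>

lemma second_derivative_symmetric:
  fixes f :: "'v::real_normed_vector \<Rightarrow> real"
  assumes "open S" "smooth_on f S" "x \<in> S"
  shows "frechet_derivative (\<lambda>y. frechet_derivative f (at y) u) (at x) v =
    frechet_derivative (\<lambda>y. frechet_derivative f (at y) v) (at x) u" (is "?A x = ?B x")
proof (rule ccontr)
  assume ne: "?A x \<noteq> ?B x"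
  define e where "e = \<bar>?A x - ?B x\<bar> / 2"
  have e: "e > 0" using ne by (simp add: e_def)
  have c: "continuous_on S ?A" "continuous_on S ?B"
    using assms by (auto intro!: smooth_on_continuous_on smooth_on_derivative)
  then have "isCont ?A x" "isCont ?B x" using assms continuous_on_eq_continuous_at by blast+
  then have "\<forall>\<^sub>F y in at x. dist (?A y) (?A x) < e" "\<forall>\<^sub>F y in at x. dist (?B y) (?B x) < e"
    using e by (auto simp: isCont_def dest: tendstoD)
  moreover have "\<forall>\<^sub>F y in at x. y \<in> S" using assms eventually_at_in_open' by blast
  ultimately have "\<forall>\<^sub>F y in at x. dist (?A y) (?A x) < e \<and> dist (?B y) (?B x) < e \<and> y \<in> S"
    by eventually_elim auto
  then obtain d where d: "d > 0"
    and D: "\<And>y. y \<noteq> x \<Longrightarrow> dist y x < d \<Longrightarrow> dist (?A y) (?A x) < e \<and> dist (?B y) (?B x) < e \<and> y \<in> S"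
    unfolding eventually_at by (auto simp: dist_commute)
  have D': "dist (?A y) (?A x) < e \<and> dist (?B y) (?B x) < e \<and> y \<in> S" if "dist y x < d" for y
    using D[of y] that e assms(3) by (cases "y = x") auto
  \<comment> \<open>Small enough for the parallelogram spanned by \<open>h u\<close> and \<open>h v\<close> to stay within distance \<open>d\<close>.\<close>
  define h where "h = d / (norm u + norm v + 1)"
  have pos: "norm u + norm v + 1 > 0" by (smt (verit) norm_ge_zero)
  have h: "h > 0" using d pos by (simp add: h_def)
  have near: "dist (x + s *\<^sub>R u + t *\<^sub>R v) x < d" if "0 \<le> s" "s \<le> h" "0 \<le> t" "t \<le> h" for s t
  proof -
    have "dist (x + s *\<^sub>R u + t *\<^sub>R v) x = norm (s *\<^sub>R u + t *\<^sub>R v)" by (simp add: dist_norm)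
    also have "\<dots> \<le> s * norm u + t * norm v" using that norm_triangle_ineq[of "s *\<^sub>R u" "t *\<^sub>R v"] by simp
    also have "\<dots> \<le> h * norm u + h * norm v" using that by (intro add_mono mult_right_mono) auto
    also have "\<dots> < h * (norm u + norm v + 1)" using h by (simp add: algebra_simps)
    also have "\<dots> = d" using pos by (simp add: h_def)
    finally show ?thesis .
  qed
  have smd: "f differentiable (at y)" "(\<lambda>y. frechet_derivative f (at y) w) differentiable (at y)" if "y \<in> S" for y w
    using that smooth_on_differentiable[OF assms(2)] smooth_on_differentiable[OF smooth_on_derivative[OF assms(2)]] by blast+
  let ?\<Delta> = "f (x + h *\<^sub>R u + h *\<^sub>R v) - f (x + h *\<^sub>R u) - f (x + h *\<^sub>R v) + f x"
  obtain s t where 1: "0 \<le> s" "s \<le> h" "0 \<le> t" "t \<le> h" "?\<Delta> = h * (h * ?A (x + s *\<^sub>R u + t *\<^sub>R v))"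
    using second_difference_mean_value[OF h, of x u v S f] near D' smd by blast
  have "x + s *\<^sub>R v + t *\<^sub>R u \<in> S" if "0 \<le> s" "s \<le> h" "0 \<le> t" "t \<le> h" for s t
    using D'[OF near[OF that(3,4,1,2)]] by (simp add: algebra_simps)
  then obtain s' t' where 2: "0 \<le> s'" "s' \<le> h" "0 \<le> t'" "t' \<le> h"
    "f (x + h *\<^sub>R v + h *\<^sub>R u) - f (x + h *\<^sub>R v) - f (x + h *\<^sub>R u) + f x = h * (h * ?B (x + s' *\<^sub>R v + t' *\<^sub>R u))"
    using second_difference_mean_value[OF h, of x v u S f] smd by blast
  have "?\<Delta> = h * (h * ?B (x + t' *\<^sub>R u + s' *\<^sub>R v))" using 2(5) by (simp add: algebra_simps)
  then have "?A (x + s *\<^sub>R u + t *\<^sub>R v) = ?B (x + t' *\<^sub>R u + s' *\<^sub>R v)" using 1(5) h by simp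
  moreover have "dist (?A (x + s *\<^sub>R u + t *\<^sub>R v)) (?A x) < e" using D'[OF near] 1 by blast
  moreover have "dist (?B (x + t' *\<^sub>R u + s' *\<^sub>R v)) (?B x) < e" using D'[OF near] 2 by blast
  ultimately show False unfolding e_def dist_real_def by (auto simp: abs_if field_simps split: if_splits)
qed

lemma second_derivative_symmetric_euclidean:
  fixes f :: "'v::real_normed_vector \<Rightarrow> 'w::euclidean_space"
  assumes "open S" "smooth_on f S" "x \<in> S"
  shows "frechet_derivative (\<lambda>y. frechet_derivative f (at y) u) (at x) v =
    frechet_derivative (\<lambda>y. frechet_derivative f (at y) v) (at x) u"
proof (rule euclidean_eqI)
  fix b :: 'w
  have h: "((\<lambda>y. inner (g y) b) has_derivative (\<lambda>v. inner (frechet_derivative g (at y) v) b)) (at y)"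
    if "smooth_on g S" "y \<in> S" for g and y
    using smooth_on_has_derivative[OF that] by (rule has_derivative_inner_left)
  have sm: "smooth_on (\<lambda>y. inner (f y) b) S"
  proof -
    have "Ck_on k (\<lambda>y. inner (f y) b) S" if "smooth_on f S" for k f
      using that
    proof (induction k arbitrary: f)
      case 0 then show ?case using continuous_on_inner[OF smooth_on_continuous_on continuous_on_const] by simp
    next
      case (Suc k)
      have "Ck_on k (\<lambda>x. frechet_derivative (\<lambda>y. inner (f y) b) (at x) v) S" for v
        by (rule Ck_on_cong[OF assms(1) _ Suc.IH[OF smooth_on_derivative[OF Suc.prems, of v]]])
          (simp add: frechet_derivativeI[OF h[OF Suc.prems]])
      then show ?case using h[OF Suc.prems] unfolding Ck_on.simps differentiable_def by blast
    qed
    then show ?thesis using assms(2) by (auto simp: smooth_on_def)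
  qed
  have "inner (frechet_derivative (\<lambda>y. frechet_derivative f (at y) u) (at x) v) b =
      frechet_derivative (\<lambda>y. frechet_derivative (\<lambda>y. inner (f y) b) (at y) u) (at x) v" for u v
  proof -
    have "((\<lambda>y. inner (frechet_derivative f (at y) u) b) has_derivative
        (\<lambda>v. inner (frechet_derivative (\<lambda>y. frechet_derivative f (at y) u) (at x) v) b)) (at x)"
      by (rule h[OF smooth_on_derivative[OF assms(2)] assms(3)])
    then have "((\<lambda>y. frechet_derivative (\<lambda>y. inner (f y) b) (at y) u) has_derivative
        (\<lambda>v. inner (frechet_derivative (\<lambda>y. frechet_derivative f (at y) u) (at x) v) b)) (at x)"
      by (rule has_derivative_transform_within_open[OF _ assms(1,3)]) (simp add: frechet_derivativeI[OF h[OF assms(2)]])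
    then show ?thesis by (simp add: frechet_derivativeI)
  qed
  then show "inner (frechet_derivative (\<lambda>y. frechet_derivative f (at y) u) (at x) v) b =
    inner (frechet_derivative (\<lambda>y. frechet_derivative f (at y) v) (at x) u) b"
    using second_derivative_symmetric[OF assms(1) sm assms(3)] by simp
qed

section \<open>The exterior derivative in a chart\<close>

text \<open>The Lie derivative along the constant vector field \<open>v\<close>. The domain may differ from the space of arguments of the
form, so that time derivatives of families are covered.\<close>

definition dir_deriv :: "'p \<Rightarrow> ('p::real_normed_vector \<Rightarrow> 'e ext) \<Rightarrow> 'p \<Rightarrow> 'e ext" where
  "dir_deriv v \<omega> x = (\<lambda>vs. frechet_derivative (\<lambda>y. \<omega> y vs) (at x) v)"

text \<open>The exterior derivative of the representation of a form in one chart.\<close>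

definition extd :: "('e::real_normed_vector \<Rightarrow> 'e ext) \<Rightarrow> 'e \<Rightarrow> 'e ext" where
  "extd \<omega> x = (\<lambda>vs. \<Sum>i<length vs. (-1) ^ i *
        frechet_derivative (\<lambda>y. \<omega> y (take i vs @ drop (Suc i) vs)) (at x) (vs ! i))"

text \<open>Cartan's formula for the constant vector field \<open>v\<close>. It reduces the properties of the exterior derivative to
lower degree and to properties of directional derivatives.\<close>

lemma contract_extd: "contract v (extd \<omega> x) = dir_deriv v \<omega> x - extd (\<lambda>y. contract v (\<omega> y)) x"
  by (auto simp: fun_eq_iff extd_def dir_deriv_def sum.lessThan_Suc_shift sum_negf[symmetric]
      simp del: sum.lessThan_Suc)

lemma contract_dir_deriv: "contract u (dir_deriv v \<omega> x) = dir_deriv v (\<lambda>y. contract u (\<omega> y)) x"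
  by (simp add: fun_eq_iff dir_deriv_def)

lemma extd_Nil [simp]: "extd \<omega> x [] = 0" by (simp add: extd_def)

lemma smooth_ext_on_alt: "smooth_ext_on k U \<omega> \<Longrightarrow> x \<in> U \<Longrightarrow> alt_form k (\<omega> x)"
  and smooth_ext_on_smooth: "smooth_ext_on k U \<omega> \<Longrightarrow> smooth_on (\<lambda>x. \<omega> x vs) U"
  by (auto simp: smooth_ext_on_def)

lemma smooth_ext_on_differentiable: "smooth_ext_on k U \<omega> \<Longrightarrow> x \<in> U \<Longrightarrow> (\<lambda>x. \<omega> x vs) differentiable (at x)"
  using smooth_ext_on_smooth smooth_on_differentiable by blast

lemma smooth_ext_on_has_derivative:
  "smooth_ext_on k U \<omega> \<Longrightarrow> x \<in> U \<Longrightarrow> ((\<lambda>x. \<omega> x vs) has_derivative (\<lambda>v. dir_deriv v \<omega> x vs)) (at x)"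
  using frechet_derivative_has[OF smooth_ext_on_differentiable] by (auto simp: dir_deriv_def)

lemma dir_derivI:
  "((\<lambda>y. \<omega> y vs) has_derivative D) (at x) \<Longrightarrow> dir_deriv v \<omega> x vs = D v"
  by (simp add: dir_deriv_def frechet_derivativeI)

lemma dir_deriv_cong:
  assumes "open U" "x \<in> U" "\<And>y. y \<in> U \<Longrightarrow> \<omega> y vs = \<eta> y us" "smooth_ext_on k U \<eta>"
  shows "dir_deriv v \<omega> x vs = dir_deriv v \<eta> x us"
  by (rule dir_derivI, rule has_derivative_transform_within_open[OF _ assms(1,2)])
    (use assms smooth_ext_on_has_derivative in \<open>force+\<close>)

lemma smooth_ext_on_0: "smooth_ext_on k U (\<lambda>x. 0)"
  by (simp add: smooth_ext_on_def)

lemma smooth_ext_on_cong: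
  assumes "open U" "smooth_ext_on k U \<omega>" "\<And>y. y \<in> U \<Longrightarrow> \<omega> y = \<eta> y"
  shows "smooth_ext_on k U \<eta>"
  using assms smooth_on_cong[of U "\<lambda>z. \<omega> z vs" "\<lambda>z. \<eta> z vs" for vs] by (auto simp: smooth_ext_on_def)

lemma smooth_ext_on_add:
  "open U \<Longrightarrow> smooth_ext_on k U \<omega> \<Longrightarrow> smooth_ext_on k U \<eta> \<Longrightarrow> smooth_ext_on k U (\<lambda>x. \<omega> x + \<eta> x)"
  by (auto simp: smooth_ext_on_def intro: alt_form_add smooth_on_add)

lemma smooth_ext_on_scale:
  "open U \<Longrightarrow> smooth_ext_on k U \<omega> \<Longrightarrow> smooth_ext_on k U (\<lambda>x. ext_scale r (\<omega> x))"
  by (auto simp: smooth_ext_on_def intro: alt_form_scale smooth_on_mult)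

lemma smooth_ext_on_contract: "smooth_ext_on k U \<omega> \<Longrightarrow> smooth_ext_on (k - 1) U (\<lambda>x. contract v (\<omega> x))"
  by (auto simp: smooth_ext_on_def intro: alt_form_contract simp del: One_nat_def)

lemma smooth_ext_on_wedge:
  assumes "open U" "smooth_ext_on k U \<omega>" "smooth_ext_on l U \<eta>"
  shows "smooth_ext_on (k + l) U (\<lambda>x. wedge (\<omega> x) (\<eta> x))"
  unfolding smooth_ext_on_def
proof (intro conjI ballI allI)
  fix vs
  have s: "smooth_on (\<lambda>x. \<omega> x us) U" "smooth_on (\<lambda>x. \<eta> x us) U" for us using assms by (auto simp: smooth_ext_on_def)
  have "smooth_on (\<lambda>x. \<Sum>k\<le>length vs. \<Sum>\<sigma> | \<sigma> permutes {..<length vs}.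
    (of_int (sign \<sigma>) * \<omega> x (map (\<lambda>i. vs ! \<sigma> i) [0..<k]) * \<eta> x (map (\<lambda>i. vs ! \<sigma> i) [k..<length vs]))
      * inverse (fact k * fact (length vs - k))) U"
    by (intro smooth_on_sum smooth_on_mult smooth_on_const s assms(1))
  then show "smooth_on (\<lambda>x. wedge (\<omega> x) (\<eta> x) vs) U"
    by (simp add: wedge_eq_sum field_class.field_divide_inverse)
qed (use assms in \<open>auto simp: smooth_ext_on_def intro: alt_form_wedge\<close>)

lemma dir_deriv_add:
  assumes "smooth_ext_on k U \<omega>" "smooth_ext_on l U \<eta>" "x \<in> U"
  shows "dir_deriv v (\<lambda>y. \<omega> y + \<eta> y) x = dir_deriv v \<omega> x + dir_deriv v \<eta> x"
proof
  fix vs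
  have "((\<lambda>y. (\<omega> y + \<eta> y) vs) has_derivative (\<lambda>v. dir_deriv v \<omega> x vs + dir_deriv v \<eta> x vs)) (at x)"
    unfolding plus_fun_apply using assms by (intro has_derivative_add smooth_ext_on_has_derivative)
  then show "dir_deriv v (\<lambda>y. \<omega> y + \<eta> y) x vs = (dir_deriv v \<omega> x + dir_deriv v \<eta> x) vs"
    by (simp add: dir_derivI)
qed

lemma dir_deriv_scale:
  assumes "smooth_ext_on k U \<omega>" "x \<in> U"
  shows "dir_deriv v (\<lambda>y. ext_scale r (\<omega> y)) x = ext_scale r (dir_deriv v \<omega> x)"
proof
  fix vs
  have "((\<lambda>y. (ext_scale r (\<omega> y)) vs) has_derivative (\<lambda>v. r * dir_deriv v \<omega> x vs)) (at x)"
    unfolding ext_scale_apply using assms by (intro has_derivative_mult_right smooth_ext_on_has_derivative)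
  then show "dir_deriv v (\<lambda>y. ext_scale r (\<omega> y)) x vs = (ext_scale r (dir_deriv v \<omega> x)) vs"
    by (simp add: dir_derivI)
qed

lemma dir_deriv_wedge:
  assumes "smooth_ext_on k U \<omega>" "smooth_ext_on l U \<eta>" "x \<in> U"
  shows "dir_deriv v (\<lambda>y. wedge (\<omega> y) (\<eta> y)) x = wedge (dir_deriv v \<omega> x) (\<eta> x) + wedge (\<omega> x) (dir_deriv v \<eta> x)"
proof
  fix vs
  have "((\<lambda>y. wedge (\<omega> y) (\<eta> y) vs) has_derivative
      (\<lambda>v. (wedge (dir_deriv v \<omega> x) (\<eta> x) + wedge (\<omega> x) (dir_deriv v \<eta> x)) vs)) (at x)"
    unfolding wedge_eq_sum plus_fun_apply sum.distrib[symmetric]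
  proof (intro has_derivative_sum)
    fix k and \<sigma> :: "nat \<Rightarrow> nat"
    let ?a = "map (\<lambda>i. vs ! \<sigma> i) [0..<k]" and ?b = "map (\<lambda>i. vs ! \<sigma> i) [k..<length vs]"
    have "((\<lambda>y. of_int (sign \<sigma>) / (fact k * fact (length vs - k)) * (\<omega> y ?a * \<eta> y ?b)) has_derivative
        (\<lambda>v. of_int (sign \<sigma>) / (fact k * fact (length vs - k)) * (\<omega> x ?a * dir_deriv v \<eta> x ?b + dir_deriv v \<omega> x ?a * \<eta> x ?b))) (at x)"
      using assms by (intro has_derivative_mult_right has_derivative_mult smooth_ext_on_has_derivative)
    moreover have "(\<lambda>y. of_int (sign \<sigma>) / (fact k * fact (length vs - k)) * (\<omega> y ?a * \<eta> y ?b)) =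
        (\<lambda>y. of_int (sign \<sigma>) * \<omega> y ?a * \<eta> y ?b / (fact k * fact (length vs - k)))"
      by (simp add: fun_eq_iff)
    moreover have "(\<lambda>v. of_int (sign \<sigma>) / (fact k * fact (length vs - k)) * (\<omega> x ?a * dir_deriv v \<eta> x ?b + dir_deriv v \<omega> x ?a * \<eta> x ?b)) =
        (\<lambda>v. of_int (sign \<sigma>) * dir_deriv v \<omega> x ?a * \<eta> x ?b / (fact k * fact (length vs - k)) +
             of_int (sign \<sigma>) * \<omega> x ?a * dir_deriv v \<eta> x ?b / (fact k * fact (length vs - k)))"
      by (simp add: fun_eq_iff distrib_left add_divide_distrib add.commute)
    ultimately show "((\<lambda>y. of_int (sign \<sigma>) * \<omega> y ?a * \<eta> y ?b / (fact k * fact (length vs - k))) has_derivative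
        (\<lambda>v. of_int (sign \<sigma>) * dir_deriv v \<omega> x ?a * \<eta> x ?b / (fact k * fact (length vs - k)) +
             of_int (sign \<sigma>) * \<omega> x ?a * dir_deriv v \<eta> x ?b / (fact k * fact (length vs - k)))) (at x)"
      by (simp only:)
  qed
  then show "dir_deriv v (\<lambda>y. wedge (\<omega> y) (\<eta> y)) x vs =
      (wedge (dir_deriv v \<omega> x) (\<eta> x) + wedge (\<omega> x) (dir_deriv v \<eta> x)) vs"
    by (rule dir_derivI)
qed

text \<open>The defining identities of an alternating form hold at all points of \<open>U\<close>, so they can be differentiated.\<close>

lemma alt_form_dir_deriv:
  assumes "open U" "smooth_ext_on k U \<omega>" "x \<in> U"
  shows "alt_form k (dir_deriv w \<omega> x)"
proof -
  have d: "((\<lambda>x. \<omega> x vs) has_derivative (\<lambda>v. dir_deriv v \<omega> x vs)) (at x)" for vs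
    by (rule smooth_ext_on_has_derivative[OF assms(2,3)])
  have alt: "alt_form k (\<omega> y)" if "y \<in> U" for y using assms that by (auto simp: smooth_ext_on_def)
  have transfer: "dir_deriv w \<omega> x vs = D w"
    if "(g has_derivative D) (at x)" "\<And>y. y \<in> U \<Longrightarrow> g y = \<omega> y vs" for g D vs
    by (rule dir_derivI, rule has_derivative_transform_within_open[OF that(1) assms(1,3) that(2)])
  show ?thesis unfolding alt_form_def
  proof (intro conjI allI impI)
    fix vs :: "'b list" assume "length vs \<noteq> k"
    then show "dir_deriv w \<omega> x vs = 0"
      using transfer[of "\<lambda>y. 0" "\<lambda>v. 0" vs] alt_form_length[OF alt] by auto
  next
    fix vs :: "'b list" and i assume i: "i < k" "length vs = k"
    have lin: "linear (\<lambda>v. \<omega> y (vs[i := v]))" if "y \<in> U" for y using alt[OF that] i by (simp add: alt_form_def)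
    show "linear (\<lambda>v. dir_deriv w \<omega> x (vs[i := v]))"
    proof (rule linearI)
      fix a b
      show "dir_deriv w \<omega> x (vs[i := a + b]) = dir_deriv w \<omega> x (vs[i := a]) + dir_deriv w \<omega> x (vs[i := b])"
        by (rule transfer[OF has_derivative_add[OF d d]]) (simp add: linear_add[OF lin])
    next
      fix r a
      show "dir_deriv w \<omega> x (vs[i := r *\<^sub>R a]) = r *\<^sub>R dir_deriv w \<omega> x (vs[i := a])"
        using transfer[OF has_derivative_mult_right[OF d[of "vs[i := a]"], of r], of "vs[i := r *\<^sub>R a]"]
        by (simp add: linear_scale[OF lin])
    qed
  next
    fix vs :: "'b list" and i j assume "i < k" "j < k" "length vs = k \<and> i \<noteq> j \<and> vs ! i = vs ! j"
    then have "\<omega> y vs = 0" if "y \<in> U" for y using alt[OF that] unfolding alt_form_def by blast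
    then show "dir_deriv w \<omega> x vs = 0" using transfer[of "\<lambda>y. 0" "\<lambda>v. 0" vs] by auto
  qed
qed

lemma smooth_ext_on_dir_deriv:
  assumes "open U" "smooth_ext_on k U \<omega>"
  shows "smooth_ext_on k U (dir_deriv v \<omega>)"
  unfolding smooth_ext_on_def
proof (intro conjI ballI allI)
  show "smooth_on (\<lambda>x. dir_deriv v \<omega> x vs) U" for vs
    unfolding dir_deriv_def by (rule smooth_on_derivative[OF smooth_ext_on_smooth[OF assms(2)]])
qed (rule alt_form_dir_deriv[OF assms])

lemma extd_eq_dir_deriv:
  "extd \<omega> x vs = (\<Sum>i<length vs. (-1) ^ i * dir_deriv (vs ! i) \<omega> x (take i vs @ drop (Suc i) vs))"
  by (simp add: extd_def dir_deriv_def)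

lemma extd_add:
  assumes "smooth_ext_on k U \<omega>" "smooth_ext_on l U \<eta>" "x \<in> U"
  shows "extd (\<lambda>y. \<omega> y + \<eta> y) x = extd \<omega> x + extd \<eta> x"
  by (auto simp: fun_eq_iff extd_eq_dir_deriv dir_deriv_add[OF assms] sum.distrib distrib_left)

lemma extd_scale:
  assumes "smooth_ext_on k U \<omega>" "x \<in> U"
  shows "extd (\<lambda>y. ext_scale r (\<omega> y)) x = ext_scale r (extd \<omega> x)"
  by (auto simp: fun_eq_iff extd_eq_dir_deriv dir_deriv_scale[OF assms] sum_distrib_left mult.left_commute)

lemma extd_diff:
  assumes "open U" "smooth_ext_on k U \<omega>" "smooth_ext_on k U \<eta>" "x \<in> U"
  shows "extd (\<lambda>y. \<omega> y - \<eta> y) x = extd \<omega> x - extd \<eta> x"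
proof -
  have e: "(\<lambda>y. \<omega> y + ext_scale (-1) (\<eta> y)) = (\<lambda>y. \<omega> y - \<eta> y)" by (auto simp: fun_eq_iff)
  have "extd (\<lambda>y. \<omega> y + ext_scale (-1) (\<eta> y)) x = extd \<omega> x + ext_scale (-1) (extd \<eta> x)"
    using assms by (simp add: extd_add[OF assms(2) smooth_ext_on_scale[OF assms(1,3)]] extd_scale[OF assms(3)])
  then show ?thesis unfolding e by (auto simp: fun_eq_iff)
qed

lemma extd_cong:
  assumes "open U" "x \<in> U" "\<And>y. y \<in> U \<Longrightarrow> \<omega> y = \<eta> y" "smooth_ext_on k U \<eta>"
  shows "extd \<omega> x = extd \<eta> x"
  using dir_deriv_cong[OF assms(1,2) _ assms(4), of \<omega>] assms(3) by (auto simp: fun_eq_iff extd_eq_dir_deriv)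

lemma extd_zero_on:
  assumes "open U" "x \<in> U" "\<And>y. y \<in> U \<Longrightarrow> \<omega> y = 0"
  shows "extd \<omega> x = 0"
  using extd_cong[OF assms(1,2), of \<omega> "\<lambda>y. 0" 0] assms(3) smooth_ext_on_0
  by (auto simp: fun_eq_iff extd_def frechet_derivative_const)

lemma linear_dir_deriv:
  "smooth_ext_on k U \<omega> \<Longrightarrow> x \<in> U \<Longrightarrow> linear (\<lambda>v. dir_deriv v \<omega> x vs)"
  using smooth_ext_on_has_derivative has_derivative_linear by blast

text \<open>Alternation: by Cartan's formula, contracting twice with \<open>v\<close> gives \<open>L i - i L + d i i\<close>, where \<open>i\<close> is the interior
product with \<open>v\<close> and \<open>L\<close> the Lie derivative; \<open>L\<close> commutes with \<open>i\<close>, and \<open>i i = 0\<close>.\<close>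

lemma alt_form_extd:
  "open U \<Longrightarrow> x \<in> U \<Longrightarrow> smooth_ext_on k U \<omega> \<Longrightarrow> alt_form (Suc k) (extd \<omega> x)"
proof (induction k arbitrary: \<omega> rule: less_induct)
  case (less k)
  note U = less.prems(1,2) and sm = less.prems(3)
  have c: "alt_form k (extd (\<lambda>y. contract v (\<omega> y)) x)" for v
  proof (cases k)
    case 0
    have "extd (\<lambda>y. contract v (\<omega> y)) x = 0"
      by (rule extd_zero_on[OF U]) (use sm 0 alt_form_0_contract in \<open>auto simp: smooth_ext_on_def\<close>)
    then show ?thesis by simp
  next
    case (Suc m)
    then show ?thesis using less.IH[of m "\<lambda>y. contract v (\<omega> y)"] U smooth_ext_on_contract[OF sm, of v]
      by (simp del: contract_apply)
  qed
  show ?case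
  proof (rule alt_formI_contract)
    fix v
    show "alt_form k (contract v (extd \<omega> x))"
      unfolding contract_extd using U sm c by (intro alt_form_diff alt_form_dir_deriv)
  next
    fix vs
    have e: "extd \<omega> x (v # vs) = dir_deriv v \<omega> x vs - (\<Sum>i<length vs. (-1) ^ i *
        contract v (dir_deriv (vs ! i) \<omega> x) (take i vs @ drop (Suc i) vs))" for v
      using fun_cong[OF contract_extd[of v \<omega> x], of vs]
      unfolding extd_eq_dir_deriv[of "\<lambda>y. contract v (\<omega> y)"] contract_dir_deriv[symmetric] by simp
    have "linear (\<lambda>v. contract v (dir_deriv w \<omega> x) us)" for w us
      using alt_form_linear_Cons[OF alt_form_dir_deriv[OF U(1) sm U(2)]] by simp
    then have "linear (\<lambda>v. (-1) ^ i * contract v (dir_deriv w \<omega> x) us)" for i w us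
      by (intro linear_compose_scale_right[where 'b=real, simplified])
    then show "linear (\<lambda>v. extd \<omega> x (v # vs))"
      unfolding e by (intro linear_compose_sub linear_dir_deriv[OF sm U(2)] linear_compose_sum ballI)
  next
    fix v vs
    have "extd (\<lambda>y. contract v (contract v (\<omega> y))) x = 0"
      by (rule extd_zero_on[OF U]) (use sm contract_contract in \<open>auto simp: smooth_ext_on_def\<close>)
    then have "contract v (contract v (extd \<omega> x)) = 0"
      by (simp add: contract_extd contract_minus contract_dir_deriv del: contract_apply)
    then show "extd \<omega> x (v # v # vs) = 0" by (simp add: fun_eq_iff)
  qed simp
qed

lemma smooth_ext_on_extd:
  assumes "open U" "smooth_ext_on k U \<omega>"
  shows "smooth_ext_on (Suc k) U (extd \<omega>)"
  unfolding smooth_ext_on_def extd_eq_dir_deriv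
  using alt_form_extd[OF assms(1) _ assms(2)]
proof (intro conjI ballI allI)
  fix vs
  show "smooth_on (\<lambda>z. \<Sum>i<length vs. (- 1) ^ i * dir_deriv (vs ! i) \<omega> z (take i vs @ drop (Suc i) vs)) U"
    using smooth_ext_on_dir_deriv[OF assms] smooth_ext_on_smooth
    by (intro smooth_on_sum smooth_on_mult smooth_on_const assms(1)) blast
qed (simp add: extd_eq_dir_deriv[abs_def] )

text \<open>By induction on the arguments: contraction turns the claim into the product rule for \<open>dir_deriv\<close> and two instances
of lower degree. In degree 0 a contraction vanishes, so there the sign of the instance does not matter.\<close>

lemma extd_wedge:
  "open U \<Longrightarrow> x \<in> U \<Longrightarrow> smooth_ext_on k U \<omega> \<Longrightarrow> smooth_ext_on l U \<eta> \<Longrightarrow>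
    extd (\<lambda>y. wedge (\<omega> y) (\<eta> y)) x = wedge (extd \<omega> x) (\<eta> x) + ext_scale ((-1) ^ k) (wedge (\<omega> x) (extd \<eta> x))"
proof
  fix vs
  assume U: "open U" "x \<in> U"
  assume "smooth_ext_on k U \<omega>" "smooth_ext_on l U \<eta>"
  then show "extd (\<lambda>y. wedge (\<omega> y) (\<eta> y)) x vs =
    (wedge (extd \<omega> x) (\<eta> x) + ext_scale ((-1) ^ k) (wedge (\<omega> x) (extd \<eta> x))) vs"
  proof (induction vs arbitrary: k l \<omega> \<eta>)
    case (Cons v vs)
    note sw = Cons.prems(1) and se = Cons.prems(2)
    note cw = smooth_ext_on_contract[OF sw, of v] and ce = smooth_ext_on_contract[OF se, of v]
    have a: "alt_form k (\<omega> y)" "alt_form l (\<eta> y)" if "y \<in> U" for y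
      using that sw se smooth_ext_on_alt by blast+
    have IH1: "extd (\<lambda>y. wedge (contract v (\<omega> y)) (\<eta> y)) x vs =
      wedge (extd (\<lambda>y. contract v (\<omega> y)) x) (\<eta> x) vs - (-1) ^ k * wedge (contract v (\<omega> x)) (extd \<eta> x) vs"
    proof (cases k)
      case 0
      then have z: "contract v (\<omega> y) = 0" if "y \<in> U" for y using a(1)[OF that] alt_form_0_contract by auto
      have "extd (\<lambda>y. wedge (contract v (\<omega> y)) (\<eta> y)) x = 0" "extd (\<lambda>y. contract v (\<omega> y)) x = 0"
        using z by (auto intro!: extd_zero_on[OF U])
      then show ?thesis using z[OF U(2)] by (simp del: contract_apply)
    next
      case (Suc m)
      then show ?thesis using Cons.IH[OF cw se] by (simp del: contract_apply)
    qed
    have IH2: "extd (\<lambda>y. wedge (\<omega> y) (contract v (\<eta> y))) x vs =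
      wedge (extd \<omega> x) (contract v (\<eta> x)) vs + (-1) ^ k * wedge (\<omega> x) (extd (\<lambda>y. contract v (\<eta> y)) x) vs"
      using Cons.IH[OF sw ce] by (simp del: contract_apply)
    have "extd (\<lambda>y. contract v (wedge (\<omega> y) (\<eta> y))) x =
       extd (\<lambda>y. wedge (contract v (\<omega> y)) (\<eta> y) + ext_scale ((-1) ^ k) (wedge (\<omega> y) (contract v (\<eta> y)))) x"
    proof (cases "k + l")
      case 0
      then have "contract v (\<omega> y) = 0" "contract v (\<eta> y) = 0" if "y \<in> U" for y
        using a[OF that] alt_form_0_contract by auto
      then show ?thesis by (subst (1 2) extd_zero_on[OF U]) (auto simp: contract_wedge[OF a] simp del: contract_apply)
    next
      case (Suc m)
      have "smooth_ext_on (k + l - 1) U (\<lambda>y. contract v (wedge (\<omega> y) (\<eta> y)))"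
        by (intro smooth_ext_on_contract smooth_ext_on_wedge U sw se)
      then show ?thesis
        by (intro extd_cong[OF U, symmetric]) (auto simp: contract_wedge[OF a] simp del: contract_apply)
    qed
    also have "\<dots> = extd (\<lambda>y. wedge (contract v (\<omega> y)) (\<eta> y)) x +
        ext_scale ((-1) ^ k) (extd (\<lambda>y. wedge (\<omega> y) (contract v (\<eta> y))) x)"
      using U by (simp add: extd_add[OF smooth_ext_on_wedge[OF U(1) cw se]
        smooth_ext_on_scale[OF U(1) smooth_ext_on_wedge[OF U(1) sw ce]]] extd_scale[OF smooth_ext_on_wedge[OF U(1) sw ce]]
        del: contract_apply)
    finally have A: "extd (\<lambda>y. contract v (wedge (\<omega> y) (\<eta> y))) x = \<dots>" .
    have "extd (\<lambda>y. wedge (\<omega> y) (\<eta> y)) x (v # vs) = contract v (extd (\<lambda>y. wedge (\<omega> y) (\<eta> y)) x) vs" by simp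
    also have "\<dots> = contract v (wedge (extd \<omega> x) (\<eta> x) + ext_scale ((-1) ^ k) (wedge (\<omega> x) (extd \<eta> x))) vs"
      unfolding contract_extd A contract_plus contract_times contract_wedge[OF alt_form_extd[OF U sw] a(2)[OF U(2)]]
        contract_wedge[OF a(1)[OF U(2)] alt_form_extd[OF U se]] dir_deriv_wedge[OF sw se U(2)]
      by (simp add: IH1 IH2 wedge_diff_left wedge_diff_right algebra_simps power_mult_distrib[symmetric] del: contract_apply)
    finally show ?case by simp
  qed simp
qed

text \<open>Equality of mixed partial derivatives.\<close>

lemma dir_deriv_extd:
  assumes "open U" "smooth_ext_on k U \<omega>" "x \<in> U"
  shows "dir_deriv v (extd \<omega>) x = extd (dir_deriv v \<omega>) x"
proof
  fix vs
  have s: "smooth_on (\<lambda>y. \<omega> y us) U" for us by (rule smooth_ext_on_smooth[OF assms(2)])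
  have "((\<lambda>y. extd \<omega> y vs) has_derivative (\<lambda>v. \<Sum>i<length vs. (-1) ^ i *
      dir_deriv v (\<lambda>y. dir_deriv (vs ! i) \<omega> y) x (take i vs @ drop (Suc i) vs))) (at x)"
    unfolding extd_eq_dir_deriv
    using smooth_ext_on_dir_deriv[OF assms(1,2)] assms(3)
    by (intro has_derivative_sum has_derivative_mult_right smooth_ext_on_has_derivative)
  then have "dir_deriv v (extd \<omega>) x vs = (\<Sum>i<length vs. (-1) ^ i *
      dir_deriv v (\<lambda>y. dir_deriv (vs ! i) \<omega> y) x (take i vs @ drop (Suc i) vs))"
    by (rule dir_derivI)
  also have "\<dots> = extd (dir_deriv v \<omega>) x vs"
    unfolding extd_eq_dir_deriv
    using second_derivative_symmetric[OF assms(1) s assms(3)] by (simp add: dir_deriv_def)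
  finally show "dir_deriv v (extd \<omega>) x vs = extd (dir_deriv v \<omega>) x vs" .
qed

text \<open>Contraction with \<open>v\<close> gives \<open>L d - d i d = L d - d L + d d i\<close>, where the Lie derivative \<open>L\<close> commutes with \<open>d\<close>.\<close>

lemma extd_extd:
  "open U \<Longrightarrow> x \<in> U \<Longrightarrow> smooth_ext_on k U \<omega> \<Longrightarrow> extd (extd \<omega>) x = 0"
proof
  fix vs
  assume U: "open U" "x \<in> U" and "smooth_ext_on k U \<omega>"
  then show "extd (extd \<omega>) x vs = 0 vs"
  proof (induction vs arbitrary: k \<omega>)
    case (Cons v vs)
    note sm = Cons.prems(3)
    note sc = smooth_ext_on_contract[OF sm, of v]
    have c: "extd (\<lambda>y. contract v (extd \<omega> y)) x = extd (dir_deriv v \<omega>) x - extd (extd (\<lambda>y. contract v (\<omega> y))) x"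
    proof (cases k)
      case 0
      then have z: "contract v (\<omega> y) = 0" if "y \<in> U" for y using smooth_ext_on_alt[OF sm that] alt_form_0_contract by auto
      have z': "extd (\<lambda>y. contract v (\<omega> y)) y = 0" if "y \<in> U" for y
        by (rule extd_zero_on[OF U(1) that z])
      have "extd (\<lambda>y. contract v (extd \<omega> y)) x = extd (dir_deriv v \<omega>) x"
        by (rule extd_cong[OF U _ smooth_ext_on_dir_deriv[OF U(1) sm]]) (simp add: contract_extd z')
      moreover have "extd (extd (\<lambda>y. contract v (\<omega> y))) x = 0"
        by (rule extd_zero_on[OF U z'])
      ultimately show ?thesis by simp
    next
      case (Suc m)
      have s: "smooth_ext_on k U (extd (\<lambda>y. contract v (\<omega> y)))" 
        using smooth_ext_on_extd[OF U(1) sc] Suc by simp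
      show ?thesis unfolding contract_extd
        by (rule extd_diff[OF U(1) smooth_ext_on_dir_deriv[OF U(1) sm] s U(2)])
    qed
    have "extd (extd \<omega>) x (v # vs) = contract v (extd (extd \<omega>) x) vs" by simp
    also have "\<dots> = extd (extd (\<lambda>y. contract v (\<omega> y))) x vs"
      unfolding contract_extd[of v "extd \<omega>"] c dir_deriv_extd[OF U(1) sm U(2)] by simp
    finally show ?case using Cons.IH[OF U sc] by simp
  qed simp
qed

lemma linear_euclidean_sum:
  fixes a :: "'e::euclidean_space" and g :: "'e \<Rightarrow> real"
  assumes "linear g" shows "g a = (\<Sum>b\<in>Basis. inner a b * g b)"
proof -
  have "g (\<Sum>b\<in>Basis. inner a b *\<^sub>R b) = (\<Sum>b\<in>Basis. inner a b * g b)"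
    by (simp add: linear_sum[OF assms] linear_scale[OF assms])
  then show ?thesis by (simp add: euclidean_representation)
qed

text \<open>The product rule for a form at a moving point \<open>\<phi> y\<close>, evaluated on moving vectors. Expanding the first vector in a basis
reduces it to the contractions of the form with the basis vectors.\<close>

lemma has_derivative_ext_at_vectors:
  fixes f :: "'p::real_normed_vector \<Rightarrow> 'e::euclidean_space ext" and a :: "'b \<Rightarrow> 'v::real_normed_vector \<Rightarrow> 'e"
  assumes U: "open U'" "\<phi> x \<in> U'"
    and \<phi>: "(\<phi> has_derivative \<phi>') (at x)" and a: "\<And>v. (a v has_derivative a' v) (at x)"
  shows "smooth_ext_on k U' f \<Longrightarrow>
   ((\<lambda>y. f (\<phi> y) (map (\<lambda>v. a v y) vs)) has_derivative
    (\<lambda>h. dir_deriv (\<phi>' h) f (\<phi> x) (map (\<lambda>v. a v x) vs) +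
      (\<Sum>j<length vs. f (\<phi> x) ((map (\<lambda>v. a v x) vs)[j := a' (vs ! j) h])))) (at x)"
proof (induction vs arbitrary: k f)
  case Nil
  have "((\<lambda>z. f z []) has_derivative (\<lambda>v. dir_deriv v f (\<phi> x) [])) (at (\<phi> x))"
    by (rule smooth_ext_on_has_derivative[OF Nil U(2)])
  from diff_chain_at[OF \<phi> this] show ?case by (simp add: o_def)
next
  case (Cons v vs)
  have ev: "\<forall>\<^sub>F y in at x. \<phi> y \<in> U'"
    using has_derivative_continuous[OF \<phi>] U by (metis continuous_within topological_tendstoD)
  have exp: "f z (w # us) = (\<Sum>b\<in>Basis. inner w b * contract b (f z) us)" if "z \<in> U'" for z w us
    using linear_euclidean_sum[OF alt_form_linear_Cons[OF smooth_ext_on_alt[OF Cons.prems that]], of w us] by simp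
  have dexp: "dir_deriv h f (\<phi> x) (w # us) = (\<Sum>b\<in>Basis. inner w b * dir_deriv h (\<lambda>y. contract b (f y)) (\<phi> x) us)" for h w us
    using linear_euclidean_sum[OF alt_form_linear_Cons[OF alt_form_dir_deriv[OF U(1) Cons.prems U(2)]], of h w us]
    by (simp add: dir_deriv_def)
  let ?us = "\<lambda>y. map (\<lambda>v. a v y) vs"
  let ?D = "\<lambda>g h. dir_deriv (\<phi>' h) g (\<phi> x) (?us x) + (\<Sum>j<length vs. g (\<phi> x) ((?us x)[j := a' (vs ! j) h]))"
  have "((\<lambda>y. \<Sum>b\<in>Basis. inner (a v y) b * contract b (f (\<phi> y)) (?us y)) has_derivative
     (\<lambda>h. \<Sum>b\<in>Basis. inner (a v x) b * ?D (\<lambda>y. contract b (f y)) h + inner (a' v h) b * contract b (f (\<phi> x)) (?us x))) (at x)"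
    by (intro has_derivative_sum has_derivative_mult has_derivative_inner_left a
      Cons.IH[OF smooth_ext_on_contract[OF Cons.prems]])
  moreover have "(\<Sum>b\<in>Basis. inner (a v x) b * ?D (\<lambda>y. contract b (f y)) h + inner (a' v h) b * contract b (f (\<phi> x)) (?us x))
     = dir_deriv (\<phi>' h) f (\<phi> x) (map (\<lambda>v. a v x) (v # vs)) +
      (\<Sum>j<length (v # vs). f (\<phi> x) ((map (\<lambda>v. a v x) (v # vs))[j := a' ((v # vs) ! j) h]))" for h
    unfolding length_Cons sum.lessThan_Suc_shift
    by (simp add: exp[OF U(2)] dexp sum.distrib distrib_left sum_distrib_left sum.swap[of _ Basis] del: contract_apply)
  ultimately have "((\<lambda>y. \<Sum>b\<in>Basis. inner (a v y) b * contract b (f (\<phi> y)) (?us y)) has_derivative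
     (\<lambda>h. dir_deriv (\<phi>' h) f (\<phi> x) (map (\<lambda>v. a v x) (v # vs)) +
      (\<Sum>j<length (v # vs). f (\<phi> x) ((map (\<lambda>v. a v x) (v # vs))[j := a' ((v # vs) ! j) h])))) (at x)"
    by (simp del: contract_apply)
  then show ?case
  proof (rule has_derivative_transform_eventually)
    show "\<forall>\<^sub>F y in at x. (\<Sum>b\<in>Basis. inner (a v y) b * contract b (f (\<phi> y)) (?us y)) = f (\<phi> y) (map (\<lambda>v. a v y) (v # vs))"
      using ev by eventually_elim (simp add: exp)
    show "(\<Sum>b\<in>Basis. inner (a v x) b * contract b (f (\<phi> x)) (?us x)) = f (\<phi> x) (map (\<lambda>v. a v x) (v # vs))"
      using U(2) by (simp add: exp)
  qed simp
qed

text \<open>The expression through which second derivatives of a coordinate change enter the exterior derivative of a pullback,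
with \<open>B\<close> the second and \<open>L\<close> the first derivative. Among the terms that involve the first argument \<open>v\<close> in \<open>B\<close>, those in which
it is the direction of differentiation have \<open>B v w\<close> in a slot \<open>j\<close>, and those in which it is an argument have \<open>B w v\<close> in
front; they cancel. The other terms form the same expression for a contraction of \<open>f\<close>.\<close>

lemma alternating_symmetric_cancel:
  assumes "\<And>u w. B u w = B w u"
  shows "alt_form k f \<Longrightarrow> (\<Sum>i<length vs. (-1) ^ i * (\<Sum>j<length vs - 1.
     f ((map L (take i vs @ drop (Suc i) vs))[j := B (vs ! i) ((take i vs @ drop (Suc i) vs) ! j)]))) = (0::real)"
proof (induction vs arbitrary: k f)
  case (Cons v ws)
  let ?o = "\<lambda>i. take i ws @ drop (Suc i) ws"
  let ?m = "length ws"
  have first: "(\<Sum>j<?m. f ((map L ws)[j := B v (ws ! j)])) = (\<Sum>i<?m. (-1) ^ i * f (B v (ws ! i) # map L (?o i)))"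
  proof (rule sum.cong[OF refl])
    fix j assume "j \<in> {..<?m}"
    then have "(map L ws)[j := B v (ws ! j)] = take j (map L ws) @ B v (ws ! j) # drop (Suc j) (map L ws)" and j: "j < ?m"
      by (auto simp: upd_conv_take_nth_drop)
    then show "f ((map L ws)[j := B v (ws ! j)]) = (-1) ^ j * f (B v (ws ! j) # map L (?o j))"
      using alt_form_to_front[OF Cons.prems, of "take j (map L ws)"] j by (simp add: take_map drop_map)
  qed
  have step: "(\<Sum>j<?m. f ((map L (v # ?o i))[j := B (ws ! i) ((v # ?o i) ! j)])) =
      f (B (ws ! i) v # map L (?o i)) + (\<Sum>j<?m - 1. contract (L v) f ((map L (?o i))[j := B (ws ! i) (?o i ! j)]))"
    if i: "i < ?m" for i
  proof -
    obtain m' where m': "?m = Suc m'" using i by (cases ?m) auto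
    show ?thesis unfolding m' sum.lessThan_Suc_shift by simp
  qed
  have "(\<Sum>i<length (v # ws). (-1) ^ i * (\<Sum>j<length (v # ws) - 1.
     f ((map L (take i (v # ws) @ drop (Suc i) (v # ws)))[j := B ((v # ws) ! i) ((take i (v # ws) @ drop (Suc i) (v # ws)) ! j)])))
    = (\<Sum>j<?m. f ((map L ws)[j := B v (ws ! j)])) +
      (\<Sum>i<?m. (-1) ^ Suc i * (\<Sum>j<?m. f ((map L (v # ?o i))[j := B (ws ! i) ((v # ?o i) ! j)])))"
    unfolding length_Cons sum.lessThan_Suc_shift by simp
  also have "(\<Sum>i<?m. (-1) ^ Suc i * (\<Sum>j<?m. f ((map L (v # ?o i))[j := B (ws ! i) ((v # ?o i) ! j)])))
    = (\<Sum>i<?m. (-1) ^ Suc i * (f (B (ws ! i) v # map L (?o i)) + (\<Sum>j<?m - 1. contract (L v) f ((map L (?o i))[j := B (ws ! i) (?o i ! j)]))))"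
    by (intro sum.cong refl arg_cong2[where f="(*)"] step) simp
  also have "\<dots> = - (\<Sum>i<?m. (-1) ^ i * f (B (ws ! i) v # map L (?o i))) -
     (\<Sum>i<?m. (-1) ^ i * (\<Sum>j<?m - 1. contract (L v) f ((map L (?o i))[j := B (ws ! i) (?o i ! j)])))"
    by (simp add: distrib_left sum_negf sum_subtractf del: contract_apply)
  also have "(\<Sum>i<?m. (-1) ^ i * (\<Sum>j<?m - 1. contract (L v) f ((map L (?o i))[j := B (ws ! i) (?o i ! j)]))) = 0"
    by (rule Cons.IH[OF alt_form_contract[OF Cons.prems]])
  finally show ?case unfolding first using assms[of v] by simp
qed simp

text \<open>Besides the pullback of the exterior derivative, the chain rule produces the second-derivative terms of
\<open>alternating_symmetric_cancel\<close>.\<close>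

lemma extd_pullback:
  fixes \<omega> :: "'e::euclidean_space \<Rightarrow> 'e ext" and \<phi> :: "'e \<Rightarrow> 'e"
  assumes U: "open U" "x \<in> U" "open U'" and \<phi>: "smooth_on \<phi> U" "\<phi> ` U \<subseteq> U'"
    and sm: "smooth_ext_on k U' \<omega>'"
    and eq: "\<And>y vs. y \<in> U \<Longrightarrow> \<omega> y vs = \<omega>' (\<phi> y) (map (frechet_derivative \<phi> (at y)) vs)"
  shows "extd \<omega> x vs = extd \<omega>' (\<phi> x) (map (frechet_derivative \<phi> (at x)) vs)"
proof -
  let ?L = "\<lambda>y. frechet_derivative \<phi> (at y)"
  let ?B = "\<lambda>u w. frechet_derivative (\<lambda>y. ?L y w) (at x) u"
  let ?o = "\<lambda>i. take i vs @ drop (Suc i) vs"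
  have in': "\<phi> x \<in> U'" using \<phi>(2) U(2) by auto
  have d: "dir_deriv h \<omega> x us = dir_deriv (?L x h) \<omega>' (\<phi> x) (map (?L x) us) +
      (\<Sum>j<length us. \<omega>' (\<phi> x) ((map (?L x) us)[j := ?B h (us ! j)]))" for h us
  proof (rule dir_derivI)
    have "((\<lambda>y. \<omega>' (\<phi> y) (map (\<lambda>v. ?L y v) us)) has_derivative
      (\<lambda>h. dir_deriv (?L x h) \<omega>' (\<phi> x) (map (\<lambda>v. ?L x v) us) +
        (\<Sum>j<length us. \<omega>' (\<phi> x) ((map (\<lambda>v. ?L x v) us)[j := ?B h (us ! j)])))) (at x)"
      by (rule has_derivative_ext_at_vectors[where \<phi> = \<phi> and \<phi>' = "?L x" and x = x and f = \<omega>' and a = "\<lambda>v y. ?L y v" and a' = "\<lambda>v h. ?B h v",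
          OF U(3) in' _ _ sm])
        (use smooth_on_has_derivative[OF \<phi>(1) U(2)] smooth_on_has_derivative[OF smooth_on_derivative[OF \<phi>(1)] U(2)] in auto)
    then show "((\<lambda>y. \<omega> y us) has_derivative
      (\<lambda>h. dir_deriv (?L x h) \<omega>' (\<phi> x) (map (?L x) us) +
        (\<Sum>j<length us. \<omega>' (\<phi> x) ((map (?L x) us)[j := ?B h (us ! j)])))) (at x)"
      by (rule has_derivative_transform_within_open[OF _ U(1,2)]) (simp add: eq)
  qed
  have "extd \<omega> x vs = (\<Sum>i<length vs. (-1) ^ i * dir_deriv (?L x (vs ! i)) \<omega>' (\<phi> x) (map (?L x) (?o i)))
     + (\<Sum>i<length vs. (-1) ^ i * (\<Sum>j<length vs - 1. \<omega>' (\<phi> x) ((map (?L x) (?o i))[j := ?B (vs ! i) (?o i ! j)])))"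
    unfolding extd_eq_dir_deriv d sum.distrib[symmetric] distrib_left[symmetric]
  proof (intro sum.cong refl arg_cong2[where f="(*)"] arg_cong2[where f="(+)"])
    fix i assume "i \<in> {..<length vs}"
    then show "{..<length (?o i)} = {..<length vs - 1}" by auto
  qed
  also have "(\<Sum>i<length vs. (-1) ^ i * (\<Sum>j<length vs - 1. \<omega>' (\<phi> x) ((map (?L x) (?o i))[j := ?B (vs ! i) (?o i ! j)]))) = 0"
    by (rule alternating_symmetric_cancel[OF _ smooth_ext_on_alt[OF sm in']])
      (rule second_derivative_symmetric_euclidean[OF U(1) \<phi>(1) U(2)])
  also have "(\<Sum>i<length vs. (-1) ^ i * dir_deriv (?L x (vs ! i)) \<omega>' (\<phi> x) (map (?L x) (?o i))) =
     extd \<omega>' (\<phi> x) (map (?L x) vs)"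
    unfolding extd_eq_dir_deriv by (auto simp: take_map drop_map intro!: sum.cong)
  finally show ?thesis by simp
qed

lemma smooth_ext_on_slice:
  fixes W :: "real \<times> 'e::euclidean_space \<Rightarrow> 'e ext"
  assumes "open T" "open U" "smooth_ext_on k (T \<times> U) W" "t \<in> T"
  shows "smooth_ext_on k U (\<lambda>x. W (t, x))"
  using assms smooth_on_slice[OF assms(1,2) _ assms(4)] by (auto simp: smooth_ext_on_def)

lemma dir_deriv_slice:
  assumes "smooth_ext_on k (T \<times> U) W" "t \<in> T" "x \<in> U"
  shows "dir_deriv v (\<lambda>x. W (t, x)) x = dir_deriv (0, v) W (t, x)"
proof
  fix vs
  have "(\<lambda>z. W z vs) differentiable (at (t, x))"
    by (rule smooth_ext_on_differentiable[OF assms(1)]) (use assms in auto)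
  from has_derivative_slice[OF this] show "dir_deriv v (\<lambda>x. W (t, x)) x vs = dir_deriv (0, v) W (t, x) vs"
    by (simp add: dir_derivI) (simp add: dir_deriv_def)
qed

lemma deriv_slice:
  assumes "smooth_ext_on k (T \<times> U) W" "t \<in> T" "x \<in> U"
  shows "deriv (\<lambda>s. W (s, x) vs) t = dir_deriv (1, 0) W (t, x) vs"
proof -
  have "(\<lambda>z. W z vs) differentiable (at (t, x))"
    by (rule smooth_ext_on_differentiable[OF assms(1)]) (use assms in auto)
  from DERIV_imp_deriv[OF has_derivative_time[OF this]] show ?thesis by (simp add: dir_deriv_def)
qed

section \<open>Forms in the charts of an atlas\<close>

text \<open>The elements of degree \<open>k\<close> of the \<open>p\<close>-th power of the ideal; for \<open>p = 0\<close> these are all forms.\<close>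

definition ideal_power :: "('a, 'e::euclidean_space) chart set \<Rightarrow> ('a, 'e) foliation \<Rightarrow> nat \<Rightarrow> nat \<Rightarrow> ('a, 'e) dform set" where
  "ideal_power A F p k = {\<omega>. form A k \<omega> \<and> (\<forall>c\<in>A. \<forall>x\<in>im c. vanishing (tangent F c x) p (\<omega> c x))}"

definition codimension_le :: "('a, 'e::euclidean_space) chart set \<Rightarrow> ('a, 'e) foliation \<Rightarrow> nat \<Rightarrow> bool" where
  "codimension_le A F q \<longleftrightarrow> (\<forall>c\<in>A. \<forall>x\<in>im c. codim_le q (tangent F c x))"

text \<open>What the arguments about \<open>T_form\<close> use of a family \<open>\<beta>\<close>. Independence of the choices passes through one-forms that
are of this kind but do not come with a defining form \<open>\<alpha>\<close> such that \<open>d\<alpha> = \<alpha> \<and> \<beta>\<close>.\<close>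

definition leafwise_closed_family ::
  "('a, 'e::euclidean_space) chart set \<Rightarrow> real set \<Rightarrow> (real \<Rightarrow> ('a, 'e) foliation) \<Rightarrow> (real \<Rightarrow> ('a, 'e) dform) \<Rightarrow> bool" where
  "leafwise_closed_family A J F b \<longleftrightarrow> smooth_form_family A 1 J b \<and> (\<forall>t\<in>J. ext_d (b t) \<in> ideal_power A (F t) 1 2)"

definition function_form :: "('a, 'e::euclidean_space) chart set \<Rightarrow> (('a, 'e) chart \<Rightarrow> 'e \<Rightarrow> real) \<Rightarrow> ('a, 'e) dform" where
  "function_form A g c x vs = (if c \<in> A \<and> x \<in> im c then g c x * ext_one vs else 0)"

context
  fixes A :: "('a, 'e::euclidean_space) chart set"
begin

lemma form_zero: "form A k \<omega> \<Longrightarrow> c \<notin> A \<or> x \<notin> im c \<Longrightarrow> \<omega> c x = 0"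
  by (rule ext) (unfold form_def zero_fun_apply, blast)

lemma form_smooth_ext: "form A k \<omega> \<Longrightarrow> c \<in> A \<Longrightarrow> smooth_ext_on k (im c) (\<omega> c)"
  by (auto simp: form_def)

lemma form_alt: "form A k \<omega> \<Longrightarrow> alt_form k (\<omega> c x)"
  using form_smooth_ext smooth_ext_on_alt form_zero alt_form_0 by metis

lemma form_compat: "form A k \<omega> \<Longrightarrow> c \<in> A \<Longrightarrow> c' \<in> A \<Longrightarrow> p \<in> fst c \<Longrightarrow> p \<in> fst c' \<Longrightarrow>
    \<omega> c (snd c p) vs = \<omega> c' (snd c' p) (map (tangent_map c c' p) vs)"
  unfolding form_def by blast

lemma formI:
  assumes "\<And>c x. c \<notin> A \<or> x \<notin> im c \<Longrightarrow> \<omega> c x = 0"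
    "\<And>c. c \<in> A \<Longrightarrow> smooth_ext_on k (im c) (\<omega> c)"
    "\<And>c c' p vs. c \<in> A \<Longrightarrow> c' \<in> A \<Longrightarrow> p \<in> fst c \<Longrightarrow> p \<in> fst c' \<Longrightarrow>
      \<omega> c (snd c p) vs = \<omega> c' (snd c' p) (map (tangent_map c c' p) vs)"
  shows "form A k \<omega>"
  unfolding form_def
proof (intro conjI allI impI ballI)
  fix c and x :: 'e and vs assume "c \<notin> A \<or> x \<notin> im c"
  from assms(1)[OF this] show "\<omega> c x vs = 0" by simp
next
  fix c c' p vs assume "c \<in> A" "c' \<in> A" "p \<in> fst c \<inter> fst c'"
  with assms(3) show "\<omega> c (snd c p) vs = \<omega> c' (snd c' p) (map (tangent_map c c' p) vs)" by blast
qed (rule assms(2))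

lemma form_eqI:
  assumes "form A k \<omega>" "form A l \<eta>" "\<And>c x. c \<in> A \<Longrightarrow> x \<in> im c \<Longrightarrow> \<omega> c x = \<eta> c x"
  shows "\<omega> = \<eta>"
proof (intro ext)
  fix c x vs show "\<omega> c x vs = \<eta> c x vs"
    using assms form_zero[OF assms(1), of c x] form_zero[OF assms(2), of c x]
    by (cases "c \<in> A \<and> x \<in> im c") auto
qed

lemma form_scale_at: "form_scale r \<omega> c x = ext_scale r (\<omega> c x)"
  by (auto simp: form_scale_def fun_eq_iff)

lemma form_scale_minus_one: "form_scale (-1) \<omega> = - \<omega>"
  by (auto simp: form_scale_def fun_eq_iff)

lemma form_scale_0: "form_scale r 0 = 0"
  and form_scale_one: "form_scale 1 \<omega> = \<omega>"
  and form_scale_add_left: "form_scale (r + s) \<omega> = form_scale r \<omega> + form_scale s \<omega>"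
  by (auto simp: form_scale_def fun_eq_iff algebra_simps)

lemma form_scale_eq_0: "form_scale r \<omega> = (0 :: ('a, 'e) dform) \<Longrightarrow> r \<noteq> 0 \<Longrightarrow> \<omega> = 0"
  by (simp add: fun_eq_iff form_scale_def)

lemma form_pow_0: "form_pow A \<omega> 0 = form_one A"
  and form_pow_Suc: "form_pow A \<omega> (Suc n) = fwedge \<omega> (form_pow A \<omega> n)"
  by (auto simp: form_pow_def)

lemma fwedge_assoc:
  "form A k \<omega> \<Longrightarrow> form A l \<eta> \<Longrightarrow> form A m \<zeta> \<Longrightarrow> fwedge (fwedge \<omega> \<eta>) \<zeta> = fwedge \<omega> (fwedge \<eta> \<zeta>)"
  by (intro ext) (simp add: fwedge_def wedge_assoc[OF form_alt form_alt form_alt])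

lemma fwedge_commute:
  "form A k \<omega> \<Longrightarrow> form A l \<eta> \<Longrightarrow> fwedge \<omega> \<eta> = form_scale ((-1) ^ (k * l)) (fwedge \<eta> \<omega>)"
proof (intro ext)
  fix c x vs assume w: "form A k \<omega>" and e: "form A l \<eta>"
  show "fwedge \<omega> \<eta> c x vs = form_scale ((-1) ^ (k * l)) (fwedge \<eta> \<omega>) c x vs"
    unfolding fwedge_def form_scale_def wedge_commute[OF form_alt[OF w] form_alt[OF e]] by simp
qed

lemma fwedge_commute_even:
  assumes "form A k \<omega>" "form A l \<eta>" "even k"
  shows "fwedge \<eta> \<omega> = fwedge \<omega> \<eta>"
  using fwedge_commute[OF assms(2,1)] assms(3) by (simp add: form_scale_one)

lemma fwedge_self_odd:
  assumes "form A k \<omega>" "odd k" shows "fwedge \<omega> \<omega> = 0"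
proof -
  have "fwedge \<omega> \<omega> = - fwedge \<omega> \<omega>"
    using fwedge_commute[OF assms(1,1)] assms(2) by (simp add: form_scale_minus_one)
  then have "fwedge \<omega> \<omega> c x vs = - fwedge \<omega> \<omega> c x vs" for c x vs by (metis uminus_apply)
  then show ?thesis by (simp add: fun_eq_iff)
qed

lemma fwedge_add_right: "fwedge \<zeta> (\<omega> + \<eta>) = fwedge \<zeta> \<omega> + fwedge \<zeta> \<eta>"
  and fwedge_diff_left: "fwedge (\<omega> - \<eta>) \<zeta> = fwedge \<omega> \<zeta> - fwedge \<eta> \<zeta>"
  and fwedge_diff_right: "fwedge \<zeta> (\<omega> - \<eta>) = fwedge \<zeta> \<omega> - fwedge \<zeta> \<eta>"
  by (auto simp: fwedge_def fun_eq_iff wedge_add_left wedge_add_right wedge_diff_left wedge_diff_right)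

lemma fwedge_scale_left: "fwedge (form_scale r \<omega>) \<eta> = form_scale r (fwedge \<omega> \<eta>)"
  and fwedge_scale_right: "fwedge \<omega> (form_scale r \<eta>) = form_scale r (fwedge \<omega> \<eta>)"
  by (auto simp: fwedge_def fun_eq_iff form_scale_at wedge_scale_left wedge_scale_right)

lemma fwedge_0_left [simp]: "fwedge 0 \<omega> = 0" and fwedge_0_right [simp]: "fwedge \<omega> 0 = 0"
  by (auto simp: fwedge_def fun_eq_iff)

lemma ext_d_at: "x \<in> im c \<Longrightarrow> ext_d \<omega> c x = extd (\<omega> c) x"
  by (auto simp: ext_d_def extd_def fun_eq_iff)

lemma ext_d_0: "ext_d (0 :: ('a, 'e) dform) = 0"
  by (simp add: fun_eq_iff ext_d_def frechet_derivative_const)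

lemma family_form: "smooth_form_family A k J \<omega> \<Longrightarrow> t \<in> J \<Longrightarrow> form A k (\<omega> t)"
  by (simp add: smooth_form_family_def)

lemma family_smooth: "smooth_form_family A k J \<omega> \<Longrightarrow> c \<in> A \<Longrightarrow> smooth_ext_on k (J \<times> im c) (\<lambda>(t, x). \<omega> t c x)"
  by (simp add: smooth_form_family_def)

lemma familyI:
  assumes "\<And>t. t \<in> J \<Longrightarrow> form A k (\<omega> t)"
    and "\<And>c vs. c \<in> A \<Longrightarrow> smooth_on (\<lambda>(t, x). \<omega> t c x vs) (J \<times> im c)"
  shows "smooth_form_family A k J \<omega>"
  unfolding smooth_form_family_def
proof (intro conjI ballI assms(1))
  fix c assume c: "c \<in> A"
  show "smooth_ext_on k (J \<times> im c) (\<lambda>(t, x). \<omega> t c x)"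
    unfolding smooth_ext_on_def
  proof (intro conjI ballI allI)
    fix z assume "z \<in> J \<times> im c"
    then show "alt_form k (case z of (t, x) \<Rightarrow> \<omega> t c x)"
      unfolding case_prod_unfold by (intro form_alt[OF assms(1)]) auto
  next
    fix vs show "smooth_on (\<lambda>z. (case z of (t, x) \<Rightarrow> \<omega> t c x) vs) (J \<times> im c)"
      using assms(2)[OF c, of vs] by (simp add: case_prod_unfold)
  qed
qed

lemma ideal_eq_ideal_power: "ideal A F k = ideal_power A F 1 k"
proof -
  have "(\<forall>vs. length vs = k \<and> set vs \<subseteq> V \<longrightarrow> \<omega> c x vs = 0) \<longleftrightarrow> vanishing V 1 (\<omega> c x)"
    if "form A k \<omega>" for \<omega> :: "('a, 'e) dform" and V c x
    unfolding vanishing_1_iff using alt_form_length[OF form_alt[OF that]] by blast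
  then show ?thesis unfolding ideal_def ideal_power_def by blast
qed

lemma ideal_power_form: "\<omega> \<in> ideal_power A F p k \<Longrightarrow> form A k \<omega>"
  by (simp add: ideal_power_def)

lemma form_ideal_power_0: "form A k \<omega> \<Longrightarrow> \<omega> \<in> ideal_power A F 0 k"
  by (simp add: ideal_power_def vanishing_0)

lemma ideal_power_mono: "\<omega> \<in> ideal_power A F p k \<Longrightarrow> p' \<le> p \<Longrightarrow> \<omega> \<in> ideal_power A F p' k"
  unfolding ideal_power_def using vanishing_mono by blast

end

text \<open>Negating the first vector of a tuple changes the sign of the \<open>q\<close>-form; this uses \<open>q \<ge> 1\<close>.\<close>

lemma oriented_coframe_pos_tuple:
  assumes "oriented_coframe q F c x as" "1 \<le> q"
  shows "\<exists>vs. vs \<in> pos_tuples F c x"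
proof -
  let ?w = "wedge_list as"
  have as: "length as = q" "\<And>a. a \<in> set as \<Longrightarrow> alt_form 1 a" and pos: "pos_tuples F c x = {vs. 0 < ?w vs}"
    using assms(1) by (auto simp: oriented_coframe_def)
  obtain vs where vs: "?w vs \<noteq> 0" using assms(1) by (auto simp: oriented_coframe_def)
  have w: "alt_form q ?w" using alt_form_wedge_list[of as, OF as(2)] as(1) by simp
  have "length vs = q" using alt_form_length[OF w] vs by blast
  then obtain v us where v: "vs = v # us" using assms(2) by (cases vs) auto
  have "?w ((- v) # us) = - ?w (v # us)" using linear_neg[OF alt_form_linear_Cons[OF w]] .
  then show ?thesis using vs pos v by (cases "?w vs > 0") (auto intro: exI[of _ "v # us"] exI[of _ "(- v) # us"])
qed

context
  fixes A :: "('a, 'e::euclidean_space) chart set"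
begin

lemma function_form_at: "c \<in> A \<Longrightarrow> x \<in> im c \<Longrightarrow> function_form A g c x = ext_scale (g c x) ext_one"
  by (simp add: fun_eq_iff function_form_def)

lemma defining_form_at:
  assumes "defining_form A q F \<alpha>" "c \<in> A" "x \<in> im c"
  shows "alt_form q (\<alpha> c x)" "vanishing (tangent F c x) q (\<alpha> c x)" "codim_le q (tangent F c x)" "\<exists>us. \<alpha> c x us \<noteq> 0"
proof -
  obtain N as where N: "x \<in> N" "length as = q" "\<forall>a\<in>set as. smooth_ext_on 1 N a"
    "\<forall>x\<in>N. \<alpha> c x = wedge_list (map (\<lambda>a. a x) as) \<and> tangent F c x = common_kernel (map (\<lambda>a. a x) as)"
    using assms unfolding defining_form_def by meson
  let ?as = "map (\<lambda>a. a x) as"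
  have alt: "alt_form 1 a" if "a \<in> set ?as" for a using that N by (auto simp: smooth_ext_on_def)
  have e: "\<alpha> c x = wedge_list ?as" "tangent F c x = common_kernel ?as" using N by auto
  have "form A q \<alpha>" using assms(1) by (simp add: defining_form_def)
  from form_alt[OF this] show "alt_form q (\<alpha> c x)" .
  show "vanishing (tangent F c x) q (\<alpha> c x)"
    unfolding e using vanishing_wedge_list[of ?as "common_kernel ?as"] alt N(2) by (auto simp: common_kernel_def)
  show "codim_le q (tangent F c x)"
    unfolding e using codim_le_common_kernel[of ?as, OF alt] N(2) by simp
  show "\<exists>us. \<alpha> c x us \<noteq> 0" using assms unfolding defining_form_def by blast
qed

text \<open>The criterion by which forms are recognised as elements of the ideal of the foliation.\<close>

lemma fwedge_eq_0_imp_ideal: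
  assumes \<alpha>: "defining_form A q F \<alpha>" and \<omega>: "form A k \<omega>" and z: "fwedge \<alpha> \<omega> = 0"
  shows "\<omega> \<in> ideal_power A F 1 k"
  unfolding ideal_power_def vanishing_1_iff
proof (intro CollectI conjI ballI allI impI \<omega>)
  fix c and x :: 'e and vs assume c: "c \<in> A" "x \<in> im c" and vs: "set vs \<subseteq> tangent F c x"
  obtain us where us: "\<alpha> c x us \<noteq> 0" using defining_form_at(4)[OF \<alpha> c] by blast
  have "wedge (\<alpha> c x) (\<omega> c x) = 0"
    using fun_cong[OF fun_cong[OF z, of c], of x] by (simp only: fwedge_def zero_fun_apply)
  then show "\<omega> c x vs = 0"
    by (rule wedge_eq_0_imp_vanishing[OF defining_form_at(1,2)[OF \<alpha> c] us form_alt[OF \<omega>] _ vs])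
qed

lemma defining_familyD:
  assumes "defining_family A q J F \<alpha> \<beta>"
  shows "smooth_form_family A q J \<alpha>" "smooth_form_family A 1 J \<beta>"
    "\<And>t. t \<in> J \<Longrightarrow> defining_form A q (F t) (\<alpha> t)" "\<And>t. t \<in> J \<Longrightarrow> ext_d (\<alpha> t) = fwedge (\<alpha> t) (\<beta> t)"
  using assms by (auto simp: defining_family_def)

lemma defining_family_codimension:
  "defining_family A q J F \<alpha> \<beta> \<Longrightarrow> t \<in> J \<Longrightarrow> codimension_le A (F t) q"
  using defining_form_at(3) defining_familyD(3) by (fastforce simp: codimension_le_def)

end

section \<open>Differential forms on a manifold\<close>

context
  fixes M :: "'a topology" and A :: "('a, 'e::euclidean_space) chart set"
  assumes mfd: "smooth_manifold M A"
begin

lemma open_im: "c \<in> A \<Longrightarrow> open (im c)"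
  using mfd by (auto simp: smooth_manifold_def is_chart_def)

lemma chart_inj: "c \<in> A \<Longrightarrow> inj_on (snd c) (fst c)"
  and chart_openin: "c \<in> A \<Longrightarrow> openin M (fst c)"
proof -
  assume c: "c \<in> A"
  then have h: "homeomorphic_map (subtopology M (fst c)) (top_of_set (im c)) (snd c)" and o: "openin M (fst c)"
    using mfd by (auto simp: smooth_manifold_def is_chart_def)
  show "openin M (fst c)" by (rule o)
  have "topspace (subtopology M (fst c)) = fst c" using openin_subset[OF o] by (auto simp: topspace_subtopology)
  then show "inj_on (snd c) (fst c)" using homeomorphic_imp_injective_map[OF h] by simp
qed

lemma overlap_open:
  assumes "c \<in> A" "c' \<in> A" shows "open (snd c ` (fst c \<inter> fst c'))"
proof -
  have h: "homeomorphic_map (subtopology M (fst c)) (top_of_set (im c)) (snd c)"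
    using mfd assms by (auto simp: smooth_manifold_def is_chart_def)
  have "openin (subtopology M (fst c)) (fst c \<inter> fst c')"
    unfolding openin_subtopology using chart_openin[OF assms(2)] by (intro exI[of _ "fst c'"]) auto
  then have "openin (top_of_set (im c)) (snd c ` (fst c \<inter> fst c'))"
    using homeomorphic_imp_open_map[OF h] unfolding open_map_def by blast
  then show ?thesis using open_im[OF assms(1)] openin_open_trans by blast
qed

lemma transition_apply: "c \<in> A \<Longrightarrow> p \<in> fst c \<Longrightarrow> transition c c' (snd c p) = snd c' p"
  using chart_inj by (simp add: transition_def)

lemma transition_smooth:
  "c \<in> A \<Longrightarrow> c' \<in> A \<Longrightarrow> smooth_on (transition c c') (snd c ` (fst c \<inter> fst c'))"
  using mfd by (auto simp: smooth_manifold_def compatible_def)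

lemma transition_image: "c \<in> A \<Longrightarrow> transition c c' ` (snd c ` (fst c \<inter> fst c')) \<subseteq> im c'"
  unfolding im_def using transition_apply[of c _ c'] by (auto simp del: split_paired_All split_paired_Ex)

lemma form_0: "form A k 0"
  by (rule formI) (auto simp: smooth_ext_on_def)

lemma form_add:
  assumes w: "form A k \<omega>" and e: "form A k \<eta>" shows "form A k (\<omega> + \<eta>)"
proof (rule formI)
  show "(\<omega> + \<eta>) c x = 0" if "c \<notin> A \<or> x \<notin> im c" for c x
    using form_zero[OF w that] form_zero[OF e that] by simp
  show "smooth_ext_on k (im c) ((\<omega> + \<eta>) c)" if "c \<in> A" for c
    using smooth_ext_on_add[OF open_im[OF that] form_smooth_ext[OF w that] form_smooth_ext[OF e that]]
    by (simp add: plus_fun_def)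
  fix c c' p vs assume *: "c \<in> A" "c' \<in> A" "p \<in> fst c" "p \<in> fst c'"
  show "(\<omega> + \<eta>) c (snd c p) vs = (\<omega> + \<eta>) c' (snd c' p) (map (tangent_map c c' p) vs)"
    using form_compat[OF w *] form_compat[OF e *] by simp
qed

lemma form_form_scale: "form A k \<omega> \<Longrightarrow> form A k (form_scale r \<omega>)"
proof (rule formI)
  assume w: "form A k \<omega>"
  show "form_scale r \<omega> c x = 0" if "c \<notin> A \<or> x \<notin> im c" for c x
    using form_zero[OF w that] by (simp add: form_scale_at ext_scale_def zero_fun_def)
  have e: "form_scale r \<omega> c = (\<lambda>x. ext_scale r (\<omega> c x))" for c by (rule ext) (rule form_scale_at)
  show "smooth_ext_on k (im c) (form_scale r \<omega> c)" if "c \<in> A" for c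
    unfolding e by (rule smooth_ext_on_scale[OF open_im[OF that] form_smooth_ext[OF w that]])
  fix c c' p vs assume *: "c \<in> A" "c' \<in> A" "p \<in> fst c" "p \<in> fst c'"
  show "form_scale r \<omega> c (snd c p) vs = form_scale r \<omega> c' (snd c' p) (map (tangent_map c c' p) vs)"
    using form_compat[OF w *] by (simp add: form_scale_def)
qed

lemma form_uminus: "form A k \<omega> \<Longrightarrow> form A k (- \<omega>)"
  using form_form_scale[of k \<omega> "-1"] by (simp add: form_scale_minus_one)

lemma form_diff: "form A k \<omega> \<Longrightarrow> form A k \<eta> \<Longrightarrow> form A k (\<omega> - \<eta>)"
  using form_add[OF _ form_uminus, of k \<omega> \<eta>] by simp

lemma form_fwedge:
  assumes w: "form A k \<omega>" and e: "form A l \<eta>" shows "form A (k + l) (fwedge \<omega> \<eta>)"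
proof (rule formI)
  show "fwedge \<omega> \<eta> c x = 0" if "c \<notin> A \<or> x \<notin> im c" for c x
    using form_zero[OF w that] by (simp add: fwedge_def)
  have e': "fwedge \<omega> \<eta> c = (\<lambda>x. wedge (\<omega> c x) (\<eta> c x))" for c by (rule ext) (rule fwedge_def)
  show "smooth_ext_on (k + l) (im c) (fwedge \<omega> \<eta> c)" if "c \<in> A" for c
    unfolding e' by (rule smooth_ext_on_wedge[OF open_im[OF that] form_smooth_ext[OF w that] form_smooth_ext[OF e that]])
  fix c c' p vs assume *: "c \<in> A" "c' \<in> A" "p \<in> fst c" "p \<in> fst c'"
  show "fwedge \<omega> \<eta> c (snd c p) vs = fwedge \<omega> \<eta> c' (snd c' p) (map (tangent_map c c' p) vs)"
  proof -
    have "\<omega> c (snd c p) = \<omega> c' (snd c' p) \<circ> map (tangent_map c c' p)"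
      "\<eta> c (snd c p) = \<eta> c' (snd c' p) \<circ> map (tangent_map c c' p)"
      using form_compat[OF w *] form_compat[OF e *] by (auto simp: fun_eq_iff)
    then show ?thesis by (simp add: fwedge_def wedge_map)
  qed
qed

lemma form_form_one: "form A 0 (form_one A)"
proof (rule formI)
  show "smooth_ext_on 0 (im c) (form_one A c)" if c: "c \<in> A" for c
  proof (rule smooth_ext_on_cong[OF open_im[OF c]])
    show "smooth_ext_on 0 (im c) (\<lambda>x. ext_one)" by (simp add: smooth_ext_on_def alt_form_one)
  qed (auto simp: form_one_def c fun_eq_iff)
qed (auto simp: form_one_def fun_eq_iff ext_one_def im_def)

lemma form_form_pow: "form A k \<omega> \<Longrightarrow> form A (n * k) (form_pow A \<omega> n)"
  by (induction n) (auto simp: form_pow_0 form_pow_Suc form_form_one intro: form_fwedge)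

lemma fwedge_one_right: "form A k \<omega> \<Longrightarrow> fwedge \<omega> (form_one A) = \<omega>"
  and fwedge_one_left: "form A k \<omega> \<Longrightarrow> fwedge (form_one A) \<omega> = \<omega>"
proof -
  assume w: "form A k \<omega>"
  have e: "form_one A c x = ext_one" if "c \<in> A" "x \<in> im c" for c x using that by (auto simp: form_one_def fun_eq_iff)
  show "fwedge \<omega> (form_one A) = \<omega>"
    by (rule form_eqI[OF form_fwedge[OF w form_form_one] w]) (simp add: fwedge_def e wedge_one_right[OF form_alt[OF w]])
  show "fwedge (form_one A) \<omega> = \<omega>"
    by (rule form_eqI[OF form_fwedge[OF form_form_one w] w]) (simp add: fwedge_def e wedge_one_left[OF form_alt[OF w]])
qed

text \<open>The chartwise formula is independent of the chart because exterior derivatives commute with pullback along the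
transition maps.\<close>

lemma form_ext_d:
  assumes w: "form A k \<omega>" shows "form A (Suc k) (ext_d \<omega>)"
proof (rule formI)
  fix c and x :: 'e assume cx: "c \<notin> A \<or> x \<notin> im c"
  show "ext_d \<omega> c x = 0"
  proof (cases "x \<in> im c")
    case True
    then have "\<omega> c y vs = 0" for y vs using cx form_zero[OF w] by auto
    then show ?thesis by (auto simp: ext_d_def fun_eq_iff frechet_derivative_const)
  qed (auto simp: ext_d_def)
next
  fix c assume c: "c \<in> A"
  show "smooth_ext_on (Suc k) (im c) (ext_d \<omega> c)"
    by (rule smooth_ext_on_cong[OF open_im[OF c] smooth_ext_on_extd[OF open_im[OF c] form_smooth_ext[OF w c]]])
      (simp add: ext_d_at)
next
  fix c c' p vs assume *: "c \<in> A" "c' \<in> A" "p \<in> fst c" "p \<in> fst c'"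
  let ?U = "snd c ` (fst c \<inter> fst c')"
  have p: "snd c p \<in> im c" "snd c' p \<in> im c'" "snd c p \<in> ?U" using * by (auto simp: im_def)
  have "extd (\<omega> c) (snd c p) vs =
      extd (\<omega> c') (transition c c' (snd c p)) (map (frechet_derivative (transition c c') (at (snd c p))) vs)"
  proof (rule extd_pullback[OF overlap_open[OF *(1,2)] p(3) open_im[OF *(2)] transition_smooth[OF *(1,2)]
      transition_image[OF *(1)] form_smooth_ext[OF w *(2)]])
    fix y vs assume "y \<in> ?U"
    then obtain r where r: "r \<in> fst c" "r \<in> fst c'" "y = snd c r" by auto
    show "\<omega> c y vs = \<omega> c' (transition c c' y) (map (frechet_derivative (transition c c') (at y)) vs)"
      using form_compat[OF w *(1,2) r(1,2)] transition_apply[OF *(1) r(1)] r(3) by (simp add: tangent_map_def)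
  qed
  then show "ext_d \<omega> c (snd c p) vs = ext_d \<omega> c' (snd c' p) (map (tangent_map c c' p) vs)"
    using p transition_apply[OF *(1,3)] by (simp add: ext_d_at tangent_map_def)
qed

lemma ext_d_add:
  assumes w: "form A k \<omega>" and e: "form A k \<eta>" shows "ext_d (\<omega> + \<eta>) = ext_d \<omega> + ext_d \<eta>"
proof (rule form_eqI[OF form_ext_d[OF form_add[OF w e]] form_add[OF form_ext_d[OF w] form_ext_d[OF e]]])
  fix c and x :: 'e assume c: "c \<in> A" "x \<in> im c"
  have "(\<omega> + \<eta>) c = (\<lambda>x. \<omega> c x + \<eta> c x)" by (simp add: fun_eq_iff)
  then show "ext_d (\<omega> + \<eta>) c x = (ext_d \<omega> + ext_d \<eta>) c x"
    using c extd_add[OF form_smooth_ext[OF w c(1)] form_smooth_ext[OF e c(1)] c(2)] by (simp add: ext_d_at)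
qed

lemma ext_d_scale:
  assumes w: "form A k \<omega>" shows "ext_d (form_scale r \<omega>) = form_scale r (ext_d \<omega>)"
proof (rule form_eqI[OF form_ext_d[OF form_form_scale[OF w]] form_form_scale[OF form_ext_d[OF w]]])
  fix c and x :: 'e assume c: "c \<in> A" "x \<in> im c"
  have "form_scale r \<omega> c = (\<lambda>x. ext_scale r (\<omega> c x))" by (simp add: form_scale_at fun_eq_iff)
  then show "ext_d (form_scale r \<omega>) c x = form_scale r (ext_d \<omega>) c x"
    using c extd_scale[OF form_smooth_ext[OF w c(1)] c(2)] by (simp add: ext_d_at form_scale_at)
qed

lemma ext_d_uminus: "form A k \<omega> \<Longrightarrow> ext_d (- \<omega>) = - ext_d \<omega>"
  using ext_d_scale[of k \<omega> "-1"] by (simp add: form_scale_minus_one)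

lemma ext_d_diff: "form A k \<omega> \<Longrightarrow> form A k \<eta> \<Longrightarrow> ext_d (\<omega> - \<eta>) = ext_d \<omega> - ext_d \<eta>"
  using ext_d_add[of k \<omega> "- \<eta>"] form_uminus[of k \<eta>] ext_d_uminus[of k \<eta>] by simp

lemma ext_d_fwedge:
  assumes w: "form A k \<omega>" and e: "form A l \<eta>"
  shows "ext_d (fwedge \<omega> \<eta>) = fwedge (ext_d \<omega>) \<eta> + form_scale ((-1) ^ k) (fwedge \<omega> (ext_d \<eta>))"
proof (rule form_eqI)
  show "form A (Suc (k + l)) (ext_d (fwedge \<omega> \<eta>))" by (intro form_ext_d form_fwedge w e)
  show "form A (Suc (k + l)) (fwedge (ext_d \<omega>) \<eta> + form_scale ((-1) ^ k) (fwedge \<omega> (ext_d \<eta>)))"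
    using form_fwedge[OF form_ext_d[OF w] e] form_fwedge[OF w form_ext_d[OF e]]
    by (intro form_add form_form_scale) auto
  fix c and x :: 'e assume c: "c \<in> A" "x \<in> im c"
  have "fwedge \<omega> \<eta> c = (\<lambda>y. wedge (\<omega> c y) (\<eta> c y))" by (simp add: fwedge_def fun_eq_iff)
  then show "ext_d (fwedge \<omega> \<eta>) c x = (fwedge (ext_d \<omega>) \<eta> + form_scale ((-1) ^ k) (fwedge \<omega> (ext_d \<eta>))) c x"
    using extd_wedge[OF open_im[OF c(1)] c(2) form_smooth_ext[OF w c(1)] form_smooth_ext[OF e c(1)]] c
    by (simp add: ext_d_at form_scale_at fwedge_def)
qed

lemma ext_d_ext_d:
  assumes w: "form A k \<omega>" shows "ext_d (ext_d \<omega>) = 0"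
proof (rule form_eqI[OF form_ext_d[OF form_ext_d[OF w]] form_0])
  fix c and x :: 'e assume c: "c \<in> A" "x \<in> im c"
  have "extd (ext_d \<omega> c) x = extd (extd (\<omega> c)) x"
    by (rule extd_cong[OF open_im[OF c(1)] c(2) _ smooth_ext_on_extd[OF open_im[OF c(1)] form_smooth_ext[OF w c(1)]]])
      (simp add: ext_d_at)
  then show "ext_d (ext_d \<omega>) c x = 0 c x"
    using extd_extd[OF open_im[OF c(1)] c(2) form_smooth_ext[OF w c(1)]] c by (simp add: ext_d_at)
qed

lemma ext_d_one: "ext_d (form_one A) = 0"
proof (rule form_eqI[OF form_ext_d[OF form_form_one] form_0])
  fix c and x :: 'e assume c: "c \<in> A" "x \<in> im c"
  have "extd (form_one A c) x = extd (\<lambda>y. ext_one) x"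
    by (rule extd_cong[OF open_im[OF c(1)] c(2), of _ _ 0])
      (auto simp: form_one_def c fun_eq_iff smooth_ext_on_def alt_form_one)
  then show "ext_d (form_one A) c x = 0 c x"
    using c by (simp add: ext_d_at extd_def frechet_derivative_const fun_eq_iff)
qed

lemma ext_d_pow:
  assumes "form A k a" "ext_d a = 0" shows "ext_d (form_pow A a n) = 0"
proof (induction n)
  case 0 then show ?case by (simp add: form_pow_0 ext_d_one)
next
  case (Suc n)
  show ?case
    unfolding form_pow_Suc ext_d_fwedge[OF assms(1) form_form_pow[OF assms(1)]] assms(2) Suc
      fwedge_0_left fwedge_0_right form_scale_0 by (rule add_0)
qed

section \<open>Powers of the ideal of a foliation and its cohomology\<close>

lemma ideal_power_fwedge:
  "\<omega> \<in> ideal_power A F p k \<Longrightarrow> \<eta> \<in> ideal_power A F p' l \<Longrightarrow> fwedge \<omega> \<eta> \<in> ideal_power A F (p + p') (k + l)"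
  unfolding ideal_power_def using form_fwedge[of k \<omega> l \<eta>] by (auto simp: fwedge_def intro!: vanishing_wedge)

lemma ideal_power_pow:
  assumes "\<omega> \<in> ideal_power A F 1 k" shows "form_pow A \<omega> n \<in> ideal_power A F n (n * k)"
proof (induction n)
  case 0
  then show ?case using form_ideal_power_0[OF form_form_one] by (simp add: form_pow_0)
next
  case (Suc n)
  then show ?case using ideal_power_fwedge[OF assms Suc] by (simp add: form_pow_Suc)
qed

lemma ideal_power_0: "0 \<in> ideal_power A F p k"
  using form_0 by (simp add: ideal_power_def vanishing_def)

lemma ideal_power_add:
  "\<omega> \<in> ideal_power A F p k \<Longrightarrow> \<eta> \<in> ideal_power A F p k \<Longrightarrow> \<omega> + \<eta> \<in> ideal_power A F p k"
  using form_add by (auto simp: ideal_power_def vanishing_def)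

lemma ideal_power_scale: "\<omega> \<in> ideal_power A F p k \<Longrightarrow> form_scale r \<omega> \<in> ideal_power A F p k"
  using form_form_scale by (auto simp: ideal_power_def vanishing_def form_scale_def)

lemma ideal_power_diff:
  "\<omega> \<in> ideal_power A F p k \<Longrightarrow> \<eta> \<in> ideal_power A F p k \<Longrightarrow> \<omega> - \<eta> \<in> ideal_power A F p k"
  using form_diff by (auto simp: ideal_power_def vanishing_def)

lemma ideal_power_top:
  assumes "codimension_le A F q" "\<omega> \<in> ideal_power A F (Suc q) k" shows "\<omega> = 0"
proof (rule form_eqI[OF ideal_power_form[OF assms(2)] form_0])
  fix c and x :: 'e assume "c \<in> A" "x \<in> im c"
  then have "\<omega> c x = 0"
    using assms by (intro vanishing_top[OF form_alt[OF ideal_power_form[OF assms(2)]]])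
      (auto simp: ideal_power_def codimension_le_def)
  then show "\<omega> c x = 0 c x" by simp
qed

text \<open>Lets an identity between values of exact forms be read as exactness, with primitive in the same power of the
ideal.\<close>

lemma linear_combination_ideal_power:
  assumes "finite I" "\<And>i. i \<in> I \<Longrightarrow> \<omega> i \<in> ideal_power A F p k"
  shows "\<exists>\<eta>\<in>ideal_power A F p k. \<forall>c x vs. ext_d \<eta> c x vs = (\<Sum>i\<in>I. r i * ext_d (\<omega> i) c x vs)"
  using assms
proof (induction I rule: finite_induct)
  case empty
  show ?case
  proof (rule bexI[of _ 0])
    show "\<forall>c x vs. ext_d 0 c x vs = (\<Sum>i\<in>{}. r i * ext_d (\<omega> i) c x vs)" unfolding ext_d_0 by simp
  qed (rule ideal_power_0)
next
  case (insert i I)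
  then obtain \<eta> where e: "\<eta> \<in> ideal_power A F p k" "\<forall>c x vs. ext_d \<eta> c x vs = (\<Sum>i\<in>I. r i * ext_d (\<omega> i) c x vs)"
    by blast
  have w: "\<omega> i \<in> ideal_power A F p k" using insert.prems by simp
  note fw = ideal_power_form[OF w]
  show ?case
  proof (rule bexI[of _ "form_scale (r i) (\<omega> i) + \<eta>"])
    show "form_scale (r i) (\<omega> i) + \<eta> \<in> ideal_power A F p k"
      by (intro ideal_power_add ideal_power_scale w e)
    show "\<forall>c x vs. ext_d (form_scale (r i) (\<omega> i) + \<eta>) c x vs = (\<Sum>i\<in>insert i I. r i * ext_d (\<omega> i) c x vs)"
      using e insert.hyps
      by (simp add: ext_d_add[OF form_form_scale[OF fw] ideal_power_form[OF e(1)]] ext_d_scale[OF fw] form_scale_def)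
  qed
qed

text \<open>The form in which all equalities of classes are obtained.\<close>

lemma cohomologous_classes:
  assumes "\<omega> \<in> ideal A F (Suc k)" "ext_d \<omega> = 0" "\<theta> \<in> ideal A F k" "\<eta> \<in> ideal A F (Suc k)" "\<eta> = \<omega> + ext_d \<theta>"
  shows "coh_class A F (Suc k) \<eta> = coh_class A F (Suc k) \<omega>"
proof -
  have I: "ideal A F j = ideal_power A F 1 j" for j by (rule ideal_eq_ideal_power)
  have f\<theta>: "form A k \<theta>" using assms(3) unfolding I by (rule ideal_power_form)
  have f\<omega>: "form A (Suc k) \<omega>" using assms(1) unfolding I by (rule ideal_power_form)
  have "ext_d \<eta> = 0"
    unfolding assms(5) using assms(2)
    by (simp add: ext_d_add[OF f\<omega> form_ext_d[OF f\<theta>]] ext_d_ext_d[OF f\<theta>])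
  then have e: "\<eta> \<in> cocycles A F (Suc k)" and w: "\<omega> \<in> cocycles A F (Suc k)"
    using assms by (simp_all add: cocycles_def)
  have "\<zeta> - \<eta> \<in> coboundaries A F (Suc k) \<longleftrightarrow> \<zeta> - \<omega> \<in> coboundaries A F (Suc k)" for \<zeta>
  proof
    assume "\<zeta> - \<eta> \<in> coboundaries A F (Suc k)"
    then obtain \<xi> where x: "\<xi> \<in> ideal A F k" "\<zeta> - \<eta> = ext_d \<xi>" by (auto simp: coboundaries_def)
    then have fx: "form A k \<xi>" unfolding I using ideal_power_form by blast
    have "\<zeta> - \<omega> = ext_d (\<xi> + \<theta>)"
      unfolding ext_d_add[OF fx f\<theta>] x(2)[symmetric] assms(5) by simp
    moreover have "\<xi> + \<theta> \<in> ideal A F k" using x(1) assms(3) unfolding I by (rule ideal_power_add)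
    ultimately show "\<zeta> - \<omega> \<in> coboundaries A F (Suc k)" by (simp add: coboundaries_def)
  next
    assume "\<zeta> - \<omega> \<in> coboundaries A F (Suc k)"
    then obtain \<xi> where x: "\<xi> \<in> ideal A F k" "\<zeta> - \<omega> = ext_d \<xi>" by (auto simp: coboundaries_def)
    then have fx: "form A k \<xi>" unfolding I using ideal_power_form by blast
    have "\<zeta> - \<eta> = ext_d (\<xi> - \<theta>)"
      unfolding ext_d_diff[OF fx f\<theta>] x(2)[symmetric] assms(5) by simp
    moreover have "\<xi> - \<theta> \<in> ideal A F k" using x(1) assms(3) unfolding I by (rule ideal_power_diff)
    ultimately show "\<zeta> - \<eta> \<in> coboundaries A F (Suc k)" by (simp add: coboundaries_def)
  qed
  then show ?thesis using e w by (auto simp: coh_class_def cohomologous_def)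
qed

lemma self_in_coh_class:
  assumes "\<omega> \<in> ideal A F (Suc k)" "ext_d \<omega> = 0"
  shows "\<omega> \<in> coh_class A F (Suc k) \<omega>"
proof -
  have "0 \<in> ext_d ` ideal A F k"
    using ideal_power_0[of F 1 k] ext_d_0 ideal_eq_ideal_power by (metis image_eqI)
  then show ?thesis using assms by (auto simp: coh_class_def cohomologous_def cocycles_def coboundaries_def)
qed

lemma coh_class_in_coh:
  assumes "\<omega> \<in> ideal A F k" "ext_d \<omega> = 0" shows "coh_class A F k \<omega> \<in> coh A F k"
  using assms by (auto simp: coh_class_def coh_def cocycles_def intro: quotientI)

section \<open>Smooth families of forms\<close>

context
  fixes J :: "real set"
  assumes openJ: "open J"
begin

lemma open_J_im: "c \<in> A \<Longrightarrow> open (J \<times> im c)"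
  using openJ open_im by (intro open_Times)

lemma form_dt_at:
  assumes "smooth_form_family A k J \<omega>" "c \<in> A" "t \<in> J" "x \<in> im c"
  shows "form_dt \<omega> t c x = dir_deriv (1, 0) (\<lambda>(t, x). \<omega> t c x) (t, x)"
  using deriv_slice[OF family_smooth[OF assms(1,2)] assms(3,4)] by (simp add: fun_eq_iff form_dt_def)

text \<open>The time derivative only sees times in the open set \<open>J\<close>. In particular, identities that hold for all
\<open>s \<in> J\<close> can be differentiated.\<close>

lemma form_dt_cong:
  assumes "t \<in> J" "\<And>s. s \<in> J \<Longrightarrow> \<omega> s = \<eta> s"
  shows "form_dt \<omega> t = form_dt \<eta> t"
proof (intro ext)
  fix c x vs
  have "\<forall>\<^sub>F s in nhds t. \<omega> s c x vs = \<eta> s c x vs"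
    using eventually_nhds_in_open[OF openJ assms(1)] by eventually_elim (simp add: assms(2))
  then show "form_dt \<omega> t c x vs = form_dt \<eta> t c x vs"
    unfolding form_dt_def by (rule deriv_cong_ev) simp
qed

lemma form_dt_zero: "form_dt (\<lambda>s. 0) t = 0"
  by (simp add: fun_eq_iff form_dt_def)

lemma family_form_dt:
  assumes w: "smooth_form_family A k J \<omega>"
  shows "smooth_form_family A k J (form_dt \<omega>)"
proof (rule familyI)
  fix t assume t: "t \<in> J"
  show "form A k (form_dt \<omega> t)"
  proof (rule formI)
    fix c and x :: 'e assume cx: "c \<notin> A \<or> x \<notin> im c"
    have "\<forall>\<^sub>F s in nhds t. \<omega> s c x vs = 0" for vs
      using eventually_nhds_in_open[OF openJ t]
      by eventually_elim (use form_zero[OF family_form[OF w] cx] in simp)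
    then have "deriv (\<lambda>s. \<omega> s c x vs) t = deriv (\<lambda>s. 0) t" for vs
      by (rule deriv_cong_ev) simp
    then show "form_dt \<omega> t c x = 0" by (simp add: form_dt_def fun_eq_iff)
  next
    fix c assume c: "c \<in> A"
    have "smooth_ext_on k (im c) (\<lambda>x. dir_deriv (1, 0) (\<lambda>(t, x). \<omega> t c x) (t, x))"
      by (rule smooth_ext_on_slice[OF openJ open_im[OF c] smooth_ext_on_dir_deriv[OF open_J_im[OF c] family_smooth[OF w c]] t])
    then show "smooth_ext_on k (im c) (form_dt \<omega> t c)"
      by (rule smooth_ext_on_cong[OF open_im[OF c]]) (simp add: form_dt_at[OF w c t])
  next
    fix c c' p vs assume *: "c \<in> A" "c' \<in> A" "p \<in> fst c" "p \<in> fst c'"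
    have "\<forall>\<^sub>F s in nhds t. \<omega> s c (snd c p) vs = \<omega> s c' (snd c' p) (map (tangent_map c c' p) vs)"
      using eventually_nhds_in_open[OF openJ t]
      by eventually_elim (rule form_compat[OF family_form[OF w] *])
    then show "form_dt \<omega> t c (snd c p) vs = form_dt \<omega> t c' (snd c' p) (map (tangent_map c c' p) vs)"
      unfolding form_dt_def by (rule deriv_cong_ev) simp
  qed
next
  fix c vs assume c: "c \<in> A"
  have "smooth_on (\<lambda>z. dir_deriv (1, 0) (\<lambda>(t, x). \<omega> t c x) z vs) (J \<times> im c)"
    by (rule smooth_ext_on_smooth[OF smooth_ext_on_dir_deriv[OF open_J_im[OF c] family_smooth[OF w c]]])
  then show "smooth_on (\<lambda>(t, x). form_dt \<omega> t c x vs) (J \<times> im c)"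
    by (rule smooth_on_cong[OF open_J_im[OF c], rotated]) (auto simp: form_dt_at[OF w c])
qed

lemma family_fwedge:
  assumes w: "smooth_form_family A k J \<omega>" and e: "smooth_form_family A l J \<eta>"
  shows "smooth_form_family A (k + l) J (\<lambda>t. fwedge (\<omega> t) (\<eta> t))"
proof (rule familyI)
  fix c vs assume c: "c \<in> A"
  have "smooth_on (\<lambda>z. wedge ((\<lambda>(t, x). \<omega> t c x) z) ((\<lambda>(t, x). \<eta> t c x) z) vs) (J \<times> im c)"
    by (rule smooth_ext_on_smooth[OF smooth_ext_on_wedge[OF open_J_im[OF c] family_smooth[OF w c] family_smooth[OF e c]]])
  then show "smooth_on (\<lambda>(t, x). fwedge (\<omega> t) (\<eta> t) c x vs) (J \<times> im c)"
    by (simp add: fwedge_def case_prod_unfold)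
qed (intro form_fwedge family_form[OF w] family_form[OF e])

lemma family_add:
  assumes w: "smooth_form_family A k J \<omega>" and e: "smooth_form_family A k J \<eta>"
  shows "smooth_form_family A k J (\<lambda>t. \<omega> t + \<eta> t)"
proof (rule familyI)
  fix c vs assume c: "c \<in> A"
  have "smooth_on (\<lambda>z. (\<lambda>(t, x). \<omega> t c x) z vs + (\<lambda>(t, x). \<eta> t c x) z vs) (J \<times> im c)"
    by (intro smooth_on_add open_J_im[OF c] smooth_ext_on_smooth[OF family_smooth[OF w c]] smooth_ext_on_smooth[OF family_smooth[OF e c]])
  then show "smooth_on (\<lambda>(t, x). (\<omega> t + \<eta> t) c x vs) (J \<times> im c)"
    by (simp add: case_prod_unfold)
qed (intro form_add family_form[OF w] family_form[OF e])

lemma family_scale: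
  assumes w: "smooth_form_family A k J \<omega>"
  shows "smooth_form_family A k J (\<lambda>t. form_scale r (\<omega> t))"
proof (rule familyI)
  fix c vs assume c: "c \<in> A"
  have "smooth_on (\<lambda>z. r * (\<lambda>(t, x). \<omega> t c x) z vs) (J \<times> im c)"
    by (intro smooth_on_mult smooth_on_const open_J_im[OF c] smooth_ext_on_smooth[OF family_smooth[OF w c]])
  then show "smooth_on (\<lambda>(t, x). form_scale r (\<omega> t) c x vs) (J \<times> im c)"
    by (simp add: case_prod_unfold form_scale_def)
qed (intro form_form_scale family_form[OF w])

lemma family_diff:
  assumes w: "smooth_form_family A k J \<omega>" and e: "smooth_form_family A k J \<eta>"
  shows "smooth_form_family A k J (\<lambda>t. \<omega> t - \<eta> t)"
  using family_add[OF w family_scale[OF e, of "-1"]] by (simp add: form_scale_minus_one)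

lemma family_ext_d:
  assumes w: "smooth_form_family A k J \<omega>"
  shows "smooth_form_family A (Suc k) J (\<lambda>t. ext_d (\<omega> t))"
proof (rule familyI)
  fix c vs assume c: "c \<in> A"
  let ?W = "\<lambda>(t, x). \<omega> t c x"
  have "smooth_on (\<lambda>z. \<Sum>i<length vs. (-1) ^ i * dir_deriv (0, vs ! i) ?W z (take i vs @ drop (Suc i) vs)) (J \<times> im c)"
    by (intro smooth_on_sum smooth_on_mult smooth_on_const open_J_im[OF c]
      smooth_ext_on_smooth[OF smooth_ext_on_dir_deriv[OF open_J_im[OF c] family_smooth[OF w c]]])
  then show "smooth_on (\<lambda>(t, x). ext_d (\<omega> t) c x vs) (J \<times> im c)"
    by (rule smooth_on_cong[OF open_J_im[OF c], rotated])
      (auto simp: ext_d_at extd_eq_dir_deriv dir_deriv_slice[OF family_smooth[OF w c], symmetric])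
qed (intro form_ext_d family_form[OF w])

lemma family_one: "smooth_form_family A 0 J (\<lambda>t. form_one A)"
proof (rule familyI)
  fix c vs assume c: "c \<in> A"
  show "smooth_on (\<lambda>(t::real, x). form_one A c x vs) (J \<times> im c)"
    by (rule smooth_on_cong[OF open_J_im[OF c] _ smooth_on_const[of "ext_one vs"]]) (auto simp: form_one_def c)
qed (rule form_form_one)

lemma family_pow:
  assumes w: "smooth_form_family A k J \<omega>"
  shows "smooth_form_family A (n * k) J (\<lambda>t. form_pow A (\<omega> t) n)"
proof (induction n)
  case 0 then show ?case using family_one by (simp add: form_pow_0)
next
  case (Suc n)
  then show ?case using family_fwedge[OF w Suc] by (simp add: form_pow_Suc)
qed

lemma form_dt_fwedge:
  assumes w: "smooth_form_family A k J \<omega>" and e: "smooth_form_family A l J \<eta>" and t: "t \<in> J"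
  shows "form_dt (\<lambda>s. fwedge (\<omega> s) (\<eta> s)) t = fwedge (form_dt \<omega> t) (\<eta> t) + fwedge (\<omega> t) (form_dt \<eta> t)"
proof (rule form_eqI)
  show "form A (k + l) (form_dt (\<lambda>s. fwedge (\<omega> s) (\<eta> s)) t)"
    by (rule family_form[OF family_form_dt[OF family_fwedge[OF w e]] t])
  show "form A (k + l) (fwedge (form_dt \<omega> t) (\<eta> t) + fwedge (\<omega> t) (form_dt \<eta> t))"
    by (intro form_add form_fwedge family_form[OF _ t] family_form_dt w e)
  fix c and x :: 'e assume c: "c \<in> A" "x \<in> im c"
  have eq: "(\<lambda>(t, x). fwedge (\<omega> t) (\<eta> t) c x) = (\<lambda>z. wedge ((\<lambda>(t, x). \<omega> t c x) z) ((\<lambda>(t, x). \<eta> t c x) z))"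
    by (simp add: fun_eq_iff fwedge_def)
  have z: "(t, x) \<in> J \<times> im c" using t c by simp
  have "form_dt (\<lambda>s. fwedge (\<omega> s) (\<eta> s)) t c x = dir_deriv (1, 0) (\<lambda>(t, x). fwedge (\<omega> t) (\<eta> t) c x) (t, x)"
    by (rule form_dt_at[OF family_fwedge[OF w e] c(1) t c(2)])
  also have "\<dots> = wedge (form_dt \<omega> t c x) (\<eta> t c x) + wedge (\<omega> t c x) (form_dt \<eta> t c x)"
    unfolding eq dir_deriv_wedge[OF family_smooth[OF w c(1)] family_smooth[OF e c(1)] z]
      form_dt_at[OF w c(1) t c(2)] form_dt_at[OF e c(1) t c(2)] by simp
  finally show "form_dt (\<lambda>s. fwedge (\<omega> s) (\<eta> s)) t c x =
      (fwedge (form_dt \<omega> t) (\<eta> t) + fwedge (\<omega> t) (form_dt \<eta> t)) c x"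
    by (simp add: fwedge_def)
qed

lemma form_dt_add:
  assumes w: "smooth_form_family A k J \<omega>" and e: "smooth_form_family A k J \<eta>" and t: "t \<in> J"
  shows "form_dt (\<lambda>s. \<omega> s + \<eta> s) t = form_dt \<omega> t + form_dt \<eta> t"
proof (rule form_eqI)
  show "form A k (form_dt (\<lambda>s. \<omega> s + \<eta> s) t)"
    by (rule family_form[OF family_form_dt[OF family_add[OF w e]] t])
  show "form A k (form_dt \<omega> t + form_dt \<eta> t)"
    by (intro form_add family_form[OF _ t] family_form_dt w e)
  fix c and x :: 'e assume c: "c \<in> A" "x \<in> im c"
  have eq: "(\<lambda>(t, x). (\<omega> t + \<eta> t) c x) = (\<lambda>z. (\<lambda>(t, x). \<omega> t c x) z + (\<lambda>(t, x). \<eta> t c x) z)"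
    by (simp add: fun_eq_iff)
  have z: "(t, x) \<in> J \<times> im c" using t c by simp
  have "form_dt (\<lambda>s. \<omega> s + \<eta> s) t c x = dir_deriv (1, 0) (\<lambda>(t, x). (\<omega> t + \<eta> t) c x) (t, x)"
    by (rule form_dt_at[OF family_add[OF w e] c(1) t c(2)])
  also have "\<dots> = form_dt \<omega> t c x + form_dt \<eta> t c x"
    unfolding eq dir_deriv_add[OF family_smooth[OF w c(1)] family_smooth[OF e c(1)] z]
      form_dt_at[OF w c(1) t c(2)] form_dt_at[OF e c(1) t c(2)] by simp
  finally show "form_dt (\<lambda>s. \<omega> s + \<eta> s) t c x = (form_dt \<omega> t + form_dt \<eta> t) c x" by simp
qed

lemma form_dt_scale:
  assumes w: "smooth_form_family A k J \<omega>" and t: "t \<in> J"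
  shows "form_dt (\<lambda>s. form_scale r (\<omega> s)) t = form_scale r (form_dt \<omega> t)"
proof (rule form_eqI)
  show "form A k (form_dt (\<lambda>s. form_scale r (\<omega> s)) t)"
    by (rule family_form[OF family_form_dt[OF family_scale[OF w]] t])
  show "form A k (form_scale r (form_dt \<omega> t))"
    by (intro form_form_scale family_form[OF _ t] family_form_dt w)
  fix c and x :: 'e assume c: "c \<in> A" "x \<in> im c"
  have eq: "(\<lambda>(t, x). form_scale r (\<omega> t) c x) = (\<lambda>z. ext_scale r ((\<lambda>(t, x). \<omega> t c x) z))"
    by (simp add: fun_eq_iff form_scale_def)
  have z: "(t, x) \<in> J \<times> im c" using t c by simp
  have "form_dt (\<lambda>s. form_scale r (\<omega> s)) t c x = dir_deriv (1, 0) (\<lambda>(t, x). form_scale r (\<omega> t) c x) (t, x)"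
    by (rule form_dt_at[OF family_scale[OF w] c(1) t c(2)])
  also have "\<dots> = ext_scale r (form_dt \<omega> t c x)"
    unfolding eq dir_deriv_scale[OF family_smooth[OF w c(1)] z] form_dt_at[OF w c(1) t c(2)] by simp
  finally show "form_dt (\<lambda>s. form_scale r (\<omega> s)) t c x = form_scale r (form_dt \<omega> t) c x"
    by (simp add: form_scale_at)
qed

lemma form_dt_diff:
  assumes w: "smooth_form_family A k J \<omega>" and e: "smooth_form_family A k J \<eta>" and t: "t \<in> J"
  shows "form_dt (\<lambda>s. \<omega> s - \<eta> s) t = form_dt \<omega> t - form_dt \<eta> t"
  using form_dt_add[OF w family_scale[OF e, of "-1"] t] form_dt_scale[OF e t, of "-1"]
  by (simp add: form_scale_minus_one)

text \<open>Equality of mixed partial derivatives in time and space.\<close>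

lemma form_dt_ext_d:
  assumes w: "smooth_form_family A k J \<omega>" and t: "t \<in> J"
  shows "form_dt (\<lambda>s. ext_d (\<omega> s)) t = ext_d (form_dt \<omega> t)"
proof (rule form_eqI)
  show "form A (Suc k) (form_dt (\<lambda>s. ext_d (\<omega> s)) t)"
    by (rule family_form[OF family_form_dt[OF family_ext_d[OF w]] t])
  show "form A (Suc k) (ext_d (form_dt \<omega> t))"
    by (intro form_ext_d family_form[OF _ t] family_form_dt w)
  fix c and x :: 'e assume c: "c \<in> A" "x \<in> im c"
  let ?W = "\<lambda>(t, x). \<omega> t c x"
  note sW = family_smooth[OF w c(1)]
  note sD = smooth_ext_on_dir_deriv[OF open_J_im[OF c(1)] sW]
  have z: "(t, x) \<in> J \<times> im c" using t c by simp
  show "form_dt (\<lambda>s. ext_d (\<omega> s)) t c x = ext_d (form_dt \<omega> t) c x"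
  proof
    fix vs :: "'e list"
    let ?o = "\<lambda>i. take i vs @ drop (Suc i) vs"
    have "((\<lambda>z. \<Sum>i<length vs. (-1) ^ i * dir_deriv (0, vs ! i) ?W z (?o i)) has_derivative
       (\<lambda>v. \<Sum>i<length vs. (-1) ^ i * dir_deriv v (dir_deriv (0, vs ! i) ?W) (t, x) (?o i))) (at (t, x))"
      by (intro has_derivative_sum has_derivative_mult_right smooth_ext_on_has_derivative[OF sD z])
    then have "((\<lambda>z. (\<lambda>(t, x). ext_d (\<omega> t) c x) z vs) has_derivative
       (\<lambda>v. \<Sum>i<length vs. (-1) ^ i * dir_deriv v (dir_deriv (0, vs ! i) ?W) (t, x) (?o i))) (at (t, x))"
      by (rule has_derivative_transform_within_open[OF _ open_J_im[OF c(1)] z])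
        (auto simp: ext_d_at extd_eq_dir_deriv dir_deriv_slice[OF sW, symmetric])
    then have "form_dt (\<lambda>s. ext_d (\<omega> s)) t c x vs =
        (\<Sum>i<length vs. (-1) ^ i * dir_deriv (1, 0) (dir_deriv (0, vs ! i) ?W) (t, x) (?o i))"
      unfolding form_dt_at[OF family_ext_d[OF w] c(1) t c(2)] by (rule dir_derivI)
    also have "\<dots> = (\<Sum>i<length vs. (-1) ^ i * dir_deriv (0, vs ! i) (dir_deriv (1, 0) ?W) (t, x) (?o i))"
      using second_derivative_symmetric[OF open_J_im[OF c(1)] smooth_ext_on_smooth[OF sW] z]
      by (simp add: dir_deriv_def)
    also have "\<dots> = extd (\<lambda>x. dir_deriv (1, 0) ?W (t, x)) x vs"
      unfolding extd_eq_dir_deriv dir_deriv_slice[OF sD t c(2)] ..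
    also have "\<dots> = extd (form_dt \<omega> t c) x vs"
      by (subst extd_cong[OF open_im[OF c(1)] c(2) _ smooth_ext_on_slice[OF openJ open_im[OF c(1)] sD t, of "(1, 0)"], of "form_dt \<omega> t c"])
        (simp_all add: form_dt_at[OF w c(1) t])
    also have "\<dots> = ext_d (form_dt \<omega> t) c x vs" using c by (simp add: ext_d_at)
    finally show "form_dt (\<lambda>s. ext_d (\<omega> s)) t c x vs = ext_d (form_dt \<omega> t) c x vs" .
  qed
qed

text \<open>Two-forms commute with all forms, so the usual power rule holds.\<close>

lemma form_dt_pow:
  assumes a: "smooth_form_family A 2 J a" and t: "t \<in> J"
  shows "form_dt (\<lambda>s. form_pow A (a s) n) t = form_scale (real n) (fwedge (form_dt a t) (form_pow A (a t) (n - 1)))"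
proof (induction n)
  case 0
  show ?case by (simp add: fun_eq_iff form_pow_0 form_dt_def form_scale_def)
next
  case (Suc n)
  note IH = Suc
  note fa = family_form[OF a t] and fd = family_form[OF family_form_dt[OF a] t]
  have "form_dt (\<lambda>s. form_pow A (a s) (Suc n)) t =
      fwedge (form_dt a t) (form_pow A (a t) n) + fwedge (a t) (form_dt (\<lambda>s. form_pow A (a s) n) t)"
    unfolding form_pow_Suc by (rule form_dt_fwedge[OF a family_pow[OF a] t])
  also have "fwedge (a t) (form_dt (\<lambda>s. form_pow A (a s) n) t) = form_scale (real n) (fwedge (form_dt a t) (form_pow A (a t) n))"
  proof (cases n)
    case 0
    have z: "form_scale 0 \<omega> = 0" for \<omega> :: "('a, 'e) dform" by (simp add: fun_eq_iff form_scale_def)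
    show ?thesis unfolding IH unfolding 0 of_nat_0 z fwedge_0_right by (rule refl)
  next
    case (Suc m)
    have "fwedge (a t) (fwedge (form_dt a t) (form_pow A (a t) m)) = fwedge (form_dt a t) (fwedge (a t) (form_pow A (a t) m))"
      using fwedge_commute_even[OF fa fd] form_form_pow[OF fa, of m] fa fd
      by (simp add: fwedge_assoc[symmetric])
    then show ?thesis unfolding IH unfolding Suc by (simp add: fwedge_scale_right form_pow_Suc)
  qed
  finally show ?case by (simp add: form_scale_add_left form_scale_one add.commute)
qed

section \<open>Transgression along families of leafwise closed one-forms\<close>

text \<open>The arithmetic of \<open>T_form_transgression\<close>. Substituting \<open>w1\<close> and \<open>w0\<close> and eliminating \<open>y1\<close> by \<open>E\<close>, each
summand on the right becomes a difference of consecutive values of \<open>G\<close>.\<close>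

lemma weighted_telescoping:
  fixes x0 x1 y0 y1 w0 w1 :: "nat \<Rightarrow> real"
  assumes E: "\<And>i. i \<le> q \<Longrightarrow> x1 i - x0 i + (real i * y1 (i - 1) + real (q - i) * y0 i) = 0"
    and w1: "\<And>i. i < q \<Longrightarrow> w1 i = x1 (Suc i) - x1 i - y1 i"
    and w0: "\<And>i. i < q \<Longrightarrow> w0 i = x0 (Suc i) - x0 i - y0 i"
  shows "(real q + 1) * (x1 q - x0 0) = (\<Sum>i<q. real (Suc i) * w1 i) + (\<Sum>i<q. real (q - i) * w0 i)"
proof -
  \<comment> \<open>\<open>E\<close> at the index 0 gives \<open>G 0 = (q + 1) * x0 0\<close>, and \<open>G q = (q + 1) * x1 q\<close> is clear.\<close>
  define G where "G i = (real i + 1) * x1 i + (real q - real i) * (x0 i + y0 i)" for i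
  have "real (Suc i) * w1 i + real (q - i) * w0 i = G (Suc i) - G i" if i: "i < q" for i
  proof -
    have r: "real (q - i) = real q - real i" "real (q - Suc i) = real q - real i - 1" using i by auto
    have "x1 (Suc i) - x0 (Suc i) + (real (Suc i) * y1 i + (real q - real i - 1) * y0 (Suc i)) = 0"
      using E[of "Suc i"] i r by simp
    then have e: "real (Suc i) * y1 i = x0 (Suc i) - x1 (Suc i) - (real q - real i - 1) * y0 (Suc i)" by linarith
    have "real (Suc i) * w1 i = real (Suc i) * (x1 (Suc i) - x1 i) - real (Suc i) * y1 i"
      using w1[OF i] by (simp only: right_diff_distrib)
    then show ?thesis unfolding e w0[OF i] r G_def by (simp add: algebra_simps)
  qed
  then have "(\<Sum>i<q. real (Suc i) * w1 i + real (q - i) * w0 i) = (\<Sum>i<q. G (Suc i) - G i)" by simp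
  also have "\<dots> = G q - G 0" by (rule sum_lessThan_telescope)
  also have "\<dots> = (real q + 1) * (x1 q - x0 0)"
    using E[of 0] by (simp add: G_def algebra_simps)
  finally show ?thesis by (simp add: sum.distrib)
qed

context
  fixes F :: "real \<Rightarrow> ('a, 'e) foliation"
begin

lemma leafwise_closed_smooth: "leafwise_closed_family A J F b \<Longrightarrow> smooth_form_family A 1 J b"
  and leafwise_closed_ideal: "leafwise_closed_family A J F b \<Longrightarrow> t \<in> J \<Longrightarrow> ext_d (b t) \<in> ideal_power A (F t) 1 2"
  by (auto simp: leafwise_closed_family_def)

lemma leafwise_closed_d_smooth: "leafwise_closed_family A J F b \<Longrightarrow> smooth_form_family A 2 J (\<lambda>s. ext_d (b s))"
  using family_ext_d[OF leafwise_closed_smooth] by (simp add: numeral_2_eq_2)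

lemma leafwise_closed_form: "leafwise_closed_family A J F b \<Longrightarrow> t \<in> J \<Longrightarrow> form A 1 (b t)"
  by (rule family_form[OF leafwise_closed_smooth])

lemma leafwise_closed_dt_form: "leafwise_closed_family A J F b \<Longrightarrow> t \<in> J \<Longrightarrow> form A 1 (form_dt b t)"
  by (rule family_form[OF family_form_dt[OF leafwise_closed_smooth]])

lemma leafwise_closed_d_form: "leafwise_closed_family A J F b \<Longrightarrow> t \<in> J \<Longrightarrow> form A 2 (ext_d (b t))"
  by (rule family_form[OF leafwise_closed_d_smooth])

lemma leafwise_closed_dd: "leafwise_closed_family A J F b \<Longrightarrow> t \<in> J \<Longrightarrow> ext_d (ext_d (b t)) = 0"
  by (rule ext_d_ext_d[OF leafwise_closed_form])

lemma leafwise_closed_pow_ideal: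
  "leafwise_closed_family A J F b \<Longrightarrow> t \<in> J \<Longrightarrow> form_pow A (ext_d (b t)) n \<in> ideal_power A (F t) n (2 * n)"
  using ideal_power_pow[OF leafwise_closed_ideal, of b t n] by (simp add: mult.commute)

lemma leafwise_closed_pow_form: "leafwise_closed_family A J F b \<Longrightarrow> t \<in> J \<Longrightarrow> form A (2 * n) (form_pow A (ext_d (b t)) n)"
  using ideal_power_form[OF leafwise_closed_pow_ideal] .

lemma leafwise_closed_pow_closed: "leafwise_closed_family A J F b \<Longrightarrow> t \<in> J \<Longrightarrow> ext_d (form_pow A (ext_d (b t)) n) = 0"
  by (rule ext_d_pow[OF leafwise_closed_d_form leafwise_closed_dd])

lemma leafwise_closed_pow_fam: "leafwise_closed_family A J F b \<Longrightarrow> smooth_form_family A (2 * n) J (\<lambda>s. form_pow A (ext_d (b s)) n)"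
  using family_pow[OF leafwise_closed_d_smooth, of b n] by (simp add: mult.commute)

lemma leafwise_closed_dt_d: "leafwise_closed_family A J F b \<Longrightarrow> t \<in> J \<Longrightarrow> form_dt (\<lambda>s. ext_d (b s)) t = ext_d (form_dt b t)"
  by (rule form_dt_ext_d[OF leafwise_closed_smooth])

lemma leafwise_closed_dt_d_form: "leafwise_closed_family A J F b \<Longrightarrow> t \<in> J \<Longrightarrow> form A 2 (ext_d (form_dt b t))"
  using form_ext_d[OF leafwise_closed_dt_form] by (simp add: numeral_2_eq_2)

lemma leafwise_closed_dt_pow:
  "leafwise_closed_family A J F b \<Longrightarrow> t \<in> J \<Longrightarrow> form_dt (\<lambda>s. form_pow A (ext_d (b s)) n) t =
     form_scale (real n) (fwedge (ext_d (form_dt b t)) (form_pow A (ext_d (b t)) (n - 1)))"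
  using form_dt_pow[OF leafwise_closed_d_smooth, of b t n] leafwise_closed_dt_d[of b t] by simp

context
  fixes q :: nat
  assumes codim: "\<forall>t\<in>J. codimension_le A (F t) q"
begin

lemma T_form_ideal_power:
  assumes b: "leafwise_closed_family A J F b" and t: "t \<in> J"
  shows "T_form A q b t \<in> ideal_power A (F t) q (2 * q + 1)"
  using ideal_power_fwedge[OF form_ideal_power_0[OF leafwise_closed_dt_form[OF b t]] leafwise_closed_pow_ideal[OF b t, of q]]
  by (simp add: T_form_def)

text \<open>For every \<open>s\<close> the power \<open>(d b)^(q+1)\<close> is zero; its time derivative is \<open>q + 1\<close> times the exterior derivative of
\<open>T_form A q b t\<close>.\<close>

lemma ext_d_T_form:
  assumes b: "leafwise_closed_family A J F b" and t: "t \<in> J"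
  shows "ext_d (T_form A q b t) = 0"
proof -
  have "form_pow A (ext_d (b s)) (Suc q) = 0" if "s \<in> J" for s
    by (rule ideal_power_top[OF bspec[OF codim that] leafwise_closed_pow_ideal[OF b that]])
  then have "form_dt (\<lambda>s. form_pow A (ext_d (b s)) (Suc q)) t = form_dt (\<lambda>s. 0) t"
    by (intro form_dt_cong[OF t]) auto
  then have "form_scale (real (Suc q)) (fwedge (ext_d (form_dt b t)) (form_pow A (ext_d (b t)) q)) = 0"
    unfolding leafwise_closed_dt_pow[OF b t] form_dt_zero by simp
  then have z: "fwedge (ext_d (form_dt b t)) (form_pow A (ext_d (b t)) q) = 0"
    by (rule form_scale_eq_0) simp
  show ?thesis
    unfolding T_form_def ext_d_fwedge[OF leafwise_closed_dt_form[OF b t] leafwise_closed_pow_form[OF b t]] z leafwise_closed_pow_closed[OF b t]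
      fwedge_0_right form_scale_0 by (rule add_0)
qed

text \<open>The core of the independence proof. Let \<open>a1\<close> and \<open>a0\<close> be the derivatives of \<open>b1\<close> and \<open>b0\<close>, let \<open>u1\<close> and \<open>u0\<close> be their time
derivatives, and \<open>\<gamma> = b1 - b0\<close>, so that \<open>d\<gamma> = a1 - a0\<close>. The products \<open>\<gamma> \<and> a1^i \<and> a0^(q-i)\<close> have \<open>q + 1\<close> factors in the
ideal and vanish for all times. Their time derivatives contain \<open>(u1 - u0) \<and> a1^i \<and> a0^(q-i)\<close> and terms in which \<open>d u1\<close>
or \<open>d u0\<close> replaces one of the two-forms. The latter are traded for differences of consecutive products
\<open>u \<and> a1^(i+1) \<and> a0^(q-i-1)\<close> and \<open>u \<and> a1^i \<and> a0^(q-i)\<close>, for \<open>u\<close> equal to \<open>u1\<close> or \<open>u0\<close>, by means of the exterior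
derivative of \<open>\<gamma> \<and> u \<and> a1^i \<and> a0^(q-1-i)\<close>. Adding up all \<open>i\<close> leaves \<open>q + 1\<close> times \<open>u1 \<and> a1^q - u0 \<and> a0^q\<close>.\<close>

lemma T_form_transgression:
  assumes b0: "leafwise_closed_family A J F b0" and b1: "leafwise_closed_family A J F b1"
    and g: "\<And>s. s \<in> J \<Longrightarrow> b1 s - b0 s \<in> ideal_power A (F s) 1 1" and t: "t \<in> J"
  shows "\<exists>W\<in>ideal_power A (F t) q (2 * q). T_form A q b1 t - T_form A q b0 t = ext_d W"
proof -
  define P where "P i j s = fwedge (form_pow A (ext_d (b1 s)) i) (form_pow A (ext_d (b0 s)) j)" for i j s
  define \<gamma> where "\<gamma> s = b1 s - b0 s" for s
  let ?u1 = "form_dt b1 t" and ?u0 = "form_dt b0 t"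
  let ?a1 = "ext_d (b1 t)" and ?a0 = "ext_d (b0 t)"
  have P_ideal: "P i j s \<in> ideal_power A (F s) (i + j) (2 * (i + j))" if "s \<in> J" for i j s
    using ideal_power_fwedge[OF leafwise_closed_pow_ideal[OF b1 that, of i] leafwise_closed_pow_ideal[OF b0 that, of j]] by (simp add: P_def)
  have P_form: "form A (2 * (i + j)) (P i j t)" for i j
    using P_ideal[OF t] ideal_power_form by blast
  have P_fam: "smooth_form_family A (2 * (i + j)) J (P i j)" for i j
    using family_fwedge[OF leafwise_closed_pow_fam[OF b1, of i] leafwise_closed_pow_fam[OF b0, of j]]
    by (simp add: P_def[abs_def])
  have P_closed: "ext_d (P i j t) = 0" for i j
    unfolding P_def ext_d_fwedge[OF leafwise_closed_pow_form[OF b1 t] leafwise_closed_pow_form[OF b0 t]] leafwise_closed_pow_closed[OF b1 t] leafwise_closed_pow_closed[OF b0 t]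
      fwedge_0_left fwedge_0_right form_scale_0 by (rule add_0)
  have swap: "fwedge (form_pow A ?a1 i) (fwedge e \<omega>) = fwedge e (fwedge (form_pow A ?a1 i) \<omega>)"
    if e: "form A 2 e" and w: "form A k \<omega>" for i e k and \<omega> :: "('a, 'e) dform"
  proof -
    have "fwedge (form_pow A ?a1 i) e = fwedge e (form_pow A ?a1 i)"
      by (rule fwedge_commute_even[OF e leafwise_closed_pow_form[OF b1 t]]) simp
    then show ?thesis
      using fwedge_assoc[OF leafwise_closed_pow_form[OF b1 t, of i] e w] fwedge_assoc[OF e leafwise_closed_pow_form[OF b1 t, of i] w] by simp
  qed
  have a1P: "fwedge ?a1 (P i j t) = P (Suc i) j t" for i j
    unfolding P_def form_pow_Suc
    by (rule fwedge_assoc[OF leafwise_closed_d_form[OF b1 t] leafwise_closed_pow_form[OF b1 t] leafwise_closed_pow_form[OF b0 t], symmetric])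
  have a0P: "fwedge ?a0 (P i j t) = P i (Suc j) t" for i j
    unfolding P_def form_pow_Suc swap[OF leafwise_closed_d_form[OF b0 t] leafwise_closed_pow_form[OF b0 t]] ..
  have dtP: "form_dt (P i j) t = form_scale (real i) (fwedge (ext_d ?u1) (P (i - 1) j t)) +
      form_scale (real j) (fwedge (ext_d ?u0) (P i (j - 1) t))" for i j
  proof -
    have "form_dt (P i j) t = form_dt (\<lambda>s. fwedge (form_pow A (ext_d (b1 s)) i) (form_pow A (ext_d (b0 s)) j)) t"
      by (simp add: P_def[abs_def])
    also have "\<dots> = fwedge (form_dt (\<lambda>s. form_pow A (ext_d (b1 s)) i) t) (form_pow A ?a0 j) +
        fwedge (form_pow A ?a1 i) (form_dt (\<lambda>s. form_pow A (ext_d (b0 s)) j) t)"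
      by (rule form_dt_fwedge[OF leafwise_closed_pow_fam[OF b1] leafwise_closed_pow_fam[OF b0] t])
    also have "fwedge (form_dt (\<lambda>s. form_pow A (ext_d (b1 s)) i) t) (form_pow A ?a0 j) =
        form_scale (real i) (fwedge (ext_d ?u1) (P (i - 1) j t))"
      unfolding leafwise_closed_dt_pow[OF b1 t] fwedge_scale_left P_def
        fwedge_assoc[OF leafwise_closed_dt_d_form[OF b1 t] leafwise_closed_pow_form[OF b1 t] leafwise_closed_pow_form[OF b0 t]] ..
    also have "fwedge (form_pow A ?a1 i) (form_dt (\<lambda>s. form_pow A (ext_d (b0 s)) j) t) =
        form_scale (real j) (fwedge (ext_d ?u0) (P i (j - 1) t))"
      unfolding leafwise_closed_dt_pow[OF b0 t] fwedge_scale_right P_def swap[OF leafwise_closed_dt_d_form[OF b0 t] leafwise_closed_pow_form[OF b0 t]] ..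
    finally show ?thesis .
  qed
  have \<gamma>_fam: "smooth_form_family A 1 J \<gamma>"
    using family_diff[OF leafwise_closed_smooth[OF b1] leafwise_closed_smooth[OF b0]] by (simp add: \<gamma>_def[abs_def])
  have \<gamma>_ideal: "\<gamma> s \<in> ideal_power A (F s) 1 1" if "s \<in> J" for s using g[OF that] by (simp add: \<gamma>_def)
  note \<gamma>_form = family_form[OF \<gamma>_fam t]
  have dt\<gamma>: "form_dt \<gamma> t = ?u1 - ?u0"
    using form_dt_diff[OF leafwise_closed_smooth[OF b1] leafwise_closed_smooth[OF b0] t] by (simp add: \<gamma>_def[abs_def])
  have d\<gamma>: "ext_d (\<gamma> t) = ?a1 - ?a0"
    unfolding \<gamma>_def by (rule ext_d_diff[OF leafwise_closed_form[OF b1 t] leafwise_closed_form[OF b0 t]])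
  define Y where "Y e i = fwedge (\<gamma> t) (fwedge e (P i (q - 1 - i) t))" for e i
  have E: "fwedge ?u1 (P i (q - i) t) - fwedge ?u0 (P i (q - i) t) +
     (form_scale (real i) (Y (ext_d ?u1) (i - 1)) + form_scale (real (q - i)) (Y (ext_d ?u0) i)) = 0" if i: "i \<le> q" for i
  proof -
    have "fwedge (\<gamma> s) (P i (q - i) s) = 0" if s: "s \<in> J" for s
      by (rule ideal_power_top[OF bspec[OF codim s]])
        (use ideal_power_fwedge[OF \<gamma>_ideal[OF s] P_ideal[OF s, of i "q - i"]] i in simp)
    then have "form_dt (\<lambda>s. fwedge (\<gamma> s) (P i (q - i) s)) t = form_dt (\<lambda>s. 0) t"
      by (intro form_dt_cong[OF t]) auto
    then have *: "fwedge (form_dt \<gamma> t) (P i (q - i) t) + fwedge (\<gamma> t) (form_dt (P i (q - i)) t) = 0"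
      unfolding form_dt_fwedge[OF \<gamma>_fam P_fam t] form_dt_zero .
    \<comment> \<open>For \<open>i = 0\<close> the truncated \<open>i - 1\<close> is wrong, but there the coefficient \<open>i\<close> is zero.\<close>
    have "real i = 0 \<or> q - 1 - (i - 1) = q - i" "q - i - 1 = q - 1 - i" using i by auto
    then show ?thesis
      using * unfolding dt\<gamma> dtP fwedge_diff_left fwedge_add_right fwedge_scale_right Y_def
      by (auto simp: form_scale_def fun_eq_iff)
  qed
  define W where "W u i = fwedge (\<gamma> t) (fwedge u (P i (q - 1 - i) t))" for u i
  have W_ideal: "W u i \<in> ideal_power A (F t) q (2 * q)" if "form A 1 u" "i < q" for u i
    using ideal_power_fwedge[OF \<gamma>_ideal[OF t]
        ideal_power_fwedge[OF form_ideal_power_0[OF that(1)] P_ideal[OF t, of i "q - 1 - i"]]] that(2)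
    by (cases q) (simp_all add: W_def)
  have dW: "ext_d (W u i) = fwedge u (P (Suc i) (q - Suc i) t) - fwedge u (P i (q - i) t) - Y (ext_d u) i"
    if u: "form A 1 u" and i: "i < q" for u i
  proof -
    let ?P = "P i (q - 1 - i) t"
    have du: "form A 2 (ext_d u)" using form_ext_d[OF u] by (simp add: numeral_2_eq_2)
    have "ext_d (fwedge u ?P) = fwedge (ext_d u) ?P"
      unfolding ext_d_fwedge[OF u P_form] P_closed fwedge_0_right form_scale_0 by (rule add_0_right)
    then have "ext_d (W u i) = fwedge (?a1 - ?a0) (fwedge u ?P) - Y (ext_d u) i"
      unfolding W_def ext_d_fwedge[OF \<gamma>_form form_fwedge[OF u P_form]] d\<gamma> Y_def
      by (simp add: form_scale_minus_one)
    also have "fwedge (?a1 - ?a0) (fwedge u ?P) = fwedge u (fwedge ?a1 ?P) - fwedge u (fwedge ?a0 ?P)"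
    proof -
      have "fwedge a (fwedge u ?P) = fwedge u (fwedge a ?P)" if a: "form A 2 a" for a
        using fwedge_commute_even[OF a u] fwedge_assoc[OF a u P_form] fwedge_assoc[OF u a P_form] by simp
      then show ?thesis using leafwise_closed_d_form[OF b1 t] leafwise_closed_d_form[OF b0 t] by (simp add: fwedge_diff_left)
    qed
    also have "fwedge ?a1 ?P = P (Suc i) (q - Suc i) t" using a1P[of i "q - 1 - i"] by simp
    also have "fwedge ?a0 ?P = P i (q - i) t" using a0P[of i "q - 1 - i"] i by (simp add: Suc_diff_Suc)
    finally show ?thesis .
  qed
  note u1 = leafwise_closed_dt_form[OF b1 t] and u0 = leafwise_closed_dt_form[OF b0 t]
  have W1I: "W ?u1 i \<in> ideal_power A (F t) q (2 * q)" and W0I: "W ?u0 i \<in> ideal_power A (F t) q (2 * q)"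
    if "i \<in> {..<q}" for i
    using W_ideal[OF u1] W_ideal[OF u0] that by auto
  have "\<exists>\<eta>\<in>ideal_power A (F t) q (2 * q).
      \<forall>c x vs. ext_d \<eta> c x vs = (\<Sum>i<q. (real (Suc i) / (real q + 1)) * ext_d (W ?u1 i) c x vs)"
    by (rule linear_combination_ideal_power[OF finite_lessThan]) (rule W1I)
  then obtain W1 where W1: "W1 \<in> ideal_power A (F t) q (2 * q)"
    "\<forall>c x vs. ext_d W1 c x vs = (\<Sum>i<q. (real (Suc i) / (real q + 1)) * ext_d (W ?u1 i) c x vs)"
    by blast
  have "\<exists>\<eta>\<in>ideal_power A (F t) q (2 * q).
      \<forall>c x vs. ext_d \<eta> c x vs = (\<Sum>i<q. (real (q - i) / (real q + 1)) * ext_d (W ?u0 i) c x vs)"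
    by (rule linear_combination_ideal_power[OF finite_lessThan]) (rule W0I)
  then obtain W0 where W0: "W0 \<in> ideal_power A (F t) q (2 * q)"
    "\<forall>c x vs. ext_d W0 c x vs = (\<Sum>i<q. (real (q - i) / (real q + 1)) * ext_d (W ?u0 i) c x vs)"
    by blast
  have T1: "T_form A q b1 t = fwedge ?u1 (P q (q - q) t)"
    unfolding T_form_def P_def by (simp add: form_pow_0 fwedge_one_right[OF leafwise_closed_pow_form[OF b1 t]])
  have T0: "T_form A q b0 t = fwedge ?u0 (P 0 (q - 0) t)"
    unfolding T_form_def P_def by (simp add: form_pow_0 fwedge_one_left[OF leafwise_closed_pow_form[OF b0 t]])
  have "T_form A q b1 t - T_form A q b0 t = ext_d (W1 + W0)"
  proof (intro ext)
    fix c x vs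
    have ne: "real q + 1 \<noteq> 0" using of_nat_0_le_iff[of q, where 'a=real] by linarith
    have "(real q + 1) * (T_form A q b1 t c x vs - T_form A q b0 t c x vs) =
       (\<Sum>i<q. real (Suc i) * ext_d (W ?u1 i) c x vs) + (\<Sum>i<q. real (q - i) * ext_d (W ?u0 i) c x vs)"
      unfolding T1 T0
    proof (rule weighted_telescoping[where ?x1.0 = "\<lambda>i. fwedge ?u1 (P i (q - i) t) c x vs" and ?x0.0 = "\<lambda>i. fwedge ?u0 (P i (q - i) t) c x vs"
          and ?w1.0 = "\<lambda>i. ext_d (W ?u1 i) c x vs" and ?w0.0 = "\<lambda>i. ext_d (W ?u0 i) c x vs"
          and ?y1.0 = "\<lambda>i. Y (ext_d ?u1) i c x vs" and ?y0.0 = "\<lambda>i. Y (ext_d ?u0) i c x vs"])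
      fix i assume "i \<le> q"
      from fun_cong[OF fun_cong[OF fun_cong[OF E[OF this], of c], of x], of vs]
      show "fwedge ?u1 (P i (q - i) t) c x vs - fwedge ?u0 (P i (q - i) t) c x vs +
          (real i * Y (ext_d ?u1) (i - 1) c x vs + real (q - i) * Y (ext_d ?u0) i c x vs) = 0"
        by (simp add: form_scale_def)
    next
      fix i assume i: "i < q"
      show "ext_d (W ?u1 i) c x vs = fwedge ?u1 (P (Suc i) (q - Suc i) t) c x vs - fwedge ?u1 (P i (q - i) t) c x vs - Y (ext_d ?u1) i c x vs"
        unfolding dW[OF u1 i] by simp
      show "ext_d (W ?u0 i) c x vs = fwedge ?u0 (P (Suc i) (q - Suc i) t) c x vs - fwedge ?u0 (P i (q - i) t) c x vs - Y (ext_d ?u0) i c x vs"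
        unfolding dW[OF u0 i] by simp
    qed
    also have "\<dots> = (real q + 1) * (ext_d W1 c x vs + ext_d W0 c x vs)"
      unfolding W1(2)[rule_format] W0(2)[rule_format] using ne by (simp add: distrib_left sum_distrib_left)
    finally have "T_form A q b1 t c x vs - T_form A q b0 t c x vs = ext_d W1 c x vs + ext_d W0 c x vs"
      using ne by (simp only: mult_cancel_left simp_thms)
    then show "(T_form A q b1 t - T_form A q b0 t) c x vs = ext_d (W1 + W0) c x vs"
      unfolding ext_d_add[OF ideal_power_form[OF W1(1)] ideal_power_form[OF W0(1)]] by simp
  qed
  then show ?thesis using ideal_power_add[OF W1(1) W0(1)] by blast
qed

text \<open>Removing the exact part \<open>d h\<close> from \<open>b'\<close> leaves \<open>d b'\<close> unchanged and changes \<open>T_form\<close> by an exact form; the rest of the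
difference is covered by \<open>T_form_transgression\<close>.\<close>

lemma T_form_change:
  assumes b: "leafwise_closed_family A J F b" and b': "leafwise_closed_family A J F b'"
    and h: "smooth_form_family A 0 J h"
    and g: "\<And>s. s \<in> J \<Longrightarrow> b' s - b s - ext_d (h s) \<in> ideal_power A (F s) 1 1" and t: "t \<in> J"
  shows "\<exists>W\<in>ideal_power A (F t) q (2 * q). T_form A q b' t - T_form A q b t = ext_d W"
proof -
  define b1 where "b1 s = b' s - ext_d (h s)" for s
  have dh: "smooth_form_family A 1 J (\<lambda>s. ext_d (h s))" using family_ext_d[OF h] by simp
  have db1: "ext_d (b1 s) = ext_d (b' s)" if s: "s \<in> J" for s
    unfolding b1_def ext_d_diff[OF leafwise_closed_form[OF b' s] family_form[OF dh s]]
      ext_d_ext_d[OF family_form[OF h s]] by (rule diff_zero)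
  have b1: "leafwise_closed_family A J F b1"
    unfolding leafwise_closed_family_def using family_diff[OF leafwise_closed_smooth[OF b'] dh] db1 leafwise_closed_ideal[OF b']
    by (simp add: b1_def[abs_def])
  have "b1 s - b s \<in> ideal_power A (F s) 1 1" if "s \<in> J" for s
    using g[OF that] by (simp add: b1_def algebra_simps)
  from T_form_transgression[OF b b1 this t] obtain W
    where W: "W \<in> ideal_power A (F t) q (2 * q)" "T_form A q b1 t - T_form A q b t = ext_d W" by blast
  let ?p = "form_pow A (ext_d (b' t)) q"
  have hf: "form A 0 (form_dt h t)" by (rule family_form[OF family_form_dt[OF h] t])
  have "form_dt b1 t = form_dt b' t - ext_d (form_dt h t)"
    using form_dt_diff[OF leafwise_closed_smooth[OF b'] dh t] form_dt_ext_d[OF h t] by (simp add: b1_def[abs_def])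
  then have "T_form A q b' t - T_form A q b1 t = fwedge (ext_d (form_dt h t)) ?p"
    unfolding T_form_def db1[OF t] by (simp add: fwedge_diff_left)
  also have "\<dots> = ext_d (fwedge (form_dt h t) ?p)"
    unfolding ext_d_fwedge[OF hf leafwise_closed_pow_form[OF b' t]] leafwise_closed_pow_closed[OF b' t] fwedge_0_right form_scale_0
    by (rule add_0_right[symmetric])
  finally have 2: "T_form A q b' t - T_form A q b1 t = ext_d (fwedge (form_dt h t) ?p)" .
  have V: "fwedge (form_dt h t) ?p \<in> ideal_power A (F t) q (2 * q)"
    using ideal_power_fwedge[OF form_ideal_power_0[OF hf] leafwise_closed_pow_ideal[OF b' t, of q]] by simp
  have "T_form A q b' t - T_form A q b t = ext_d (W + fwedge (form_dt h t) ?p)"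
    unfolding ext_d_add[OF ideal_power_form[OF W(1)] ideal_power_form[OF V]] W(2)[symmetric] 2[symmetric] by simp
  then show ?thesis using ideal_power_add[OF W(1) V] by blast
qed

text \<open>Both \<open>d T\<close> and the product of \<open>T\<close>, which lies in the \<open>q\<close>-th power of the ideal, with \<open>d \<rho>\<close> are zero.\<close>

lemma T_form_times_cocycle:
  assumes b: "leafwise_closed_family A J F b" and t: "t \<in> J"
    and \<rho>: "form A 1 \<rho>" "ext_d \<rho> \<in> ideal_power A (F t) 1 2"
  shows "fwedge (T_form A q b t) \<rho> \<in> ideal_power A (F t) q (2 * q + 2)"
    and "ext_d (fwedge (T_form A q b t) \<rho>) = 0"
proof -
  note T = T_form_ideal_power[OF b t]
  note Tf = ideal_power_form[OF T]
  show "fwedge (T_form A q b t) \<rho> \<in> ideal_power A (F t) q (2 * q + 2)"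
    using ideal_power_fwedge[OF T form_ideal_power_0[OF \<rho>(1)]] by simp
  have z: "fwedge (T_form A q b t) (ext_d \<rho>) = 0"
    by (rule ideal_power_top[OF bspec[OF codim t]]) (use ideal_power_fwedge[OF T \<rho>(2)] in simp)
  show "ext_d (fwedge (T_form A q b t) \<rho>) = 0"
    unfolding ext_d_fwedge[OF Tf \<rho>(1)] ext_d_T_form[OF b t] z fwedge_0_left form_scale_0 by (rule add_0)
qed

text \<open>One-forms that represent the zero class along the leaves have exact product with \<open>T\<close>: the ideal part is annihilated, and
the exact part can be integrated since \<open>T\<close> is closed.\<close>

lemma T_form_times_leafwise_exact:
  assumes b: "leafwise_closed_family A J F b" and t: "t \<in> J"
    and \<eta>: "\<eta> \<in> ideal_power A (F t) 1 1" and f: "form A 0 f"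
  shows "\<exists>W\<in>ideal_power A (F t) q (2 * q + 1). fwedge (T_form A q b t) (\<eta> + ext_d f) = ext_d W"
proof (intro bexI)
  note T = T_form_ideal_power[OF b t]
  note Tf = ideal_power_form[OF T]
  have df: "form A 1 (ext_d f)" using form_ext_d[OF f] by simp
  have fT: "form A (2 * q + 1) (fwedge f (T_form A q b t))" using form_fwedge[OF f Tf] by simp
  have z: "fwedge (T_form A q b t) \<eta> = 0"
    by (rule ideal_power_top[OF bspec[OF codim t]]) (use ideal_power_fwedge[OF T \<eta>] in simp)
  have "ext_d (fwedge f (T_form A q b t)) = fwedge (ext_d f) (T_form A q b t)"
    unfolding ext_d_fwedge[OF f Tf] ext_d_T_form[OF b t] fwedge_0_right form_scale_0 by (rule add_0_right)
  also have "\<dots> = - fwedge (T_form A q b t) (ext_d f)"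
    using fwedge_commute[OF df Tf] by (simp add: form_scale_minus_one)
  finally show "fwedge (T_form A q b t) (\<eta> + ext_d f) = ext_d (- fwedge f (T_form A q b t))"
    unfolding ext_d_uminus[OF fT] fwedge_add_right z by simp
  show "- fwedge f (T_form A q b t) \<in> ideal_power A (F t) q (2 * q + 1)"
    using ideal_power_scale[OF ideal_power_fwedge[OF form_ideal_power_0[OF f] T], of "-1"]
    by (simp add: form_scale_minus_one)
qed

text \<open>The primitive \<open>W\<close> from \<open>T_form_change\<close> lies in the \<open>q\<close>-th power of the ideal, so \<open>W \<and> d b' = 0\<close> and
\<open>d W \<and> b'\<close> is the exterior derivative of \<open>W \<and> b'\<close>.\<close>

lemma TGV_form_change:
  assumes b: "leafwise_closed_family A J F b" and b': "leafwise_closed_family A J F b'"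
    and h: "smooth_form_family A 0 J h"
    and g: "\<And>s. s \<in> J \<Longrightarrow> b' s - b s - ext_d (h s) \<in> ideal_power A (F s) 1 1" and t: "t \<in> J"
  shows "\<exists>W\<in>ideal_power A (F t) q (2 * q + 1).
    fwedge (T_form A q b' t) (b' t) = fwedge (T_form A q b t) (b t) + ext_d W"
proof -
  obtain W where W: "W \<in> ideal_power A (F t) q (2 * q)" "T_form A q b' t - T_form A q b t = ext_d W"
    using T_form_change[OF b b' h g t] by blast
  note Wf = ideal_power_form[OF W(1)]
  have z: "fwedge W (ext_d (b' t)) = 0"
    by (rule ideal_power_top[OF bspec[OF codim t]]) (use ideal_power_fwedge[OF W(1) leafwise_closed_ideal[OF b' t]] in simp)
  have 1: "fwedge (T_form A q b' t - T_form A q b t) (b' t) = ext_d (fwedge W (b' t))"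
    unfolding ext_d_fwedge[OF Wf leafwise_closed_form[OF b' t]] z form_scale_0 W(2) by (rule add_0_right[symmetric])
  have Wb: "fwedge W (b' t) \<in> ideal_power A (F t) q (2 * q + 1)"
    using ideal_power_fwedge[OF W(1) form_ideal_power_0[OF leafwise_closed_form[OF b' t]]] by simp
  obtain V where V: "V \<in> ideal_power A (F t) q (2 * q + 1)"
    "fwedge (T_form A q b t) ((b' t - b t - ext_d (h t)) + ext_d (h t)) = ext_d V"
    using T_form_times_leafwise_exact[OF b t g[OF t] family_form[OF h t]] by blast
  have "fwedge (T_form A q b' t) (b' t) = fwedge (T_form A q b t) (b t) + ext_d (fwedge W (b' t) + V)"
    unfolding ext_d_add[OF ideal_power_form[OF Wb] ideal_power_form[OF V(1)]] 1[symmetric] V(2)[symmetric]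
      fwedge_diff_left fwedge_diff_right fwedge_add_right by simp
  then show ?thesis using ideal_power_add[OF Wb V(1)] by blast
qed

text \<open>With \<open>V = b \<and> u \<and> (d b)^m\<close> and \<open>u\<close> the time derivative of \<open>b\<close>, the product rule gives
\<open>d V = T - b \<and> d u \<and> (d b)^m\<close>, and the last term occurs \<open>q\<close> times in the derivative of \<open>b \<and> (d b)^q\<close>. The \<open>m\<close> factors
\<open>d b\<close> are the only ones in the ideal; this is where \<open>q \<ge> 2\<close> enters.\<close>

lemma GV_form_derivative:
  assumes b: "leafwise_closed_family A J F b" and t: "t \<in> J" and q: "q = Suc m"
  shows "\<exists>V\<in>ideal_power A (F t) m (2 * q).
    form_dt (\<lambda>s. GV_form A q (b s)) t = form_scale (real q + 1) (T_form A q b t) - form_scale (real q) (ext_d V)"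
    and "form_dt (\<lambda>s. GV_form A q (b s)) t \<in> ideal_power A (F t) m (2 * q + 1)"
proof -
  let ?a = "ext_d (b t)" and ?u = "form_dt b t"
  let ?p = "form_pow A ?a m"
  note u = leafwise_closed_dt_form[OF b t] and a = leafwise_closed_d_form[OF b t] and p = leafwise_closed_pow_form[OF b t, of m] and du = leafwise_closed_dt_d_form[OF b t]
  have up: "form A (1 + 2 * m) (fwedge ?u ?p)" by (rule form_fwedge[OF u p])
  have dt: "form_dt (\<lambda>s. GV_form A q (b s)) t =
      T_form A q b t + form_scale (real q) (fwedge (b t) (fwedge (ext_d ?u) ?p))"
    unfolding GV_form_def form_dt_fwedge[OF leafwise_closed_smooth[OF b] leafwise_closed_pow_fam[OF b] t] leafwise_closed_dt_pow[OF b t]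
      fwedge_scale_right T_form_def by (simp add: q)
  have "ext_d (fwedge ?u ?p) = fwedge (ext_d ?u) ?p"
    unfolding ext_d_fwedge[OF u p] leafwise_closed_pow_closed[OF b t] fwedge_0_right form_scale_0 by (rule add_0_right)
  moreover have "fwedge ?a (fwedge ?u ?p) = T_form A q b t"
    using fwedge_commute_even[OF a u] fwedge_assoc[OF a u p] fwedge_assoc[OF u a p]
    by (simp add: T_form_def q form_pow_Suc)
  ultimately have dV: "ext_d (fwedge (b t) (fwedge ?u ?p)) = T_form A q b t - fwedge (b t) (fwedge (ext_d ?u) ?p)"
    unfolding ext_d_fwedge[OF leafwise_closed_form[OF b t] up] by (simp add: form_scale_minus_one)
  have "form_dt (\<lambda>s. GV_form A q (b s)) t =
      form_scale (real q + 1) (T_form A q b t) - form_scale (real q) (ext_d (fwedge (b t) (fwedge ?u ?p)))"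
    unfolding dt dV by (simp add: fun_eq_iff form_scale_def algebra_simps)
  moreover have "fwedge (b t) (fwedge ?u ?p) \<in> ideal_power A (F t) m (2 * q)"
    using ideal_power_fwedge[OF form_ideal_power_0[OF leafwise_closed_form[OF b t]]
      ideal_power_fwedge[OF form_ideal_power_0[OF u] leafwise_closed_pow_ideal[OF b t, of m]]] by (simp add: q)
  ultimately show "\<exists>V\<in>ideal_power A (F t) m (2 * q).
    form_dt (\<lambda>s. GV_form A q (b s)) t = form_scale (real q + 1) (T_form A q b t) - form_scale (real q) (ext_d V)" by blast
  have "fwedge (b t) (fwedge (ext_d ?u) ?p) \<in> ideal_power A (F t) m (2 * q + 1)"
    using ideal_power_fwedge[OF form_ideal_power_0[OF leafwise_closed_form[OF b t]]
      ideal_power_fwedge[OF form_ideal_power_0[OF du] leafwise_closed_pow_ideal[OF b t, of m]]] by (simp add: q)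
  then show "form_dt (\<lambda>s. GV_form A q (b s)) t \<in> ideal_power A (F t) m (2 * q + 1)"
    unfolding dt using ideal_power_mono[OF T_form_ideal_power[OF b t], of m] q
    by (intro ideal_power_add ideal_power_scale) auto
qed

end

end

section \<open>Comparison of defining forms\<close>

lemma family_function_form:
  assumes sm: "\<And>c. c \<in> A \<Longrightarrow> smooth_on (\<lambda>(t, x). g t c x) (J \<times> im c)"
    and comp: "\<And>t c c' p. t \<in> J \<Longrightarrow> c \<in> A \<Longrightarrow> c' \<in> A \<Longrightarrow> p \<in> fst c \<Longrightarrow> p \<in> fst c' \<Longrightarrow>
      g t c (snd c p) = g t c' (snd c' p)"
  shows "smooth_form_family A 0 J (\<lambda>t. function_form A (g t))"
proof (rule familyI)
  fix t assume t: "t \<in> J"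
  show "form A 0 (function_form A (g t))"
  proof (rule formI)
    show "function_form A (g t) c x = 0" if "c \<notin> A \<or> x \<notin> im c" for c x
      using that by (auto simp: fun_eq_iff function_form_def)
  next
    fix c assume c: "c \<in> A"
    note U = open_im[OF c]
    have "smooth_on (\<lambda>x. g t c x) (im c)" using smooth_on_slice[OF openJ U sm[OF c] t] by simp
    then have "smooth_ext_on 0 (im c) (\<lambda>x. ext_scale (g t c x) ext_one)"
      unfolding smooth_ext_on_def by (auto intro!: alt_form_scale alt_form_one smooth_on_mult U)
    then show "smooth_ext_on 0 (im c) (function_form A (g t) c)"
      by (rule smooth_ext_on_cong[OF U]) (simp add: function_form_at[OF c])
  next
    fix c c' p and vs :: "'e list" assume *: "c \<in> A" "c' \<in> A" "p \<in> fst c" "p \<in> fst c'"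
    then have "snd c p \<in> im c" "snd c' p \<in> im c'" by (auto simp: im_def)
    then show "function_form A (g t) c (snd c p) vs = function_form A (g t) c' (snd c' p) (map (tangent_map c c' p) vs)"
      using comp[OF t *] * by (simp add: function_form_at ext_one_def)
  qed
next
  fix c and vs :: "'e list" assume c: "c \<in> A"
  have "smooth_on (\<lambda>z. (\<lambda>(t, x). g t c x) z * ext_one vs) (J \<times> im c)"
    by (intro smooth_on_mult smooth_on_const sm[OF c] open_Times openJ open_im[OF c])
  then show "smooth_on (\<lambda>(t, x). function_form A (g t) c x vs) (J \<times> im c)"
    by (rule smooth_on_cong[OF open_Times[OF openJ open_im[OF c]], rotated]) (auto simp: function_form_at[OF c])
qed

text \<open>The logarithmic derivative, as an identity of one-forms.\<close>

lemma ext_d_function_form_ln: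
  assumes sm: "smooth_on (g c) (im c)" and pos: "\<And>y. y \<in> im c \<Longrightarrow> 0 < g c y" and c: "c \<in> A" "x \<in> im c"
  shows "ext_d (function_form A g) c x = ext_scale (g c x) (ext_d (function_form A (\<lambda>c y. ln (g c y))) c x)"
proof -
  note U = open_im[OF c(1)]
  have 1: "dir_deriv v (function_form A g c) x vs = frechet_derivative (g c) (at x) v * ext_one vs" for v vs
  proof (rule dir_derivI, rule has_derivative_transform_within_open[OF _ U c(2)])
    show "((\<lambda>y. g c y * ext_one vs) has_derivative (\<lambda>v. frechet_derivative (g c) (at x) v * ext_one vs)) (at x)"
      by (intro has_derivative_mult_left smooth_on_has_derivative[OF sm c(2)])
  qed (simp add: function_form_at[OF c(1)])
  have 2: "dir_deriv v (function_form A (\<lambda>c y. ln (g c y)) c) x vs = (frechet_derivative (g c) (at x) v * inverse (g c x)) * ext_one vs" for v vs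
  proof (rule dir_derivI, rule has_derivative_transform_within_open[OF _ U c(2)])
    show "((\<lambda>y. ln (g c y) * ext_one vs) has_derivative (\<lambda>v. (frechet_derivative (g c) (at x) v * inverse (g c x)) * ext_one vs)) (at x)"
      by (intro has_derivative_mult_left has_derivative_ln_comp[OF sm c(2) pos[OF c(2)]])
  qed (simp add: function_form_at[OF c(1)])
  show ?thesis using pos[OF c(2)] c
    by (simp add: fun_eq_iff ext_d_at extd_eq_dir_deriv 1 2 sum_distrib_left field_simps)
qed

text \<open>Differentiating \<open>d\<alpha> = \<alpha> \<and> \<beta>\<close> and using \<open>\<beta> \<and> \<beta> = 0\<close> gives \<open>\<alpha> \<and> d\<beta> = 0\<close>.\<close>

lemma defining_family_leafwise_closed:
  assumes df: "defining_family A q J F \<alpha> \<beta>"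
  shows "leafwise_closed_family A J F \<beta>"
  unfolding leafwise_closed_family_def
proof (intro conjI ballI defining_familyD(2)[OF df])
  fix t assume t: "t \<in> J"
  note a = family_form[OF defining_familyD(1)[OF df] t]
  note b = family_form[OF defining_familyD(2)[OF df] t]
  note da = defining_familyD(4)[OF df t]
  have db: "form A 2 (ext_d (\<beta> t))" using form_ext_d[OF b] by (simp add: numeral_2_eq_2)
  have bb: "fwedge (\<beta> t) (\<beta> t) = 0" by (rule fwedge_self_odd[OF b]) simp
  have "0 = ext_d (ext_d (\<alpha> t))" by (rule ext_d_ext_d[OF a, symmetric])
  also have "\<dots> = form_scale ((-1) ^ q) (fwedge (\<alpha> t) (ext_d (\<beta> t)))"
    unfolding da ext_d_fwedge[OF a b] fwedge_assoc[OF a b b] bb fwedge_0_right by (rule add_0)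
  finally have "fwedge (\<alpha> t) (ext_d (\<beta> t)) = 0" by (auto simp: fun_eq_iff form_scale_def)
  then show "ext_d (\<beta> t) \<in> ideal_power A (F t) 1 2"
    by (rule fwedge_eq_0_imp_ideal[OF defining_familyD(3)[OF df t] db])
qed

text \<open>Pointwise, both forms lie on the determinant line of the conormal space; they are positive on the same tuples.\<close>

lemma defining_forms_proportional:
  assumes fol: "smooth_foliation_family M A q J F" and q: "1 \<le> q"
    and df: "defining_family A q J F \<alpha> \<beta>" and df': "defining_family A q J F \<alpha>' \<beta>'"
    and t: "t \<in> J" and c: "c \<in> A" "x \<in> im c"
  shows "\<exists>r>0. \<forall>us. \<alpha>' t c x us = r * \<alpha> t c x us"
proof -
  note d = defining_familyD(3)[OF df t] and d' = defining_familyD(3)[OF df' t]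
  obtain N as where N: "(t, x) \<in> N" "\<forall>(t, x)\<in>N. oriented_coframe q (F t) c x (map (\<lambda>a. a (t, x)) as)"
    using fol t c unfolding smooth_foliation_family_def by meson
  then have "oriented_coframe q (F t) c x (map (\<lambda>a. a (t, x)) as)" by auto
  then obtain vs where vs: "vs \<in> pos_tuples (F t) c x" using oriented_coframe_pos_tuple q by blast
  have "\<forall>c\<in>A. \<forall>x\<in>im c. \<forall>vs\<in>pos_tuples (F t) c x. 0 < \<alpha> t c x vs"
    using d unfolding defining_form_def by (elim conjE)
  moreover have "\<forall>c\<in>A. \<forall>x\<in>im c. \<forall>vs\<in>pos_tuples (F t) c x. 0 < \<alpha>' t c x vs"
    using d' unfolding defining_form_def by (elim conjE)
  ultimately have pos: "\<alpha> t c x vs > 0" "\<alpha>' t c x vs > 0"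
    using vs c by blast+
  have "\<alpha>' t c x us = \<alpha>' t c x vs / \<alpha> t c x vs * \<alpha> t c x us" for us
    using vanishing_proportional[OF defining_form_at(1,2)[OF d c] defining_form_at(1,2)[OF d' c] defining_form_at(3)[OF d c], of vs us] pos
    by (simp add: field_simps)
  moreover have "0 < \<alpha>' t c x vs / \<alpha> t c x vs" using pos by simp
  ultimately show ?thesis by blast
qed

text \<open>With \<open>\<alpha>' = r \<alpha>\<close>, the two equations give \<open>\<alpha> \<and> (\<beta>' - \<beta>) = (dr / r) \<and> \<alpha>\<close>. Hence \<open>\<beta>' - \<beta>\<close> and
\<open>(-1)^q d (ln r)\<close> have the same product with \<open>\<alpha>\<close> and differ by an element of the ideal.\<close>

lemma defining_families_compare:
  assumes fol: "smooth_foliation_family M A q J F" and q: "1 \<le> q"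
    and df: "defining_family A q J F \<alpha> \<beta>" and df': "defining_family A q J F \<alpha>' \<beta>'"
  shows "\<exists>h. smooth_form_family A 0 J h \<and> (\<forall>t\<in>J. \<beta>' t - \<beta> t - ext_d (h t) \<in> ideal_power A (F t) 1 1)"
proof -
  define r where "r t c x = (SOME r. r > 0 \<and> (\<forall>us. \<alpha>' t c x us = r * \<alpha> t c x us))" for t c x
  have r: "r t c x > 0 \<and> (\<forall>us. \<alpha>' t c x us = r t c x * \<alpha> t c x us)" if "t \<in> J" "c \<in> A" "x \<in> im c" for t c x
    unfolding r_def by (rule someI_ex[OF defining_forms_proportional[OF fol q df df' that]])
  have nz: "\<exists>us. \<alpha> t c x us \<noteq> 0" if "t \<in> J" "c \<in> A" "x \<in> im c" for t c x
    using defining_form_at(4)[OF defining_familyD(3)[OF df that(1)] that(2,3)] .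
  \<comment> \<open>Locally, \<open>r\<close> is the quotient of the values of the two forms on one fixed tuple.\<close>
  have sm: "smooth_on (\<lambda>(t, x). r t c x) (J \<times> im c)" if c: "c \<in> A" for c
  proof (rule smooth_on_local)
    fix z assume z: "z \<in> J \<times> im c"
    let ?W = "J \<times> im c"
    obtain us where us: "\<alpha> (fst z) c (snd z) us \<noteq> 0" using nz[of "fst z" c "snd z"] z c by auto
    have sa: "smooth_on (\<lambda>(t, x). \<alpha> t c x us) ?W" "smooth_on (\<lambda>(t, x). \<alpha>' t c x us) ?W"
      using smooth_ext_on_smooth[OF family_smooth[OF defining_familyD(1)[OF df] c], of us]
        smooth_ext_on_smooth[OF family_smooth[OF defining_familyD(1)[OF df'] c], of us]
      by (simp_all add: case_prod_unfold)
    have W: "open ?W" by (rule open_Times[OF openJ open_im[OF c]])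
    define N where "N = ?W \<inter> (\<lambda>(t, x). \<alpha> t c x us) -` (- {0})"
    have N: "open N"
      unfolding N_def by (rule continuous_open_preimage[OF smooth_on_continuous_on[OF sa(1)] W]) auto
    have NW: "N \<subseteq> ?W" and zN: "z \<in> N" using us z by (auto simp: N_def case_prod_unfold)
    have "smooth_on (\<lambda>z. (\<lambda>(t, x). \<alpha>' t c x us) z * inverse ((\<lambda>(t, x). \<alpha> t c x us) z)) N"
      by (intro smooth_on_mult smooth_on_inverse N smooth_on_subset[OF sa(1) NW] smooth_on_subset[OF sa(2) NW])
        (auto simp: N_def)
    then have "smooth_on (\<lambda>(t, x). r t c x) N"
    proof (rule smooth_on_cong[OF N, rotated])
      fix y assume y: "y \<in> N"
      then have "\<alpha> (fst y) c (snd y) us \<noteq> 0" "fst y \<in> J" "snd y \<in> im c" by (auto simp: N_def case_prod_unfold)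
      then show "(\<lambda>(t, x). \<alpha>' t c x us) y * inverse ((\<lambda>(t, x). \<alpha> t c x us) y) = (\<lambda>(t, x). r t c x) y"
        using r[of "fst y" c "snd y"] c by (simp add: case_prod_unfold)
    qed
    then show "\<exists>N. open N \<and> z \<in> N \<and> smooth_on (\<lambda>(t, x). r t c x) N" using N zN by blast
  qed
  have comp: "r t c (snd c p) = r t c' (snd c' p)"
    if t: "t \<in> J" and *: "c \<in> A" "c' \<in> A" "p \<in> fst c" "p \<in> fst c'" for t c c' p
  proof -
    have im: "snd c p \<in> im c" "snd c' p \<in> im c'" using * by (auto simp: im_def)
    obtain us where us: "\<alpha> t c (snd c p) us \<noteq> 0" using nz[OF t *(1) im(1)] by blast
    have "\<alpha>' t c (snd c p) us = r t c' (snd c' p) * \<alpha> t c (snd c p) us"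
      using form_compat[OF family_form[OF defining_familyD(1)[OF df] t] *, of us]
        form_compat[OF family_form[OF defining_familyD(1)[OF df'] t] *, of us] r[OF t *(2) im(2)] by simp
    then show ?thesis using r[OF t *(1) im(1)] us by simp
  qed
  define l where "l t = function_form A (\<lambda>c x. ln (r t c x))" for t
  have l: "smooth_form_family A 0 J l"
    unfolding l_def
  proof (rule family_function_form)
    fix c assume c: "c \<in> A"
    have "smooth_on (\<lambda>z. ln ((\<lambda>(t, x). r t c x) z)) (J \<times> im c)"
    proof (rule smooth_on_ln[OF open_Times[OF openJ open_im[OF c]] sm[OF c]])
      fix z assume "z \<in> J \<times> im c"
      then show "0 < (case z of (t, x) \<Rightarrow> r t c x)" using r[of "fst z" c "snd z"] c by (simp add: case_prod_unfold mem_Times_iff)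
    qed
    then show "smooth_on (\<lambda>(t, x). ln (r t c x)) (J \<times> im c)" by (simp add: case_prod_unfold)
  next
    fix t c c' p assume "t \<in> J" "c \<in> A" "c' \<in> A" "p \<in> fst c" "p \<in> fst c'"
    from comp[OF this] show "ln (r t c (snd c p)) = ln (r t c' (snd c' p))" by (rule arg_cong)
  qed
  have R: "smooth_form_family A 0 J (\<lambda>t. function_form A (r t))" by (rule family_function_form[OF sm comp])
  let ?s = "(-1) ^ q :: real"
  show ?thesis
  proof (intro exI[of _ "\<lambda>t. form_scale ?s (l t)"] conjI ballI)
    show "smooth_form_family A 0 J (\<lambda>t. form_scale ?s (l t))" by (rule family_scale[OF l])
    fix t assume t: "t \<in> J"
    note a = family_form[OF defining_familyD(1)[OF df] t] and a' = family_form[OF defining_familyD(1)[OF df'] t]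
    note b = family_form[OF defining_familyD(2)[OF df] t] and b' = family_form[OF defining_familyD(2)[OF df'] t]
    note fl = family_form[OF l t] and fR = family_form[OF R t]
    have dl: "form A 1 (ext_d (l t))" using form_ext_d[OF fl] by simp
    have dh: "ext_d (form_scale ?s (l t)) = form_scale ?s (ext_d (l t))" by (rule ext_d_scale[OF fl])
    let ?\<delta> = "\<beta>' t - \<beta> t - ext_d (form_scale ?s (l t))"
    have f\<delta>: "form A 1 ?\<delta>"
      unfolding dh by (intro form_diff b b' form_form_scale dl)
    have Ra: "fwedge (function_form A (r t)) (\<alpha> t) = \<alpha>' t"
    proof (rule form_eqI[OF _ a'])
      show "form A q (fwedge (function_form A (r t)) (\<alpha> t))" using form_fwedge[OF fR a] by simp
      fix c and x :: 'e assume c: "c \<in> A" "x \<in> im c"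
      show "fwedge (function_form A (r t)) (\<alpha> t) c x = \<alpha>' t c x"
        unfolding fwedge_def function_form_at[OF c] wedge_scale_left wedge_one_left[OF form_alt[OF a]] using r[OF t c] by (simp add: fun_eq_iff)
    qed
    have key: "fwedge (ext_d (function_form A (r t))) (\<alpha> t) + fwedge (function_form A (r t)) (fwedge (\<alpha> t) (\<beta> t)) = fwedge (\<alpha>' t) (\<beta>' t)"
    proof -
      have "ext_d (\<alpha>' t) = fwedge (ext_d (function_form A (r t))) (\<alpha> t) + form_scale ((-1) ^ 0) (fwedge (function_form A (r t)) (ext_d (\<alpha> t)))"
        unfolding Ra[symmetric] by (rule ext_d_fwedge[OF fR a])
      then show ?thesis unfolding defining_familyD(4)[OF df t] defining_familyD(4)[OF df' t]
        by (simp add: form_scale_one)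
    qed
    have "fwedge (\<alpha> t) ?\<delta> = 0"
    proof (rule form_eqI[OF form_fwedge[OF a f\<delta>] form_0])
      fix c and x :: 'e assume c: "c \<in> A" "x \<in> im c"
      let ?r = "r t c x" and ?a = "\<alpha> t c x"
      have r0: "?r > 0" and ra: "\<alpha>' t c x = ext_scale ?r ?a" using r[OF t c] by (auto simp: fun_eq_iff)
      have "smooth_on (r t c) (im c)" using smooth_on_slice[OF openJ open_im[OF c(1)] sm[OF c(1)] t] by simp
      then have dR: "ext_d (function_form A (r t)) c x = ext_scale ?r (ext_d (l t) c x)"
        unfolding l_def by (rule ext_d_function_form_ln[of "r t", OF _ _ c]) (use r[OF t c(1)] in blast)
      have comm: "wedge (ext_d (l t) c x) ?a = ext_scale ?s (wedge ?a (ext_d (l t) c x))"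
        using wedge_commute[OF form_alt[OF dl] form_alt[OF a], of c x c x] by simp
      have fab: "alt_form (q + 1) (wedge ?a (\<beta> t c x))" by (rule alt_form_wedge[OF form_alt[OF a] form_alt[OF b]])
      have "wedge (ext_d (function_form A (r t)) c x) ?a + wedge (function_form A (r t) c x) (wedge ?a (\<beta> t c x)) = wedge (\<alpha>' t c x) (\<beta>' t c x)"
        using fun_cong[OF fun_cong[OF key, of c], of x] by (simp only: fwedge_def plus_fun_apply)
      then have e: "ext_scale ?r (wedge (ext_d (l t) c x) ?a) + ext_scale ?r (wedge ?a (\<beta> t c x)) = ext_scale ?r (wedge ?a (\<beta>' t c x))"
        unfolding dR ra function_form_at[OF c] wedge_scale_left wedge_one_left[OF fab] .
      have "wedge ?a (?\<delta> c x) vs = 0" for vs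
      proof -
        have "?r * (?s * wedge ?a (ext_d (l t) c x) vs + wedge ?a (\<beta> t c x) vs) = ?r * wedge ?a (\<beta>' t c x) vs"
          using fun_cong[OF e, of vs] unfolding comm by (simp add: distrib_left)
        then have "?s * wedge ?a (ext_d (l t) c x) vs + wedge ?a (\<beta> t c x) vs = wedge ?a (\<beta>' t c x) vs"
          using r0 by simp
        then show ?thesis
          unfolding dh minus_apply form_scale_at wedge_diff_right wedge_scale_right by simp
      qed
      then show "fwedge (\<alpha> t) ?\<delta> c x = 0 c x" by (simp add: fun_eq_iff fwedge_def)
    qed
    then show "?\<delta> \<in> ideal_power A (F t) 1 1"
      by (rule fwedge_eq_0_imp_ideal[OF defining_familyD(3)[OF df t] f\<delta>])
  qed
qed

end

end

section \<open>The class of a family of foliations\<close>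

theorem theorem16:
  fixes M :: "'a topology" and A :: "('a, 'e::euclidean_space) chart set"
    and q :: nat and J :: "real set"
    and F :: "real \<Rightarrow> ('a, 'e) foliation"
    and \<alpha> \<beta> :: "real \<Rightarrow> ('a, 'e) dform"
  assumes "smooth_manifold M A" and "1 \<le> q"
    and "open J" and "is_interval J"
    and "smooth_foliation_family M A q J F"
    and "defining_family A q J F \<alpha> \<beta>"
  shows
    "(\<forall>t\<in>J.
        T_form A q \<beta> t \<in> ideal A (F t) (2 * q + 1) \<and>
        ext_d (T_form A q \<beta> t) = 0 \<and>
        T_class A q F \<beta> t \<in> coh A (F t) (2 * q + 1) \<and>
        (\<forall>\<alpha>' \<beta>'. defining_family A q J F \<alpha>' \<beta>' \<longrightarrow> T_class A q F \<beta>' t = T_class A q F \<beta> t)) \<and>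
     (2 \<le> q \<longrightarrow> (\<forall>t\<in>J.
        GV_deriv_class A q F \<beta> t \<in> coh A (F t) (2 * q + 1) \<and>
        T_class A q F \<beta> t =
          coh_scale A (F t) (2 * q + 1) (1 / (real q + 1)) (GV_deriv_class A q F \<beta> t))) \<and>
     (\<forall>t\<in>J.
        TGV_class A q F \<beta> t \<in> coh A (F t) (2 * q + 2) \<and>
        \<beta> t \<in> reeb_class A (F t) (\<beta> t) \<and>
        (\<forall>\<rho>\<in>reeb_class A (F t) (\<beta> t).
           coh_class A (F t) (2 * q + 2) (fwedge (T_form A q \<beta> t) \<rho>) = TGV_class A q F \<beta> t) \<and>
        (\<forall>\<alpha>' \<beta>'. defining_family A q J F \<alpha>' \<beta>' \<longrightarrow> TGV_class A q F \<beta>' t = TGV_class A q F \<beta> t)) \<and>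
     (\<exists>\<epsilon>\<in>{1, -1}. \<forall>t\<in>J.
        form_scale \<epsilon> (fwedge (fwedge (form_dt \<beta> t) (\<beta> t)) (form_pow A (ext_d (\<beta> t)) q))
          \<in> TGV_class A q F \<beta> t)"
proof -
  note mfd = assms(1) and q = assms(2) and openJ = assms(3) and fol = assms(5) and df = assms(6)
  have codim: "\<forall>t\<in>J. codimension_le A (F t) q" using defining_family_codimension[OF df] by blast
  note lc = defining_family_leafwise_closed[OF mfd openJ]
  note b = lc[OF df]
  have I: "\<omega> \<in> ideal A (F t) k" if "\<omega> \<in> ideal_power A (F t) p k" "1 \<le> p" for \<omega> t p k
    using ideal_power_mono[OF that] by (simp add: ideal_eq_ideal_power)
  have k1: "2 * q + 1 = Suc (2 * q)" and k2: "2 * q + 2 = Suc (2 * q + 1)" by simp_all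
  have T_ideal: "T_form A q b t \<in> ideal A (F t) (Suc (2 * q))" if "leafwise_closed_family A J F b" "t \<in> J" for b t
    using I[OF T_form_ideal_power[OF mfd openJ codim that] q] by (simp add: k1)
  note T_closed = ext_d_T_form[OF mfd openJ codim]
  have TGV_ideal: "fwedge (T_form A q b t) \<rho> \<in> ideal A (F t) (Suc (2 * q + 1))"
    and TGV_closed: "ext_d (fwedge (T_form A q b t) \<rho>) = 0"
    if "leafwise_closed_family A J F b" "t \<in> J" "form A 1 \<rho>" "ext_d \<rho> \<in> ideal_power A (F t) 1 2" for b t \<rho>
    using I[OF T_form_times_cocycle(1)[OF mfd openJ codim that] q] T_form_times_cocycle(2)[OF mfd openJ codim that]
    by (simp_all add: k2)
  have b_form: "form A 1 (b t)" "ext_d (b t) \<in> ideal_power A (F t) 1 2"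
    if "leafwise_closed_family A J F b" "t \<in> J" for b t
    using leafwise_closed_form[OF mfd openJ that] leafwise_closed_ideal[OF mfd openJ that] by simp_all
  have TGV_ideal': "fwedge (T_form A q b t) (b t) \<in> ideal A (F t) (Suc (2 * q + 1))"
    and TGV_closed': "ext_d (fwedge (T_form A q b t) (b t)) = 0"
    if "leafwise_closed_family A J F b" "t \<in> J" for b t
    by (rule TGV_ideal[OF that b_form[OF that]], rule TGV_closed[OF that b_form[OF that]])

  have part1: "\<forall>t\<in>J. T_form A q \<beta> t \<in> ideal A (F t) (2 * q + 1) \<and> ext_d (T_form A q \<beta> t) = 0 \<and>
        T_class A q F \<beta> t \<in> coh A (F t) (2 * q + 1) \<and>
        (\<forall>\<alpha>' \<beta>'. defining_family A q J F \<alpha>' \<beta>' \<longrightarrow> T_class A q F \<beta>' t = T_class A q F \<beta> t)"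
  proof (intro ballI conjI allI impI)
    fix t assume t: "t \<in> J"
    show "T_form A q \<beta> t \<in> ideal A (F t) (2 * q + 1)" using T_ideal[OF b t] by (simp add: k1)
    show "ext_d (T_form A q \<beta> t) = 0" by (rule T_closed[OF b t])
    show "T_class A q F \<beta> t \<in> coh A (F t) (2 * q + 1)"
      unfolding T_class_def k1 by (rule coh_class_in_coh[OF mfd T_ideal[OF b t] T_closed[OF b t]])
    fix \<alpha>' \<beta>' assume df': "defining_family A q J F \<alpha>' \<beta>'"
    obtain h where h: "smooth_form_family A 0 J h"
      "\<And>t. t \<in> J \<Longrightarrow> \<beta>' t - \<beta> t - ext_d (h t) \<in> ideal_power A (F t) 1 1"
      using defining_families_compare[OF mfd openJ fol q df df'] by blast
    obtain W where W: "W \<in> ideal_power A (F t) q (2 * q)" "T_form A q \<beta>' t - T_form A q \<beta> t = ext_d W"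
      using T_form_change[OF mfd openJ codim b lc[OF df'] h t] by blast
    show "T_class A q F \<beta>' t = T_class A q F \<beta> t"
      unfolding T_class_def k1
      by (rule cohomologous_classes[OF mfd T_ideal[OF b t] T_closed[OF b t] I[OF W(1) q] T_ideal[OF lc[OF df'] t]])
        (simp add: W(2)[symmetric])
  qed

  have part2: "GV_deriv_class A q F \<beta> t \<in> coh A (F t) (2 * q + 1) \<and>
        T_class A q F \<beta> t = coh_scale A (F t) (2 * q + 1) (1 / (real q + 1)) (GV_deriv_class A q F \<beta> t)"
    if q2: "2 \<le> q" and t: "t \<in> J" for t
  proof -
    let ?D = "form_dt (\<lambda>s. GV_form A q (\<beta> s)) t" and ?r = "1 / (real q + 1)"
    \<comment> \<open>\<open>1 \<le> q - 1\<close> puts \<open>V\<close> below into the ideal.\<close>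
    have m: "q = Suc (q - 1)" "1 \<le> q - 1" using q2 by auto
    obtain V where V: "V \<in> ideal_power A (F t) (q - 1) (2 * q)"
      "?D = form_scale (real q + 1) (T_form A q \<beta> t) - form_scale (real q) (ext_d V)"
      using GV_form_derivative(1)[OF mfd openJ codim b t m(1)] by blast
    note Vf = ideal_power_form[OF V(1)]
    have D_ideal: "?D \<in> ideal A (F t) (Suc (2 * q))"
      using I[OF GV_form_derivative(2)[OF mfd openJ codim b t m(1)] m(2)] by (simp add: k1)
    have Tf: "form A (Suc (2 * q)) (T_form A q \<beta> t)"
      using T_ideal[OF b t] by (simp add: ideal_def)
    have dVf: "form A (Suc (2 * q)) (ext_d V)" by (rule form_ext_d[OF mfd Vf])
    have z: "form_scale r 0 = (0 :: ('a, 'e) dform)" for r by (rule form_scale_0)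
    have D_closed: "ext_d ?D = 0"
      unfolding V(2) ext_d_diff[OF mfd form_form_scale[OF mfd Tf] form_form_scale[OF mfd dVf]]
        ext_d_scale[OF mfd Tf] ext_d_scale[OF mfd dVf] T_closed[OF b t] ext_d_ext_d[OF mfd Vf] z by (rule diff_self)
    have rT: "coh_class A (F t) (Suc (2 * q)) (form_scale ?r \<omega>) = T_class A q F \<beta> t"
      if w: "\<omega> \<in> coh_class A (F t) (Suc (2 * q)) ?D" for \<omega>
    proof -
      have w': "\<omega> \<in> ideal A (F t) (Suc (2 * q))" and "\<omega> - ?D \<in> ext_d ` ideal A (F t) (2 * q)"
        using w by (auto simp: coh_class_def cohomologous_def cocycles_def coboundaries_def)
      then obtain \<xi> where x: "\<xi> \<in> ideal_power A (F t) 1 (2 * q)" "\<omega> - ?D = ext_d \<xi>"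
        by (auto simp: ideal_eq_ideal_power)
      note xf = ideal_power_form[OF x(1)]
      let ?\<theta> = "form_scale ?r \<xi> - form_scale (?r * real q) V"
      have th: "?\<theta> \<in> ideal_power A (F t) 1 (2 * q)"
        by (intro ideal_power_diff[OF mfd] ideal_power_scale[OF mfd] x(1) ideal_power_mono[OF V(1) m(2)])
      have wi: "form_scale ?r \<omega> \<in> ideal A (F t) (Suc (2 * q))"
        using w' ideal_power_scale[OF mfd] by (simp add: ideal_eq_ideal_power)
      have we: "\<omega> = ?D + ext_d \<xi>" using x(2) by (simp add: algebra_simps)
      have ne: "real q + 1 \<noteq> 0" using of_nat_0_le_iff[of q, where 'a=real] by linarith
      have ar: "?r * ((real q + 1) * a - real q * v + x) = a + (?r * x - ?r * real q * v)" for a v x :: real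
      proof -
        have "?r * ((real q + 1) * a) = a" using ne by simp
        then show ?thesis by (simp only: distrib_left right_diff_distrib)
      qed
      have "form_scale ?r \<omega> = T_form A q \<beta> t + ext_d ?\<theta>"
        unfolding we V(2) ext_d_diff[OF mfd form_form_scale[OF mfd xf] form_form_scale[OF mfd Vf]]
          ext_d_scale[OF mfd xf] ext_d_scale[OF mfd Vf]
        by (intro ext) (simp only: form_scale_def plus_fun_apply minus_apply ar)
      then show ?thesis unfolding T_class_def k1
        by (rule cohomologous_classes[OF mfd T_ideal[OF b t] T_closed[OF b t] I[OF th order_refl] wi])
    qed
    show ?thesis
    proof
      show "GV_deriv_class A q F \<beta> t \<in> coh A (F t) (2 * q + 1)"
        unfolding GV_deriv_class_def k1 by (rule coh_class_in_coh[OF mfd D_ideal D_closed])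
      show "T_class A q F \<beta> t = coh_scale A (F t) (2 * q + 1) ?r (GV_deriv_class A q F \<beta> t)"
        unfolding GV_deriv_class_def coh_scale_def k1
        using rT self_in_coh_class[OF mfd D_ideal D_closed] by blast
    qed
  qed

  have part3: "\<forall>t\<in>J.
        TGV_class A q F \<beta> t \<in> coh A (F t) (2 * q + 2) \<and>
        \<beta> t \<in> reeb_class A (F t) (\<beta> t) \<and>
        (\<forall>\<rho>\<in>reeb_class A (F t) (\<beta> t).
           coh_class A (F t) (2 * q + 2) (fwedge (T_form A q \<beta> t) \<rho>) = TGV_class A q F \<beta> t) \<and>
        (\<forall>\<alpha>' \<beta>'. defining_family A q J F \<alpha>' \<beta>' \<longrightarrow> TGV_class A q F \<beta>' t = TGV_class A q F \<beta> t)"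
  proof (intro ballI conjI allI impI)
    fix t assume t: "t \<in> J"
    show "TGV_class A q F \<beta> t \<in> coh A (F t) (2 * q + 2)"
      unfolding TGV_class_def k2 by (rule coh_class_in_coh[OF mfd TGV_ideal'[OF b t] TGV_closed'[OF b t]])
    have "0 \<in> ideal A (F t) 1" by (rule I[OF ideal_power_0[OF mfd] order_refl])
    moreover have "0 \<in> ext_d ` {\<zeta>. form A 0 \<zeta>}" using form_0[OF mfd] ext_d_0 by (metis image_eqI mem_Collect_eq)
    ultimately have "0 + 0 \<in> quot_coboundaries A (F t) 1" unfolding quot_coboundaries_def by fastforce
    moreover have "\<beta> t \<in> quot_cocycles A (F t) 1"
      using b_form[OF b t] by (simp add: quot_cocycles_def ideal_eq_ideal_power numeral_2_eq_2)
    ultimately show "\<beta> t \<in> reeb_class A (F t) (\<beta> t)" by (simp add: reeb_class_def quot_class_def)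
  next
    fix t \<rho> assume t: "t \<in> J" and "\<rho> \<in> reeb_class A (F t) (\<beta> t)"
    then have r: "form A 1 \<rho>" "ext_d \<rho> \<in> ideal_power A (F t) 1 2" and "\<rho> - \<beta> t \<in> quot_coboundaries A (F t) 1"
      by (auto simp: reeb_class_def quot_class_def quot_cocycles_def ideal_eq_ideal_power numeral_2_eq_2)
    then obtain \<eta> f where e: "\<eta> \<in> ideal_power A (F t) 1 1" "form A 0 f" "\<rho> - \<beta> t = \<eta> + ext_d f"
      by (auto simp: quot_coboundaries_def ideal_eq_ideal_power)
    obtain W where W: "W \<in> ideal_power A (F t) q (2 * q + 1)" "fwedge (T_form A q \<beta> t) (\<eta> + ext_d f) = ext_d W"
      using T_form_times_leafwise_exact[OF mfd openJ codim b t e(1,2)] by blast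
    have "fwedge (T_form A q \<beta> t) \<rho> = fwedge (T_form A q \<beta> t) (\<beta> t) + ext_d W"
      unfolding W(2)[symmetric] e(3)[symmetric] fwedge_diff_right by simp
    then show "coh_class A (F t) (2 * q + 2) (fwedge (T_form A q \<beta> t) \<rho>) = TGV_class A q F \<beta> t"
      unfolding TGV_class_def k2
      by (rule cohomologous_classes[OF mfd TGV_ideal'[OF b t] TGV_closed'[OF b t] I[OF W(1) q] TGV_ideal[OF b t r]])
  next
    fix t \<alpha>' \<beta>' assume t: "t \<in> J" and df': "defining_family A q J F \<alpha>' \<beta>'"
    note b' = lc[OF df']
    obtain h where h: "smooth_form_family A 0 J h"
      "\<And>t. t \<in> J \<Longrightarrow> \<beta>' t - \<beta> t - ext_d (h t) \<in> ideal_power A (F t) 1 1"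
      using defining_families_compare[OF mfd openJ fol q df df'] by blast
    obtain W where W: "W \<in> ideal_power A (F t) q (2 * q + 1)"
      "fwedge (T_form A q \<beta>' t) (\<beta>' t) = fwedge (T_form A q \<beta> t) (\<beta> t) + ext_d W"
      using TGV_form_change[OF mfd openJ codim b b' h t] by blast
    show "TGV_class A q F \<beta>' t = TGV_class A q F \<beta> t"
      unfolding TGV_class_def k2
      by (rule cohomologous_classes[OF mfd TGV_ideal'[OF b t] TGV_closed'[OF b t] I[OF W(1) q] TGV_ideal'[OF b' t] W(2)])
  qed

  have part4: "form_scale 1 (fwedge (fwedge (form_dt \<beta> t) (\<beta> t)) (form_pow A (ext_d (\<beta> t)) q)) \<in> TGV_class A q F \<beta> t"
    if t: "t \<in> J" for t
  proof -
    note u = leafwise_closed_dt_form[OF mfd openJ b t] and p = leafwise_closed_pow_form[OF mfd openJ b t, of q] and bf = b_form(1)[OF b t]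
    have "fwedge (fwedge (form_dt \<beta> t) (\<beta> t)) (form_pow A (ext_d (\<beta> t)) q) = fwedge (T_form A q \<beta> t) (\<beta> t)"
      unfolding T_form_def fwedge_assoc[OF u bf p] fwedge_assoc[OF u p bf]
      by (subst fwedge_commute_even[OF p bf]) simp_all
    then show ?thesis
      unfolding TGV_class_def k2 form_scale_one
      using self_in_coh_class[OF mfd TGV_ideal'[OF b t] TGV_closed'[OF b t]] by simp
  qed
  \<comment> \<open>The sign is \<open>+1\<close>: moving \<open>\<beta>\<close> past the form \<open>(d\<beta>)^q\<close> of even degree does not change the product.\<close>
  show ?thesis using part1 part2 part3 part4 by blast
qed

end
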